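(* Let $d\ge 1$, $\lambda\in\mathbb{R}\setminus\{0\}$, $T>0$ and $0<s<1$. Assume that $u_0\in L^2(\mathbb{T}^d)$ and that the solution $u$ of the periodic logarithmic Schrödinger equation $$\mathrm{i}\,\partial_t u+\Delta u=\lambda u\ln|u|^2\ \text{ on } \mathbb{T}^d,\qquad u(\cdot,0)=u_0,$$ has the regularity $$u\in C\big((0,T];\,H^s(\mathbb{T}^d)\cap L^\infty(\mathbb{T}^d)\big).$$ Let $\tau>0$ be the time step, $M=[T/\tau]$, $N$ (a positive integer) the Fourier cut-off, and let $u_N^{m+1}$ be the numerical solution given by the Lie-Trotter time-splitting Fourier spectral scheme $$u_N^{0}=\Pi_N^d u_0,\qquad u_N^{m+1}=\Phi_A^\tau\,\Pi_N^d\,\Phi_B^\tau[u_N^m],\quad m=0,1,\dots,M-1.$$ Then, with $u^{m+1}:=u(\cdot,(m+1)\tau)$, $$\|u^{m+1}-u_N^{m+1}\|\le C\,\mathrm{e}^{2|\lambda|T}\,\big(\mathcal{C}(u_0,u)+\ln N\big)\,\big(\tau^{s/2}+N^{-s}\big)\,|u|_{C(H^s)},\qquad m=0,1,\dots,M-1,$$ where $C$ is a positive constant independent of $\tau$, $N$ and any function (it may depend on parameters such as $T,d,s,|\lambda|$), and $$\mathcal{C}(u_0,u):=\ln(\|u_0\|+1)+\ln\big(\|u\|_{C(L^\infty)}+1\big).$$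
   Context: $\mathbb{T}^d=[-\pi,\pi)^d$ is the $d$-dimensional torus with $2\pi$-periodic boundary conditions, $|\mathbb{T}|=2\pi$; functions are complex-valued and $2\pi$-periodic. $\|\cdot\|$ is the $L^2(\mathbb{T}^d)$-norm. For $u\in L^2(\mathbb{T}^d)$ with Fourier coefficients $\hat u_k=|\mathbb{T}|^{-d}\int_{\mathbb{T}^d}u(x)\mathrm{e}^{-\mathrm{i}k\cdot x}\,\mathrm{d}x$, set $\|u\|_{H^s(\mathbb{T}^d)}=|\mathbb{T}|^{d/2}\big(\sum_{k\in\mathbb{Z}^d}(1+|k|^2)^s|\hat u_k|^2\big)^{1/2}$ and $|u|_{H^s(\mathbb{T}^d)}=|\mathbb{T}|^{d/2}\big(\sum_{k\in\mathbb{Z}^d\setminus\{0\}}|k|^{2s}|\hat u_k|^2\big)^{1/2}$; $H^s(\mathbb{T}^d)$ is the space of $u\in L^2(\mathbb{T}^d)$ with finite $\|u\|_{H^s}$. Also $|u|_{C(H^s)}:=\sup_{t\in(0,T]}|u(\cdot,t)|_{H^s(\mathbb{T}^d)}$ and $\|u\|_{C(L^\infty)}:=\sup_{t\in(0,T]}\|u(\cdot,t)\|_{L^\infty(\mathbb{T}^d)}$. The nonlinearity $u\ln|u|^2$ is understood to be $0$ where $u=0$. $\Pi_N^d$ is the $L^2$-orthogonal projection $\Pi_N^d u(x)=\sum_{k\in\mathbb{K}_N^d}\hat u_k\,\mathrm{e}^{\mathrm{i}k\cdot x}$ with $\mathbb{K}_N^d=\{k\in\mathbb{Z}^d:|k_i|\le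 N,\ 1\le i\le d\}$. The flow maps are $\Phi_A^t[v_0]=\mathrm{e}^{\mathrm{i}t\Delta}v_0=\sum_{k\in\mathbb{Z}^d}\mathrm{e}^{-\mathrm{i}|k|^2t}\,\hat v_{0,k}\,\mathrm{e}^{\mathrm{i}k\cdot x}$ and $\Phi_B^t[w_0](x)=\mathrm{e}^{-\mathrm{i}\lambda t\ln|w_0(x)|^2}w_0(x)$, with $\Phi_B^t[w_0](x)=0$ where $w_0(x)=0$. $[T/\tau]$ denotes the integer part. The Fourier coefficients in the scheme are taken to be computed exactly.
   Formalization: The Fourier cut-off N is required to be at least 2; for N = 1 the bound fails, since ln N = 0 and u_0 = ε exp(2i x_1) gives an error of order ε while the right-hand side is of order ε² as ε tends to 0. *)

theory Defs
  imports "HOL-Analysis.Analysis" "HOL-Probability.Essential_Supremum"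
begin

text \<open>
  Functions on the \<open>d\<close>-dimensional torus are \<open>2\<pi>\<close>-periodic functions
  \<open>real^'d \<Rightarrow> complex\<close>, with \<open>d = CARD('d)\<close>; all norms and integrals are taken over the
  fundamental cell, so functions that agree almost everywhere are not distinguished.
  Frequencies are kept as real vectors with integer entries, so that \<open>k \<bullet> x\<close> and \<open>norm k\<close>
  are the library inner product and Euclidean norm.
\<close>

definition torus :: "(real^'d) set" where
  "torus = {x. \<forall>i. - pi \<le> x $ i \<and> x $ i < pi}"

definition periodic :: "(real^'d \<Rightarrow> complex) \<Rightarrow> bool" where
  "periodic f \<longleftrightarrow> (\<forall>x i. f (x + (2 * pi) *\<^sub>R axis i 1) = f x)"

definition int_lattice :: "(real^'d) set" where
  "int_lattice = {k. \<forall>i. k $ i \<in> \<int>}"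


subsection \<open>Function spaces on the torus\<close>

definition L2 :: "(real^'d \<Rightarrow> complex) set" where
  "L2 = {f. periodic f \<and> f \<in> borel_measurable (lebesgue_on torus) \<and>
            integrable (lebesgue_on torus) (\<lambda>x. (cmod (f x))\<^sup>2)}"

definition L2_norm :: "(real^'d \<Rightarrow> complex) \<Rightarrow> real" where
  "L2_norm f = sqrt (LINT x|lebesgue_on torus. (cmod (f x))\<^sup>2)"

definition Linf_norm :: "(real^'d \<Rightarrow> complex) \<Rightarrow> ereal" where
  "Linf_norm f = esssup (lebesgue_on torus) (\<lambda>x. ereal (cmod (f x)))"

definition fourier_coeff :: "(real^'d \<Rightarrow> complex) \<Rightarrow> real^'d \<Rightarrow> complex" where
  "fourier_coeff f k =
     (LINT x|lebesgue_on torus. f x * exp (- \<i> * complex_of_real (k \<bullet> x))) / (2 * pi) ^ CARD('d)"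

definition Hs :: "real \<Rightarrow> (real^'d \<Rightarrow> complex) set" where
  "Hs s = {f \<in> L2. (\<lambda>k. (1 + (norm k)\<^sup>2) powr s * (cmod (fourier_coeff f k))\<^sup>2)
                     summable_on int_lattice}"

definition Hs_norm :: "real \<Rightarrow> (real^'d \<Rightarrow> complex) \<Rightarrow> real" where
  "Hs_norm s f = (2 * pi) powr (real CARD('d) / 2) *
     sqrt (\<Sum>\<^sub>\<infinity>k\<in>int_lattice. (1 + (norm k)\<^sup>2) powr s * (cmod (fourier_coeff f k))\<^sup>2)"

definition Hs_seminorm :: "real \<Rightarrow> (real^'d \<Rightarrow> complex) \<Rightarrow> real" where
  "Hs_seminorm s f = (2 * pi) powr (real CARD('d) / 2) *
     sqrt (\<Sum>\<^sub>\<infinity>k\<in>int_lattice - {0}. norm k powr (2 * s) * (cmod (fourier_coeff f k))\<^sup>2)"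

text \<open>
  \<open>u \<in> C((0,T]; H\<^sup>s \<inter> L\<^sup>\<infinity>)\<close>, continuity being with respect to both norms.  This does not
  bound \<open>u\<close> near \<open>t = 0\<close>, so the suprema over \<open>(0,T]\<close> below are extended reals.
\<close>

definition C_Hs_Linf :: "real \<Rightarrow> real \<Rightarrow> (real \<Rightarrow> real^'d \<Rightarrow> complex) \<Rightarrow> bool" where
  "C_Hs_Linf s T u \<longleftrightarrow>
     (\<forall>t\<in>{0<..T}. u t \<in> Hs s \<and> Linf_norm (u t) < \<infinity> \<and>
        ((\<lambda>t'. Hs_norm s (\<lambda>x. u t' x - u t x)) \<longlongrightarrow> 0) (at t within {0<..T}) \<and>
        ((\<lambda>t'. Linf_norm (\<lambda>x. u t' x - u t x)) \<longlongrightarrow> 0) (at t within {0<..T}))"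

definition sup_Hs_seminorm :: "real \<Rightarrow> real \<Rightarrow> (real \<Rightarrow> real^'d \<Rightarrow> complex) \<Rightarrow> ereal" where
  "sup_Hs_seminorm s T u = (SUP t\<in>{0<..T}. ereal (Hs_seminorm s (u t)))"

definition sup_Linf_norm :: "real \<Rightarrow> (real \<Rightarrow> real^'d \<Rightarrow> complex) \<Rightarrow> ereal" where
  "sup_Linf_norm T u = (SUP t\<in>{0<..T}. Linf_norm (u t))"


subsection \<open>The periodic logarithmic Schroedinger equation\<close>

text \<open>Since \<open>0 * z = 0\<close>, this is \<open>0\<close> at \<open>z = 0\<close>, as required.\<close>

definition log_nonlin :: "complex \<Rightarrow> complex" where
  "log_nonlin z = z * complex_of_real (ln ((cmod z)\<^sup>2))"

definition partial_deriv :: "'d \<Rightarrow> (real^'d \<Rightarrow> complex) \<Rightarrow> real^'d \<Rightarrow> complex" where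
  "partial_deriv i f x = vector_derivative (\<lambda>h. f (x + h *\<^sub>R axis i 1)) (at 0)"

primrec C_k :: "nat \<Rightarrow> (real^'d \<Rightarrow> complex) \<Rightarrow> bool" where
  "C_k 0 f \<longleftrightarrow> continuous_on UNIV f"
| "C_k (Suc n) f \<longleftrightarrow>
     (\<forall>i. (\<forall>x. (\<lambda>h. f (x + h *\<^sub>R axis i 1)) differentiable (at 0)) \<and> C_k n (partial_deriv i f))"

definition test_function :: "(real^'d \<Rightarrow> complex) \<Rightarrow> bool" where
  "test_function \<phi> \<longleftrightarrow> periodic \<phi> \<and> (\<forall>n. C_k n \<phi>)"

definition laplacian :: "(real^'d \<Rightarrow> complex) \<Rightarrow> real^'d \<Rightarrow> complex" where
  "laplacian f x = (\<Sum>i\<in>UNIV. partial_deriv i (partial_deriv i f) x)"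

text \<open>
  For \<open>u(t) \<in> H\<^sup>s\<close> with \<open>s < 1\<close> the equation cannot be read pointwise.  It is taken in the sense
  of periodic distributions at every time \<open>t \<in> (0,T]\<close>,
    \<open>\<i> (d/dt) \<integral> u \<phi> + \<integral> u \<Delta>\<phi> = \<lambda> \<integral> u ln |u|\<^sup>2 \<phi>\<close>  for all smooth periodic \<open>\<phi>\<close>
  (one-sided time derivative at \<open>t = T\<close>), and the initial value is attained in \<open>L\<^sup>2\<close>.
\<close>

definition logSE_solution ::
  "real \<Rightarrow> real \<Rightarrow> (real^'d \<Rightarrow> complex) \<Rightarrow> (real \<Rightarrow> real^'d \<Rightarrow> complex) \<Rightarrow> bool" where
  "logSE_solution lam T u0 u \<longleftrightarrow>
     (\<forall>t\<in>{0<..T}. u t \<in> L2) \<and>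
     (\<forall>\<phi>. test_function \<phi> \<longrightarrow> (\<forall>t\<in>{0<..T}. \<exists>D.
        ((\<lambda>t'. LINT x|lebesgue_on torus. u t' x * \<phi> x) has_vector_derivative D)
           (at t within {0<..T}) \<and>
        \<i> * D + (LINT x|lebesgue_on torus. u t x * laplacian \<phi> x) =
          complex_of_real lam * (LINT x|lebesgue_on torus. log_nonlin (u t x) * \<phi> x))) \<and>
     ((\<lambda>t. L2_norm (\<lambda>x. u t x - u0 x)) \<longlongrightarrow> 0) (at_right 0)"


subsection \<open>The Lie--Trotter Fourier spectral scheme\<close>

definition freqs :: "nat \<Rightarrow> (real^'d) set" where
  "freqs N = {k \<in> int_lattice. \<forall>i. \<bar>k $ i\<bar> \<le> real N}"

definition proj :: "nat \<Rightarrow> (real^'d \<Rightarrow> complex) \<Rightarrow> real^'d \<Rightarrow> complex" where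
  "proj N f x = (\<Sum>k\<in>freqs N. fourier_coeff f k * exp (\<i> * complex_of_real (k \<bullet> x)))"

text \<open>
  The series is summed pointwise in \<open>x\<close>.  The scheme applies \<open>flow_A\<close> only to trigonometric
  polynomials, for which it has finitely many nonzero terms.
\<close>

definition flow_A :: "real \<Rightarrow> (real^'d \<Rightarrow> complex) \<Rightarrow> real^'d \<Rightarrow> complex" where
  "flow_A t v x = (\<Sum>\<^sub>\<infinity>k\<in>int_lattice. exp (- \<i> * complex_of_real ((norm k)\<^sup>2 * t)) *
                     fourier_coeff v k * exp (\<i> * complex_of_real (k \<bullet> x)))"

definition flow_B :: "real \<Rightarrow> real \<Rightarrow> (real^'d \<Rightarrow> complex) \<Rightarrow> real^'d \<Rightarrow> complex" where
  "flow_B lam t w x = exp (- \<i> * complex_of_real (lam * t * ln ((cmod (w x))\<^sup>2))) * w x"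

primrec lie_trotter ::
  "real \<Rightarrow> real \<Rightarrow> nat \<Rightarrow> (real^'d \<Rightarrow> complex) \<Rightarrow> nat \<Rightarrow> real^'d \<Rightarrow> complex" where
  "lie_trotter lam \<tau> N u0 0 = proj N u0"
| "lie_trotter lam \<tau> N u0 (Suc m) = flow_A \<tau> (proj N (flow_B lam \<tau> (lie_trotter lam \<tau> N u0 m)))"


subsection \<open>The constant in the error bound\<close>

text \<open>\<open>ln (x + 1)\<close> for \<open>x \<in> [0,\<infinity>]\<close>\<close>

definition ln1p_ereal :: "ereal \<Rightarrow> ereal" where
  "ln1p_ereal x = (if x = \<infinity> then \<infinity> else ereal (ln (real_of_ereal x + 1)))"

text \<open>
  In the bound below \<open>C_fun\<close> is added to \<open>ln N\<close>, and the result multiplies a quantity that is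
  homogeneous of degree \<open>1\<close> in \<open>u\<close>.  This forces \<open>N \<ge> 2\<close>: with \<open>N = 1\<close> and
  \<open>u0 = \<epsilon> exp (2 \<i> x\<^sub>1)\<close> the solution is \<open>\<epsilon> exp (\<i> (2 x\<^sub>1 - (4 + \<lambda> ln \<epsilon>\<^sup>2) t))\<close> and the numerical
  solution is \<open>0\<close>, so the error is of order \<open>\<epsilon>\<close>, while the bound would be of order \<open>\<epsilon>\<^sup>2\<close>.
\<close>

definition C_fun ::
  "real \<Rightarrow> (real^'d \<Rightarrow> complex) \<Rightarrow> (real \<Rightarrow> real^'d \<Rightarrow> complex) \<Rightarrow> ereal" where
  "C_fun T u0 u = ereal (ln (L2_norm u0 + 1)) + ln1p_ereal (sup_Linf_norm T u)"

end

theory Submission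
  imports Defs "HOL-Probability.Characteristic_Functions"
begin

text \<open>
  Between two time levels, the exact Fourier coefficients and the numerical flow are compared in the
  frame moving with the free flow \<open>S = exp (\<i> \<sigma> \<Delta>)\<close>. There the quasi-monotonicity
  \<open>\<bar>Im ((f z - f w) (z - w)\<^sup>*)\<bar> \<le> 2 \<bar>z - w\<bar>\<^sup>2\<close> of \<open>f z = z ln \<bar>z\<bar>\<^sup>2\<close> yields a Gronwall estimate whose only
  source term is the \<open>L\<^sup>2\<close> norm of a commutator, \<open>\<Pi>\<^sub>N S\<^sup>-\<^sup>1 f(u) - f(\<Pi>\<^sub>N S\<^sup>-\<^sup>1 u)\<close>.

  This commutator is unchanged when a multiple of the identity is subtracted from \<open>f\<close>, so \<open>f\<close> may be
  replaced by \<open>z ln (\<bar>z\<bar>\<^sup>2 / lo\<^sup>2)\<close>. Clamping \<open>\<bar>z\<bar>\<close> to an interval \<open>[lo, hi]\<close> with \<open>ln (hi / lo)\<close> of order \<open>ln N\<close>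
  makes it Lipschitz with constant of order \<open>ln N\<close>; the clamping error is of order \<open>N\<^sup>-\<^sup>s\<close> because a function of
  finite \<open>H\<^sup>s\<close> seminorm exceeds the uniform bound on \<open>\<Pi>\<^sub>n u\<close> only where \<open>u - \<Pi>\<^sub>n u\<close> is comparable to it.
  Lipschitz functions are handled by interpolating between \<open>L\<^sup>2\<close> and \<open>H\<^sup>1\<close>.
\<close>

subsection \<open>The torus and its characters\<close>

text \<open>Two features of the setting shape the argument. The weak formulation gives no time
  derivative of \<open>u\<close> in L2, only one for each Fourier coefficient; hence the squared
  distance to be differentiated is written through the finitely many coefficients in
  \<open>freqs N\<close>. The quasi-monotonicity is pointwise, so within a step the numerical
  solution is kept as the unprojected \<open>flow_B\<close>; projection and free flow act at the end
  of the step, where they do not increase the L2 distance. The 2 in the quasi-monotonicity is the 2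
  in exp (2 |\<lambda>| T). The exponent s/2 comes from a balance: the free flow over time \<tau>
  displaces an H^1 function by order \<tau>^(1/2), and splitting at a frequency n of order
  \<tau>^(-1/2) makes the L2 part n^(-s) and the H^1 part \<tau>^(1/2) n^(1-s) equal. The clamping
  interval is built around the modulus of the mean, which the free flow conserves, so both terms of
  the commutator are clamped alike; the logarithm above the interval is unbounded and is summed over
  dyadic cut-offs.\<close>

abbreviation tm :: "(real^'d) measure" where
  "tm \<equiv> lebesgue_on torus"

lemma torus_borel: "(torus :: (real^'d) set) \<in> sets borel"
proof -
  have "(torus :: (real^'d) set) = (\<Inter>i. {x. - pi \<le> x $ i} \<inter> {x. x $ i < pi})"
    by (auto simp: torus_def)
  also have "\<dots> \<in> sets borel"
    by (intro sets.countable_INT'' countableI_type sets.Int) simp_all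
  finally show ?thesis .
qed

lemma torus_lebesgue [simp]: "(torus :: (real^'d) set) \<in> sets lebesgue"
  using torus_borel by (metis sets_completionI_sets sets_lborel)

text \<open>Fubini: \<open>lborel\<close> on \<open>real^'d\<close> is the image of the product
  measure over \<open>Basis\<close>, and the indicator of the half-open cell factors over the
  coordinates. \<open>inv ?ax\<close> turns basis vectors back into coordinate indices.\<close>

lemma integral_torus_prod:
  fixes f :: "'d::finite \<Rightarrow> real \<Rightarrow> complex"
  assumes f: "\<And>i. continuous_on UNIV (f i)"
  shows "(LINT x|(tm :: (real^'d) measure). (\<Prod>i\<in>UNIV. f i (x $ i))) =
    (\<Prod>i\<in>UNIV. (LINT t|lborel. indicator {-pi..<pi} t *\<^sub>R f i t))"
proof -
  let ?g = "\<lambda>i t. indicator {-pi..<pi} t *\<^sub>R f i t"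
  let ?ax = "\<lambda>i::'d. axis i (1::real)"
  have inj: "inj ?ax" by (auto simp: inj_def axis_eq_axis)
  have Bas: "(Basis :: (real^'d) set) = range ?ax" by (auto simp: Basis_vec_def)
  have [measurable]: "f i \<in> borel_measurable borel" for i
    using f by (intro borel_measurable_continuous_onI)
  have [measurable]: "(\<lambda>x::real^'d. x $ i) \<in> borel_measurable borel" for i
    by (intro borel_measurable_continuous_onI continuous_intros)
  have gm: "?g i \<in> borel_measurable borel" for i
    by measurable
  have Gm: "(\<lambda>x::real^'d. \<Prod>i\<in>UNIV. ?g i (x $ i)) \<in> borel_measurable borel"
    by (intro borel_measurable_prod measurable_compose[OF _ gm]) measurable
  have ind: "indicator torus x *\<^sub>R (\<Prod>i\<in>UNIV. f i (x $ i)) = (\<Prod>i\<in>UNIV. ?g i (x $ i))" for x :: "real^'d"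
  proof -
    have "indicator torus x = (\<Prod>i\<in>UNIV. indicator {-pi..<pi} (x $ i) :: real)"
    proof (cases "x \<in> torus")
      case False
      then obtain i where "x $ i \<notin> {-pi..<pi}" by (auto simp: torus_def)
      then have "(\<Prod>i\<in>UNIV. indicator {-pi..<pi} (x $ i) :: real) = 0"
        by (intro prod_zero bexI[of _ i]) auto
      then show ?thesis using False by simp
    qed (auto simp: torus_def indicator_def intro!: prod.neutral[symmetric])
    then show ?thesis by (simp add: scaleR_conv_of_real prod.distrib)
  qed
  have comp: "(\<Sum>b\<in>Basis. h b *\<^sub>R b) $ i = h (?ax i)" for h :: "real^'d \<Rightarrow> real" and i
  proof -
    have "(\<Sum>b\<in>Basis. h b *\<^sub>R b) $ i = (\<Sum>b\<in>Basis. h b *\<^sub>R b) \<bullet> ?ax i"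
      by (simp add: inner_axis)
    also have "\<dots> = h (?ax i)" by (subst inner_sum_left_Basis) (auto simp: Bas)
    finally show ?thesis .
  qed
  have prod_Basis: "(\<Prod>i\<in>UNIV. ?g i ((\<Sum>b\<in>Basis. h b *\<^sub>R b) $ i)) = (\<Prod>b\<in>Basis. ?g (inv ?ax b) (h b))"
    for h :: "real^'d \<Rightarrow> real"
  proof -
    have "(\<Prod>b\<in>Basis. ?g (inv ?ax b) (h b)) = (\<Prod>i\<in>UNIV. ?g (inv ?ax (?ax i)) (h (?ax i)))"
      unfolding Bas by (subst prod.reindex[OF inj]) simp
    also have "\<dots> = (\<Prod>i\<in>UNIV. ?g i (h (?ax i)))" by (simp only: inv_f_f[OF inj])
    finally show ?thesis by (simp only: comp)
  qed
  interpret product_sigma_finite "\<lambda>b::real^'d. lborel :: real measure" ..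
  have "(LINT x|(tm :: (real^'d) measure). (\<Prod>i\<in>UNIV. f i (x $ i))) =
      (LINT x|lebesgue. (\<Prod>i\<in>UNIV. ?g i ((x::real^'d) $ i)))"
    by (subst integral_restrict_space) (simp_all add: ind)
  also have "\<dots> = (LINT x|lborel. (\<Prod>i\<in>UNIV. ?g i ((x::real^'d) $ i)))"
    by (rule integral_completion) (use Gm in simp)
  also have "\<dots> = (LINT h|(\<Pi>\<^sub>M b\<in>Basis. lborel). (\<Prod>i\<in>UNIV. ?g i ((\<Sum>b\<in>Basis. h b *\<^sub>R b :: real^'d) $ i)))"
    by (subst lborel_eq, rule integral_distr[OF _ Gm]) measurable
  also have "\<dots> = (LINT h|(\<Pi>\<^sub>M b\<in>Basis. lborel). (\<Prod>b\<in>Basis. ?g (inv ?ax b) (h b)))"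
    by (simp only: prod_Basis)
  also have "\<dots> = (\<Prod>b\<in>Basis. (LINT t|lborel. ?g (inv ?ax b) t))"
  proof (rule product_integral_prod)
    fix b :: "real^'d"
    have "set_integrable lborel {-pi..pi} (f (inv ?ax b))"
      unfolding set_integrable_def by (rule borel_integrable_compact) (auto intro: continuous_on_subset[OF f])
    then have "set_integrable lborel {-pi..<pi} (f (inv ?ax b))"
      by (rule set_integrable_subset) auto
    then show "integrable lborel (?g (inv ?ax b))" by (simp add: set_integrable_def)
  qed simp
  also have "\<dots> = (\<Prod>i\<in>UNIV. (LINT t|lborel. ?g i t))"
    by (simp only: Bas prod.reindex[OF inj] o_def inv_f_f[OF inj])
  finally show ?thesis .
qed

definition chr :: "real^'d \<Rightarrow> real^'d \<Rightarrow> complex" where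
  "chr k x = exp (\<i> * complex_of_real (k \<bullet> x))"

lemma chr_zero [simp]: "chr 0 x = 1"
  by (simp add: chr_def)

lemma norm_chr [simp]: "cmod (chr k x) = 1"
  by (simp add: chr_def)

lemma chr_add: "chr (k + l) x = chr k x * chr l x"
  by (simp add: chr_def inner_add_left distrib_left exp_add)

lemma chr_diff: "chr (k - l) x = chr k x * cnj (chr l x)"
  by (simp add: chr_def inner_diff_left exp_cnj algebra_simps flip: exp_add)

lemma chr_shift: "chr k (x + h) = chr k h * chr k x"
  by (simp add: chr_def inner_add_right distrib_left exp_add)

lemma cnj_chr: "cnj (chr k x) = exp (- \<i> * complex_of_real (k \<bullet> x))"
  by (simp add: chr_def exp_cnj)

lemma continuous_on_chr [continuous_intros]: "continuous_on A (chr k)"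
  unfolding chr_def by (intro continuous_intros)

text \<open>For n \<noteq> 0 the antiderivative \<open>F\<close> takes equal values at both ends
  because n is an integer; the interval may be closed up since a point has measure zero.\<close>

lemma integral_exp_period:
  fixes n :: real
  assumes "n \<in> \<int>"
  shows "(LINT t|lborel. indicator {-pi..<pi} t *\<^sub>R exp (\<i> * complex_of_real (n * t))) =
    (if n = 0 then 2 * pi else 0)"
proof -
  have "(LINT t|lborel. indicator {-pi..<pi} t *\<^sub>R exp (\<i> * complex_of_real (n * t))) =
    (LINT t|lborel. indicator {-pi..pi} t *\<^sub>R exp (\<i> * complex_of_real (n * t)))"
  proof (rule integral_cong_AE)
    show "AE t in lborel. indicator {-pi..<pi} t *\<^sub>R exp (\<i> * complex_of_real (n * t)) =
      indicator {-pi..pi} t *\<^sub>R exp (\<i> * complex_of_real (n * t))"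
      using AE_lborel_singleton[of pi] by eventually_elim (auto simp: indicator_def)
  qed measurable
  also have "\<dots> = (if n = 0 then 2 * pi else 0)"
  proof (cases "n = 0")
    case True
    then show ?thesis by (simp add: scaleR_conv_of_real)
  next
    case False
    define F where "F = (\<lambda>t. exp (\<i> * complex_of_real (n * t)) / (\<i> * n))"
    have eq: "exp (\<i> * complex_of_real (n * pi)) = exp (\<i> * complex_of_real (n * (-pi)))"
    proof -
      obtain k :: int where "n = k" using assms by (auto elim: Ints_cases)
      then show ?thesis
        by (auto simp: exp_eq intro!: exI[of _ k] simp: algebra_simps)
    qed
    have "(LINT t|lborel. indicator {-pi..pi} t *\<^sub>R exp (\<i> * complex_of_real (n * t))) = F pi - F (-pi)"
    proof (rule integral_FTC_Icc)
      fix t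
      have "((\<lambda>z. exp (\<i> * (n * z)) / (\<i> * n)) has_field_derivative exp (\<i> * (n * complex_of_real t))) (at (complex_of_real t))"
        using False by (auto intro!: derivative_eq_intros simp: field_simps)
      from has_vector_derivative_real_field[OF this]
      show "(F has_vector_derivative exp (\<i> * complex_of_real (n * t))) (at t within {-pi..pi})"
        unfolding F_def by (auto intro: has_vector_derivative_at_within)
    qed (auto intro!: continuous_intros)
    also have "\<dots> = 0" using eq by (simp add: F_def)
    finally show ?thesis using False by simp
  qed
  finally show ?thesis .
qed

lemma integral_chr:
  assumes "(k :: real^'d) \<in> int_lattice"
  shows "(LINT x|tm. chr k x) = (if k = 0 then (2 * pi) ^ CARD('d) else 0)"
proof -
  have "(LINT x|tm. chr k x) = (LINT x|tm. (\<Prod>i\<in>UNIV. exp (\<i> * complex_of_real (k $ i * x $ i))))"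
    by (simp add: chr_def inner_vec_def exp_sum sum_distrib_left)
  also have "\<dots> = (\<Prod>i\<in>UNIV. (LINT t|lborel. indicator {-pi..<pi} t *\<^sub>R exp (\<i> * complex_of_real (k $ i * t))))"
    by (rule integral_torus_prod) (intro continuous_intros)
  also have "\<dots> = (\<Prod>i\<in>UNIV. if k $ i = 0 then 2 * complex_of_real pi else 0)"
    using assms by (intro prod.cong refl) (subst integral_exp_period, auto simp: int_lattice_def)
  also have "\<dots> = (if k = 0 then (2 * pi) ^ CARD('d) else 0)"
  proof (cases "k = 0")
    case False
    then obtain i where "k $ i \<noteq> 0" by (auto simp: vec_eq_iff)
    then have "(\<Prod>i\<in>UNIV. if k $ i = 0 then 2 * complex_of_real pi else 0) = 0"
      by (intro prod_zero bexI[of _ i]) auto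
    then show ?thesis using False by simp
  qed simp
  finally show ?thesis .
qed

lemma torus_subset_cbox: "(torus :: (real^'d) set) \<subseteq> cbox (\<chi> i. - pi) (\<chi> i. pi)"
  by (auto simp: torus_def mem_box_cart less_imp_le)

lemma torus_lmeasurable: "(torus :: (real^'d) set) \<in> lmeasurable"
  by (rule fmeasurableI2[OF _ torus_subset_cbox]) auto

interpretation tm: finite_measure "tm :: (real^'d) measure"
  by (rule finite_measure_lebesgue_on[OF torus_lmeasurable])

text \<open>The volume is the integral of the character of frequency 0, so it falls out of
  orthogonality.\<close>

lemma measure_torus: "measure tm (torus :: (real^'d) set) = (2 * pi) ^ CARD('d)"
proof -
  have "complex_of_real (measure tm (torus :: (real^'d) set)) = (LINT x|tm. chr (0::real^'d) x)"
    by (simp add: scaleR_conv_of_real)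
  also have "\<dots> = (2 * pi) ^ CARD('d)" by (subst integral_chr) (auto simp: int_lattice_def)
  finally show ?thesis using of_real_eq_iff[where 'a=complex] by fastforce
qed

subsection \<open>Square-integrable functions\<close>

text \<open>Membership in \<open>L2\<close> without periodicity: the estimates integrate over the
  cell only, and auxiliary functions such as indicators of measurable sets are not periodic.\<close>

definition sqint :: "(real^'d \<Rightarrow> complex) \<Rightarrow> bool" where
  "sqint f \<longleftrightarrow> f \<in> borel_measurable tm \<and> integrable tm (\<lambda>x. (cmod (f x))\<^sup>2)"

definition ip :: "(real^'d \<Rightarrow> complex) \<Rightarrow> (real^'d \<Rightarrow> complex) \<Rightarrow> complex" where
  "ip f g = (LINT x|tm. f x * cnj (g x))"

lemma borel_measurable_cnj [measurable (raw)]: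
  "f \<in> borel_measurable M \<Longrightarrow> (\<lambda>x. cnj (f x)) \<in> borel_measurable M"
  by (rule borel_measurable_continuous_on[of cnj]) (intro continuous_intros)

lemma sqint_measurable: "sqint f \<Longrightarrow> f \<in> borel_measurable tm"
  by (simp add: sqint_def)

lemma sqint_integrable: "sqint f \<Longrightarrow> integrable tm (\<lambda>x. (cmod (f x))\<^sup>2)"
  by (simp add: sqint_def)

lemma L2_imp_sqint: "f \<in> L2 \<Longrightarrow> sqint f"
  by (simp add: L2_def sqint_def)

lemma sqint_dominated:
  assumes "sqint g" "f \<in> borel_measurable tm" "AE x in tm. cmod (f x) \<le> c * cmod (g x)"
  shows "sqint f"
  unfolding sqint_def
proof (intro conjI assms)
  have "integrable tm (\<lambda>x. c\<^sup>2 * (cmod (g x))\<^sup>2)" using assms(1) by (simp add: sqint_def)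
  then show "integrable tm (\<lambda>x. (cmod (f x))\<^sup>2)"
  proof (rule Bochner_Integration.integrable_bound)
    show "(\<lambda>x. (cmod (f x))\<^sup>2) \<in> borel_measurable tm" using assms(2) by measurable
    show "AE x in tm. norm ((cmod (f x))\<^sup>2) \<le> norm (c\<^sup>2 * (cmod (g x))\<^sup>2)"
      using assms(3)
    proof eventually_elim
      case (elim x)
      then have "(cmod (f x))\<^sup>2 \<le> (c * cmod (g x))\<^sup>2" by (intro power_mono) auto
      then show ?case by (simp add: power_mult_distrib)
    qed
  qed
qed

lemma sqint_const [simp, intro]: "sqint (\<lambda>x. c)"
  by (simp add: sqint_def)

lemma sqint_bounded:
  assumes "f \<in> borel_measurable tm" "AE x in tm. cmod (f x) \<le> B"
  shows "sqint f"
  by (rule sqint_dominated[OF sqint_const[of "1"] assms(1), of B]) (use assms(2) in simp)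

lemma sqint_cmult [intro]: "sqint f \<Longrightarrow> sqint (\<lambda>x. c * f x)"
  by (rule sqint_dominated[of f _ "cmod c"]) (auto simp: sqint_def norm_mult)

lemma sqint_add [intro]:
  assumes "sqint f" "sqint g" shows "sqint (\<lambda>x. f x + g x)"
  unfolding sqint_def
proof (intro conjI)
  show meas: "(\<lambda>x. f x + g x) \<in> borel_measurable tm" using assms by (auto simp: sqint_def)
  have "integrable tm (\<lambda>x. 2 * (cmod (f x))\<^sup>2 + 2 * (cmod (g x))\<^sup>2)"
    using assms by (simp add: sqint_def)
  then show "integrable tm (\<lambda>x. (cmod (f x + g x))\<^sup>2)"
  proof (rule Bochner_Integration.integrable_bound)
    show "(\<lambda>x. (cmod (f x + g x))\<^sup>2) \<in> borel_measurable tm" using meas by measurable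
    show "AE x in tm. norm ((cmod (f x + g x))\<^sup>2) \<le> norm (2 * (cmod (f x))\<^sup>2 + 2 * (cmod (g x))\<^sup>2)"
    proof (rule AE_I2)
      fix x
      have "(cmod (f x + g x))\<^sup>2 \<le> (cmod (f x) + cmod (g x))\<^sup>2"
        by (intro power_mono norm_triangle_ineq) auto
      also have "\<dots> \<le> 2 * (cmod (f x))\<^sup>2 + 2 * (cmod (g x))\<^sup>2"
        using sum_squares_bound[of "cmod (f x)" "cmod (g x)"] by (simp add: power2_sum)
      finally show "norm ((cmod (f x + g x))\<^sup>2) \<le> norm (2 * (cmod (f x))\<^sup>2 + 2 * (cmod (g x))\<^sup>2)"
        by simp
    qed
  qed
qed

lemma sqint_diff [intro]:
  assumes "sqint f" "sqint g" shows "sqint (\<lambda>x. f x - g x)"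
  using sqint_add[OF assms(1) sqint_cmult[OF assms(2), of "-1"]] by simp

lemma sqint_sum [intro]:
  assumes "\<And>i. i \<in> I \<Longrightarrow> sqint (f i)" shows "sqint (\<lambda>x. \<Sum>i\<in>I. f i x)"
  using assms by (induction I rule: infinite_finite_induct) auto

lemma integrable_norm_mult:
  assumes "sqint f" "sqint g"
  shows "integrable tm (\<lambda>x. cmod (f x) * cmod (g x))"
proof (rule Bochner_Integration.integrable_bound)
  show "integrable tm (\<lambda>x. (cmod (f x))\<^sup>2 + (cmod (g x))\<^sup>2)"
    using assms by (simp add: sqint_def)
  show "(\<lambda>x. cmod (f x) * cmod (g x)) \<in> borel_measurable tm"
    using assms by (auto simp: sqint_def)
  show "AE x in tm. norm (cmod (f x) * cmod (g x)) \<le> norm ((cmod (f x))\<^sup>2 + (cmod (g x))\<^sup>2)"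
  proof (rule AE_I2)
    fix x
    have "2 * (cmod (f x) * cmod (g x)) \<le> (cmod (f x))\<^sup>2 + (cmod (g x))\<^sup>2"
      using sum_squares_bound[of "cmod (f x)" "cmod (g x)"] by (simp add: mult.assoc)
    moreover have "0 \<le> cmod (f x) * cmod (g x)" by simp
    ultimately show "norm (cmod (f x) * cmod (g x)) \<le> norm ((cmod (f x))\<^sup>2 + (cmod (g x))\<^sup>2)"
      by (simp only: real_norm_def)
  qed
qed

lemma integrable_ip:
  assumes "sqint f" "sqint g"
  shows "integrable tm (\<lambda>x. f x * cnj (g x))"
  by (rule Bochner_Integration.integrable_bound[OF integrable_norm_mult[OF assms]])
     (use assms in \<open>auto simp: sqint_def norm_mult\<close>)

lemma sqint_imp_integrable: "sqint f \<Longrightarrow> integrable tm f"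
  using integrable_ip[of f "\<lambda>x. 1"] by simp

lemma L2_norm_nonneg [simp]: "0 \<le> L2_norm f"
  by (simp add: L2_norm_def)

lemma L2_norm_sq: "(L2_norm f)\<^sup>2 = (LINT x|tm. (cmod (f x))\<^sup>2)"
  by (simp add: L2_norm_def)

lemma ip_self: "ip f f = complex_of_real ((L2_norm f)\<^sup>2)"
  unfolding ip_def L2_norm_sq by (simp flip: integral_complex_of_real complex_norm_square)

lemma cnj_ip: "cnj (ip f g) = ip g f"
  unfolding ip_def by (subst Bochner_Integration.integral_cnj[symmetric]) (simp add: mult.commute)

lemma ip_add_left: "sqint f \<Longrightarrow> sqint g \<Longrightarrow> sqint h \<Longrightarrow> ip (\<lambda>x. f x + g x) h = ip f h + ip g h"
  by (simp add: ip_def distrib_right integrable_ip)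

lemma ip_diff_left: "sqint f \<Longrightarrow> sqint g \<Longrightarrow> sqint h \<Longrightarrow> ip (\<lambda>x. f x - g x) h = ip f h - ip g h"
  by (simp add: ip_def left_diff_distrib integrable_ip)

lemma ip_cmult_left: "ip (\<lambda>x. c * f x) h = c * ip f h"
  by (simp add: ip_def mult.assoc)

lemma ip_sum_left:
  assumes "\<And>i. i \<in> I \<Longrightarrow> sqint (f i)" "sqint h"
  shows "ip (\<lambda>x. \<Sum>i\<in>I. f i x) h = (\<Sum>i\<in>I. ip (f i) h)"
  using assms by (simp add: ip_def sum_distrib_right integrable_ip Bochner_Integration.integral_sum)

lemma ip_add_right: "sqint f \<Longrightarrow> sqint g \<Longrightarrow> sqint h \<Longrightarrow> ip h (\<lambda>x. f x + g x) = ip h f + ip h g"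
  by (simp add: ip_def distrib_left integrable_ip)

lemma ip_diff_right: "sqint f \<Longrightarrow> sqint g \<Longrightarrow> sqint h \<Longrightarrow> ip h (\<lambda>x. f x - g x) = ip h f - ip h g"
  by (simp add: ip_def right_diff_distrib integrable_ip)

lemma ip_cmult_right: "ip h (\<lambda>x. c * f x) = cnj c * ip h f"
  by (simp add: ip_def mult.left_commute)

lemma ip_sum_right:
  assumes "\<And>i. i \<in> I \<Longrightarrow> sqint (f i)" "sqint h"
  shows "ip h (\<lambda>x. \<Sum>i\<in>I. f i x) = (\<Sum>i\<in>I. ip h (f i))"
  using assms by (simp add: ip_def sum_distrib_left integrable_ip Bochner_Integration.integral_sum)

lemma L2_norm_mono:
  assumes "sqint g" "f \<in> borel_measurable tm" "AE x in tm. cmod (f x) \<le> cmod (g x)"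
  shows "L2_norm f \<le> L2_norm g"
  unfolding L2_norm_def
proof (intro real_sqrt_le_mono integral_mono_AE sqint_integrable assms(1))
  show "sqint f" using sqint_dominated[OF assms(1,2), of 1] assms(3) by simp
  show "AE x in tm. (cmod (f x))\<^sup>2 \<le> (cmod (g x))\<^sup>2"
    using assms(3) by eventually_elim (simp add: power_mono)
qed

lemma L2_norm_cong_AE:
  assumes "f \<in> borel_measurable tm" "g \<in> borel_measurable tm" "AE x in tm. f x = g x"
  shows "L2_norm f = L2_norm g"
  unfolding L2_norm_def
  by (intro arg_cong[where f=sqrt] integral_cong_AE) (use assms in auto)

lemma L2_norm_const: "L2_norm (\<lambda>x::real^'d. c) = sqrt ((2 * pi) ^ CARD('d)) * cmod c"
  by (simp add: L2_norm_def measure_torus real_sqrt_mult)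

lemma L2_norm_cmult: "L2_norm (\<lambda>x. c * f x) = cmod c * L2_norm f"
  by (simp add: L2_norm_def norm_mult power_mult_distrib real_sqrt_mult)

lemma L2_norm_uminus_diff: "L2_norm (\<lambda>x. f x - g x) = L2_norm (\<lambda>x. g x - f x)"
  by (simp add: L2_norm_def norm_minus_commute)

text \<open>Young's inequality with the optimal weight \<open>?G / ?F\<close>. Both norms are
  enlarged by \<open>e\<close> so that the weight exists and is positive also when one of them
  vanishes; then \<open>e\<close> tends to 0.\<close>

lemma Cauchy_Schwarz_L2_abs:
  assumes f: "sqint f" and g: "sqint g"
  shows "(LINT x|tm. cmod (f x) * cmod (g x)) \<le> L2_norm f * L2_norm g"
proof -
  let ?F = "L2_norm f" and ?G = "L2_norm g" and ?X = "LINT x|tm. cmod (f x) * cmod (g x)"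
  have bound: "?X \<le> (?F + e) * (?G + e)" if e: "e > 0" for e :: real
  proof -
    define a where "a = (?G + e) / (?F + e)"
    have pos: "?F + e > 0" "?G + e > 0" using e by (simp_all add: add_nonneg_pos)
    then have a: "a > 0" by (simp add: a_def)
    have "2 * ?X = (LINT x|tm. 2 * (cmod (f x) * cmod (g x)))" by simp
    also have "\<dots> \<le> (LINT x|tm. a * (cmod (f x))\<^sup>2 + inverse a * (cmod (g x))\<^sup>2)"
    proof (rule integral_mono)
      show "integrable tm (\<lambda>x. 2 * (cmod (f x) * cmod (g x)))"
        using integrable_norm_mult[OF f g] by simp
      show "integrable tm (\<lambda>x. a * (cmod (f x))\<^sup>2 + inverse a * (cmod (g x))\<^sup>2)"
        using f g by (simp add: sqint_def)
      fix x
      have "0 \<le> (a * cmod (f x) - cmod (g x))\<^sup>2 / a" using a by simp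
      also have "\<dots> = a * (cmod (f x))\<^sup>2 + inverse a * (cmod (g x))\<^sup>2 - 2 * (cmod (f x) * cmod (g x))"
        using a by (simp add: power2_eq_square field_simps)
      finally show "2 * (cmod (f x) * cmod (g x)) \<le> a * (cmod (f x))\<^sup>2 + inverse a * (cmod (g x))\<^sup>2"
        by simp
    qed
    also have "\<dots> = a * ?F\<^sup>2 + inverse a * ?G\<^sup>2"
      using f g by (simp add: L2_norm_sq sqint_def)
    also have "\<dots> \<le> a * (?F + e)\<^sup>2 + inverse a * (?G + e)\<^sup>2"
      using a e by (intro add_mono mult_left_mono power_mono) auto
    also have "\<dots> = 2 * ((?F + e) * (?G + e))"
      using pos by (simp add: a_def power2_eq_square)
    finally show ?thesis by simp
  qed
  have "((\<lambda>e. (?F + e) * (?G + e)) \<longlongrightarrow> (?F + 0) * (?G + 0)) (at_right 0)"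
    by (intro tendsto_intros)
  then have "?X \<le> (?F + 0) * (?G + 0)"
    by (rule tendsto_lowerbound) (auto intro!: eventually_at_rightI[of 0 1] bound)
  then show ?thesis by simp
qed

lemma Cauchy_Schwarz_L2:
  assumes "sqint f" "sqint g"
  shows "cmod (ip f g) \<le> L2_norm f * L2_norm g"
proof -
  have "cmod (ip f g) \<le> (LINT x|tm. cmod (f x * cnj (g x)))"
    unfolding ip_def by (rule integral_norm_bound)
  also have "\<dots> = (LINT x|tm. cmod (f x) * cmod (g x))" by (simp add: norm_mult)
  finally show ?thesis using Cauchy_Schwarz_L2_abs[OF assms] by simp
qed

lemma L2_norm_add_sq:
  assumes "sqint f" "sqint g"
  shows "(L2_norm (\<lambda>x. f x + g x))\<^sup>2 = (L2_norm f)\<^sup>2 + 2 * Re (ip f g) + (L2_norm g)\<^sup>2"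
proof -
  have "complex_of_real ((L2_norm (\<lambda>x. f x + g x))\<^sup>2) = ip f f + (ip f g + cnj (ip f g)) + ip g g"
    unfolding ip_self[symmetric] cnj_ip using assms by (simp add: ip_add_left ip_add_right sqint_add)
  also have "\<dots> = complex_of_real ((L2_norm f)\<^sup>2 + 2 * Re (ip f g) + (L2_norm g)\<^sup>2)"
    by (simp add: ip_self complex_add_cnj)
  finally show ?thesis using of_real_eq_iff by blast
qed

lemma L2_norm_triangle:
  assumes "sqint f" "sqint g"
  shows "L2_norm (\<lambda>x. f x + g x) \<le> L2_norm f + L2_norm g"
proof (rule power2_le_imp_le)
  have "Re (ip f g) \<le> L2_norm f * L2_norm g"
    using Cauchy_Schwarz_L2[OF assms] complex_Re_le_cmod order_trans by blast
  then show "(L2_norm (\<lambda>x. f x + g x))\<^sup>2 \<le> (L2_norm f + L2_norm g)\<^sup>2"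
    by (simp add: L2_norm_add_sq assms power2_sum)
qed (simp add: add_nonneg_nonneg)

lemma L2_norm_triangle_diff:
  assumes "sqint f" "sqint g"
  shows "L2_norm (\<lambda>x. f x - g x) \<le> L2_norm f + L2_norm g"
  using L2_norm_triangle[OF assms(1) sqint_cmult[OF assms(2), of "-1"]] L2_norm_cmult[of "-1" g] by simp

lemma L2_norm_dist_triangle:
  assumes "sqint f" "sqint g" "sqint h"
  shows "L2_norm (\<lambda>x. f x - h x) \<le> L2_norm (\<lambda>x. f x - g x) + L2_norm (\<lambda>x. g x - h x)"
  using L2_norm_triangle[OF sqint_diff[OF assms(1,2)] sqint_diff[OF assms(2,3)]] by simp

lemma L2_norm_sum_triangle:
  assumes "\<And>i. i \<in> I \<Longrightarrow> sqint (f i)"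
  shows "L2_norm (\<lambda>x. \<Sum>i\<in>I. f i x) \<le> (\<Sum>i\<in>I. L2_norm (f i))"
  using assms
proof (induction I rule: infinite_finite_induct)
  case (insert i I)
  then have "L2_norm (\<lambda>x. f i x + (\<Sum>i\<in>I. f i x)) \<le> L2_norm (f i) + L2_norm (\<lambda>x. \<Sum>i\<in>I. f i x)"
    by (intro L2_norm_triangle sqint_sum) auto
  also have "\<dots> \<le> L2_norm (f i) + (\<Sum>i\<in>I. L2_norm (f i))" using insert by simp
  finally show ?case using insert.hyps by simp
qed (simp_all add: L2_norm_def)

lemma L2_norm_le_sup:
  assumes "f \<in> borel_measurable (tm :: (real^'d) measure)" "AE x in tm. cmod (f x) \<le> B" "0 \<le> B"
  shows "L2_norm f \<le> sqrt ((2 * pi) ^ CARD('d)) * B"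
  using L2_norm_mono[OF sqint_const[of "of_real B"] assms(1)] assms(2,3) L2_norm_const[of "of_real B", where 'd='d]
  by simp

subsection \<open>Fourier coefficients and trigonometric polynomials\<close>

lemma int_lattice_0 [simp]: "0 \<in> int_lattice"
  by (simp add: int_lattice_def)

lemma int_lattice_add: "k \<in> int_lattice \<Longrightarrow> l \<in> int_lattice \<Longrightarrow> k + l \<in> int_lattice"
  by (simp add: int_lattice_def)

lemma int_lattice_diff: "k \<in> int_lattice \<Longrightarrow> l \<in> int_lattice \<Longrightarrow> k - l \<in> int_lattice"
  by (simp add: int_lattice_def)

lemma int_lattice_axis: "axis i 1 \<in> int_lattice" "- axis i 1 \<in> int_lattice"
  by (simp_all add: int_lattice_def axis_def)

lemma freqs_subset: "freqs N \<subseteq> int_lattice"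
  by (auto simp: freqs_def)

lemma freqs_mono: "M \<le> N \<Longrightarrow> freqs M \<subseteq> freqs N"
  unfolding freqs_def by (auto intro: order_trans)

lemma zero_in_freqs [simp]: "0 \<in> freqs N"
  by (simp add: freqs_def)

lemma freqs_image: "(freqs N :: (real^'d) set) \<subseteq> (\<lambda>f. \<chi> i. real_of_int (f i)) ` (UNIV \<rightarrow>\<^sub>E {- int N..int N})"
proof
  fix k :: "real^'d" assume k: "k \<in> freqs N"
  have int: "real_of_int \<lfloor>k $ i\<rfloor> = k $ i" for i
    using k by (auto simp: freqs_def int_lattice_def elim: Ints_cases)
  have "\<lfloor>k $ i\<rfloor> \<in> {- int N..int N}" for i
  proof -
    have "\<bar>real_of_int \<lfloor>k $ i\<rfloor>\<bar> \<le> real N" using k by (simp add: int freqs_def)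
    then show ?thesis by auto
  qed
  then have "(\<lambda>i. \<lfloor>k $ i\<rfloor>) \<in> UNIV \<rightarrow>\<^sub>E {- int N..int N}" by auto
  moreover have "k = (\<chi> i. real_of_int \<lfloor>k $ i\<rfloor>)" by (simp add: vec_eq_iff int)
  ultimately show "k \<in> (\<lambda>f. \<chi> i. real_of_int (f i)) ` (UNIV \<rightarrow>\<^sub>E {- int N..int N})"
    by (intro image_eqI[where x="\<lambda>i. \<lfloor>k $ i\<rfloor>"])
qed

lemma finite_freqs [simp]: "finite (freqs N :: (real^'d) set)"
  by (rule finite_subset[OF freqs_image]) (intro finite_imageI finite_PiE, auto)

lemma card_freqs: "card (freqs N :: (real^'d) set) \<le> (2 * N + 1) ^ CARD('d)"
proof -
  let ?P = "(UNIV :: 'd set) \<rightarrow>\<^sub>E {- int N..int N}"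
  have fin: "finite ?P" by (intro finite_PiE) auto
  have "card (freqs N :: (real^'d) set) \<le> card ?P"
    using card_mono[OF finite_imageI[OF fin] freqs_image] card_image_le[OF fin] order_trans by blast
  also have "\<dots> = (2 * N + 1) ^ CARD('d)"
    by (simp add: card_PiE nat_add_distrib nat_mult_distrib)
  finally show ?thesis .
qed

lemma lattice_in_freqs:
  assumes "finite F" "F \<subseteq> int_lattice"
  obtains N where "F \<subseteq> freqs N"
proof -
  define N where "N = nat \<lceil>\<Sum>k\<in>F. norm k\<rceil>"
  have "F \<subseteq> freqs N"
  proof
    fix k assume k: "k \<in> F"
    have "\<bar>k $ i\<bar> \<le> real N" for i
    proof -
      have "\<bar>k $ i\<bar> \<le> norm k" by (rule component_le_norm_cart)
      also have "\<dots> \<le> (\<Sum>k\<in>F. norm k)" using k assms by (intro member_le_sum) auto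
      also have "\<dots> \<le> real N" unfolding N_def by (rule real_nat_ceiling_ge)
      finally show ?thesis .
    qed
    then show "k \<in> freqs N" using k assms by (auto simp: freqs_def)
  qed
  then show ?thesis by (rule that)
qed

lemma lattice_norm_ge_1:
  assumes "k \<in> int_lattice" "k \<noteq> 0"
  shows "1 \<le> norm k"
proof -
  obtain i where i: "k $ i \<noteq> 0" using assms by (auto simp: vec_eq_iff)
  then have "1 \<le> \<bar>k $ i\<bar>" using assms by (auto simp: int_lattice_def intro!: Ints_nonzero_abs_ge1)
  then show ?thesis using component_le_norm_cart[of k i] by simp
qed

lemma norm_gt_of_not_freqs:
  assumes "k \<in> int_lattice" "k \<notin> freqs N"
  shows "real N < norm k"
proof -
  obtain i where "real N < \<bar>k $ i\<bar>" using assms by (auto simp: freqs_def not_le)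
  then show ?thesis using component_le_norm_cart[of k i] by simp
qed

lemma norm_sq_freqs:
  assumes "(k :: real^'d) \<in> freqs N"
  shows "(norm k)\<^sup>2 \<le> real CARD('d) * (real N)\<^sup>2"
proof -
  have "(norm k)\<^sup>2 = (\<Sum>i\<in>UNIV. (k $ i)\<^sup>2)" by (simp add: norm_eq_sqrt_inner inner_vec_def power2_eq_square sum_nonneg)
  also have "\<dots> \<le> (\<Sum>i\<in>(UNIV::'d set). (real N)\<^sup>2)"
    using assms by (intro sum_mono) (auto simp: freqs_def abs_le_square_iff[symmetric])
  finally show ?thesis by simp
qed

lemma borel_measurable_continuous_tm:
  "continuous_on UNIV f \<Longrightarrow> (f :: real^'d \<Rightarrow> complex) \<in> borel_measurable tm"
  by (rule continuous_imp_measurable_on_sets_lebesgue) (auto intro: continuous_on_subset)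

lemma continuous_bounded_torus:
  assumes "continuous_on UNIV (f :: real^'d \<Rightarrow> complex)"
  obtains B where "0 \<le> B" "\<And>x. x \<in> torus \<Longrightarrow> cmod (f x) \<le> B"
proof -
  have "compact (f ` cbox (\<chi> i. - pi) (\<chi> i. pi))"
    by (intro compact_continuous_image compact_cbox continuous_on_subset[OF assms]) simp
  then have "bounded (f ` cbox (\<chi> i. - pi) (\<chi> i. pi))" by (rule compact_imp_bounded)
  then obtain B where B: "\<And>x. x \<in> cbox (\<chi> i. - pi) (\<chi> i. pi) \<Longrightarrow> cmod (f x) \<le> B"
    unfolding bounded_iff by auto
  show ?thesis
    by (rule that[of "max 0 B"]) (use B torus_subset_cbox in \<open>force+\<close>)
qed

lemma AE_torusI: "(\<And>x. x \<in> torus \<Longrightarrow> P x) \<Longrightarrow> AE x in (tm :: (real^'d) measure). P x"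
  by (intro AE_I2) simp

lemma sqint_continuous:
  assumes "continuous_on UNIV f" shows "sqint f"
proof -
  obtain B where "\<And>x. x \<in> torus \<Longrightarrow> cmod (f x) \<le> B" using continuous_bounded_torus[OF assms] by blast
  then show ?thesis by (intro sqint_bounded[of f B] borel_measurable_continuous_tm assms AE_torusI)
qed

lemma sqint_chr [simp, intro]: "sqint (chr k)"
  by (intro sqint_continuous continuous_intros)

lemma fourier_coeff_ip: "fourier_coeff (f :: real^'d \<Rightarrow> complex) k = ip f (chr k) / (2 * pi) ^ CARD('d)"
  by (simp add: fourier_coeff_def ip_def cnj_chr)

lemma ip_chr_eq: "ip (f :: real^'d \<Rightarrow> complex) (chr k) = (2 * pi) ^ CARD('d) * fourier_coeff f k"
  by (simp add: fourier_coeff_ip)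

lemma ip_chr_chr:
  assumes "(k :: real^'d) \<in> int_lattice" "l \<in> int_lattice"
  shows "ip (chr k) (chr l) = (if k = l then (2 * pi) ^ CARD('d) else 0)"
  using integral_chr[OF int_lattice_diff[OF assms]] by (simp add: ip_def chr_diff)

lemma fourier_coeff_add: "sqint f \<Longrightarrow> sqint g \<Longrightarrow> fourier_coeff (\<lambda>x. f x + g x) k = fourier_coeff f k + fourier_coeff g k"
  by (simp add: fourier_coeff_ip ip_add_left add_divide_distrib)

lemma fourier_coeff_diff: "sqint f \<Longrightarrow> sqint g \<Longrightarrow> fourier_coeff (\<lambda>x. f x - g x) k = fourier_coeff f k - fourier_coeff g k"
  by (simp add: fourier_coeff_ip ip_diff_left diff_divide_distrib)

lemma fourier_coeff_cmult: "fourier_coeff (\<lambda>x. c * f x) k = c * fourier_coeff f k"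
  by (simp add: fourier_coeff_ip ip_cmult_left)

definition trig :: "(real^'d) set \<Rightarrow> (real^'d \<Rightarrow> complex) \<Rightarrow> real^'d \<Rightarrow> complex" where
  "trig F c x = (\<Sum>k\<in>F. c k * chr k x)"

lemma proj_eq_trig: "proj N f = trig (freqs N) (fourier_coeff f)"
  by (simp add: fun_eq_iff proj_def trig_def chr_def)

lemma continuous_on_trig [continuous_intros]: "continuous_on A (trig F c)"
  unfolding trig_def by (intro continuous_intros)

lemma sqint_trig [simp, intro]: "sqint (trig F c)"
  by (intro sqint_continuous continuous_intros)

lemma ip_trig_right:
  assumes "sqint (f :: real^'d \<Rightarrow> complex)"
  shows "ip f (trig F c) = (2 * pi) ^ CARD('d) * (\<Sum>k\<in>F. cnj (c k) * fourier_coeff f k)"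
proof -
  have "ip f (trig F c) = (\<Sum>k\<in>F. ip f (\<lambda>x. c k * chr k x))"
    unfolding trig_def using assms by (intro ip_sum_right) auto
  also have "\<dots> = (\<Sum>k\<in>F. (2 * pi) ^ CARD('d) * (cnj (c k) * fourier_coeff f k))"
    by (intro sum.cong refl) (simp add: ip_cmult_right ip_chr_eq)
  finally show ?thesis by (simp add: sum_distrib_left)
qed

lemma fourier_coeff_trig:
  assumes "finite F" "F \<subseteq> int_lattice" "(k :: real^'d) \<in> int_lattice"
  shows "fourier_coeff (trig F c) k = (if k \<in> F then c k else 0)"
proof -
  have "fourier_coeff (trig F c) k = (\<Sum>l\<in>F. c l * (ip (chr l) (chr k) / (2 * pi) ^ CARD('d)))"
    unfolding fourier_coeff_ip trig_def by (subst ip_sum_left) (auto simp: ip_cmult_left sum_divide_distrib)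
  also have "\<dots> = (\<Sum>l\<in>F. if l = k then c k else 0)"
    using assms by (intro sum.cong refl) (auto simp: ip_chr_chr)
  finally show ?thesis using assms(1) by simp
qed

lemma fourier_coeff_proj:
  assumes "k \<in> int_lattice"
  shows "fourier_coeff (proj N f) k = (if k \<in> freqs N then fourier_coeff f k else 0)"
  unfolding proj_eq_trig using assms freqs_subset by (subst fourier_coeff_trig) auto

lemma L2_norm_trig:
  assumes "finite F" "F \<subseteq> int_lattice"
  shows "(L2_norm (trig F c :: real^'d \<Rightarrow> complex))\<^sup>2 = (2 * pi) ^ CARD('d) * (\<Sum>k\<in>F. (cmod (c k))\<^sup>2)"
proof -
  have "complex_of_real ((L2_norm (trig F c))\<^sup>2) = (2 * pi) ^ CARD('d) * (\<Sum>k\<in>F. cnj (c k) * fourier_coeff (trig F c) k)"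
    by (simp only: ip_self[symmetric] ip_trig_right[OF sqint_trig])
  also have "(\<Sum>k\<in>F. cnj (c k) * fourier_coeff (trig F c) k) = (\<Sum>k\<in>F. cnj (c k) * c k)"
    using assms by (intro sum.cong refl) (simp add: fourier_coeff_trig subset_iff)
  also have "\<dots> = complex_of_real (\<Sum>k\<in>F. (cmod (c k))\<^sup>2)"
    unfolding of_real_sum by (intro sum.cong refl) (metis complex_norm_square mult.commute)
  finally have "complex_of_real ((L2_norm (trig F c))\<^sup>2) = complex_of_real ((2 * pi) ^ CARD('d) * (\<Sum>k\<in>F. (cmod (c k))\<^sup>2))"
    by simp
  then show ?thesis using of_real_eq_iff by blast
qed

text \<open>Completing the square coefficient by coefficient. Taking c =
  \<open>fourier_coeff f\<close> gives Bessel's inequality and shows that the truncated Fourier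
  series is the best approximation; with time-dependent coefficients the identity also makes the
  distance in \<open>splitting_step\<close> differentiable.\<close>

lemma L2_norm_diff_trig:
  assumes "finite F" "F \<subseteq> int_lattice" "sqint (f :: real^'d \<Rightarrow> complex)"
  shows "(L2_norm (\<lambda>x. f x - trig F c x))\<^sup>2 = (L2_norm f)\<^sup>2
    - (2 * pi) ^ CARD('d) * (\<Sum>k\<in>F. (cmod (fourier_coeff f k))\<^sup>2)
    + (2 * pi) ^ CARD('d) * (\<Sum>k\<in>F. (cmod (fourier_coeff f k - c k))\<^sup>2)"
proof -
  let ?V = "(2 * pi) ^ CARD('d)"
  have ipre: "Re (ip f (trig F c)) = ?V * (\<Sum>k\<in>F. Re (cnj (c k) * fourier_coeff f k))"
  proof -
    have "ip f (trig F c) = complex_of_real ?V * (\<Sum>k\<in>F. cnj (c k) * fourier_coeff f k)"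
      using ip_trig_right[OF assms(3)] by simp
    then show ?thesis by simp
  qed
  have "(L2_norm (\<lambda>x. f x - trig F c x))\<^sup>2 = (L2_norm f)\<^sup>2 - 2 * Re (ip f (trig F c)) + (L2_norm (trig F c))\<^sup>2"
    using L2_norm_add_sq[OF assms(3) sqint_cmult[OF sqint_trig, of "-1" F c]]
      ip_cmult_right[of f "-1" "trig F c"] L2_norm_cmult[of "-1" "trig F c"] by simp
  also have "\<dots> = (L2_norm f)\<^sup>2 + ?V * (\<Sum>k\<in>F. (cmod (c k))\<^sup>2 - 2 * Re (cnj (c k) * fourier_coeff f k))"
    by (simp add: ipre L2_norm_trig[OF assms(1,2)] sum_subtractf sum_distrib_left algebra_simps)
  also have "(\<Sum>k\<in>F. (cmod (c k))\<^sup>2 - 2 * Re (cnj (c k) * fourier_coeff f k)) =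
    (\<Sum>k\<in>F. (cmod (fourier_coeff f k - c k))\<^sup>2 - (cmod (fourier_coeff f k))\<^sup>2)"
    by (intro sum.cong refl) (simp add: cmod_power2, simp add: power2_eq_square algebra_simps)
  finally show ?thesis by (simp add: sum_subtractf algebra_simps)
qed

lemma Bessel:
  assumes "finite F" "F \<subseteq> int_lattice" "sqint (f :: real^'d \<Rightarrow> complex)"
  shows "(2 * pi) ^ CARD('d) * (\<Sum>k\<in>F. (cmod (fourier_coeff f k))\<^sup>2) \<le> (L2_norm f)\<^sup>2"
  using L2_norm_diff_trig[OF assms, of "fourier_coeff f"] zero_le_power2[of "L2_norm (\<lambda>x. f x - trig F (fourier_coeff f) x)"]
  by simp

lemma L2_norm_diff_trig_best:
  assumes "finite F" "F \<subseteq> int_lattice" "sqint (f :: real^'d \<Rightarrow> complex)"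
  shows "L2_norm (\<lambda>x. f x - trig F (fourier_coeff f) x) \<le> L2_norm (\<lambda>x. f x - trig F c x)"
proof (rule power2_le_imp_le)
  show "(L2_norm (\<lambda>x. f x - trig F (fourier_coeff f) x))\<^sup>2 \<le> (L2_norm (\<lambda>x. f x - trig F c x))\<^sup>2"
    unfolding L2_norm_diff_trig[OF assms] by (simp add: sum_nonneg)
qed simp

lemma sqint_proj [simp, intro]: "sqint (proj N f)"
  by (simp add: proj_eq_trig)

lemma L2_norm_proj_le:
  assumes "sqint (f :: real^'d \<Rightarrow> complex)"
  shows "L2_norm (proj N f) \<le> L2_norm f"
proof (rule power2_le_imp_le)
  show "(L2_norm (proj N f))\<^sup>2 \<le> (L2_norm f)\<^sup>2"
    unfolding proj_eq_trig using Bessel[OF _ freqs_subset assms] by (simp add: L2_norm_trig freqs_subset)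
qed simp

subsection \<open>Density of trigonometric polynomials\<close>

text \<open>Supports are whole cubes \<open>freqs N\<close>; these are nested, so any two
  polynomials can be written over a common cube.\<close>

definition tpoly :: "(real^'d \<Rightarrow> complex) \<Rightarrow> bool" where
  "tpoly p \<longleftrightarrow> (\<exists>N c. p = trig (freqs N) c)"

lemma trig_extend:
  assumes "finite G" "F \<subseteq> G"
  shows "trig F c = trig G (\<lambda>k. if k \<in> F then c k else 0)"
  unfolding trig_def fun_eq_iff
  using assms by (auto intro!: sum.mono_neutral_cong_left)

lemma tpoly_trig:
  assumes "finite F" "F \<subseteq> int_lattice" shows "tpoly (trig F c)"
proof -
  obtain N where "F \<subseteq> freqs N" using lattice_in_freqs[OF assms] .
  from trig_extend[OF finite_freqs this] show ?thesis unfolding tpoly_def by blast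
qed

lemma tpoly_cmult_chr: "k \<in> int_lattice \<Longrightarrow> tpoly (\<lambda>x. c * chr k x)"
  using tpoly_trig[of "{k}" "\<lambda>_. c"] by (simp add: trig_def[abs_def])

lemma tpoly_const: "tpoly (\<lambda>x. c)"
  using tpoly_cmult_chr[of 0 c] by simp

lemma tpoly_add:
  assumes "tpoly p" "tpoly q" shows "tpoly (\<lambda>x. p x + q x)"
proof -
  obtain M a where p: "p = trig (freqs M) a" using assms(1) by (auto simp: tpoly_def)
  obtain N b where q: "q = trig (freqs N) b" using assms(2) by (auto simp: tpoly_def)
  let ?K = "freqs (max M N)"
  have "p = trig ?K (\<lambda>k. if k \<in> freqs M then a k else 0)"
    unfolding p by (rule trig_extend) (simp_all add: freqs_mono)
  moreover have "q = trig ?K (\<lambda>k. if k \<in> freqs N then b k else 0)"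
    unfolding q by (rule trig_extend) (simp_all add: freqs_mono)
  ultimately have "(\<lambda>x. p x + q x) =
      trig ?K (\<lambda>k. (if k \<in> freqs M then a k else 0) + (if k \<in> freqs N then b k else 0))"
    by (simp add: trig_def fun_eq_iff distrib_right sum.distrib)
  then show ?thesis unfolding tpoly_def by blast
qed

lemma tpoly_cmult:
  assumes "tpoly p" shows "tpoly (\<lambda>x. a * p x)"
proof -
  obtain M c where "p = trig (freqs M) c" using assms by (auto simp: tpoly_def)
  then have "(\<lambda>x. a * p x) = trig (freqs M) (\<lambda>k. a * c k)"
    by (simp add: trig_def fun_eq_iff sum_distrib_left mult.assoc)
  then show ?thesis unfolding tpoly_def by blast
qed

lemma tpoly_sum:
  assumes "\<And>i. i \<in> I \<Longrightarrow> tpoly (p i)" shows "tpoly (\<lambda>x. \<Sum>i\<in>I. p i x)"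
  using assms by (induction I rule: infinite_finite_induct) (auto intro: tpoly_add tpoly_const)

lemma tpoly_mult:
  assumes "tpoly p" "tpoly q" shows "tpoly (\<lambda>x. p x * q x)"
proof -
  obtain M a where p: "p = trig (freqs M) a" using assms(1) by (auto simp: tpoly_def)
  obtain N b where q: "q = trig (freqs N) b" using assms(2) by (auto simp: tpoly_def)
  have "(\<lambda>x. p x * q x) = (\<lambda>x. \<Sum>k\<in>freqs M. \<Sum>l\<in>freqs N. (a k * b l) * chr (k + l) x)"
    by (simp add: p q trig_def fun_eq_iff sum_product chr_add algebra_simps)
  moreover have "tpoly (\<lambda>x. \<Sum>k\<in>freqs M. \<Sum>l\<in>freqs N. (a k * b l) * chr (k + l) x)"
    using freqs_subset by (intro tpoly_sum tpoly_cmult_chr int_lattice_add) auto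
  ultimately show ?thesis by simp
qed

lemma continuous_on_tpoly: "tpoly p \<Longrightarrow> continuous_on A p"
  by (auto simp: tpoly_def intro: continuous_intros)

lemma sqint_tpoly: "tpoly p \<Longrightarrow> sqint p"
  by (intro sqint_continuous continuous_on_tpoly)

section \<open>Stone-Weierstrass on the torus\<close>

definition torus_embed :: "real^'d \<Rightarrow> complex^'d" where
  "torus_embed x = (\<chi> i. chr (axis i 1) x)"

lemma continuous_on_torus_embed: "continuous_on A torus_embed"
  unfolding torus_embed_def by (intro continuous_intros)

text \<open>\<open>torus_embed\<close> realises the torus as a product of unit circles in a
  Euclidean space, where polynomial approximation is available. A real linear coordinate of it has
  the form Re (cnj u * chr), a combination of the characters of frequency plus and minus
  \<open>axis i 1\<close>; sums and products stay trigonometric polynomials, so induction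
  finishes.\<close>

lemma tpoly_real_polynomial:
  assumes "real_polynomial_function r"
  shows "tpoly (\<lambda>x::real^'d. complex_of_real (r (torus_embed x)))"
  using assms
proof (induction rule: real_polynomial_function.induct)
  case (linear f)
  have comp: "tpoly (\<lambda>x::real^'d. complex_of_real (torus_embed x \<bullet> axis i u))" for i u
  proof -
    have "complex_of_real (torus_embed x \<bullet> axis i u) =
        cnj u / 2 * chr (axis i 1) x + u / 2 * chr (- axis i 1) x" for x :: "real^'d"
    proof -
      let ?c = "chr (axis i 1) x"
      have "complex_of_real (torus_embed x \<bullet> axis i u) = complex_of_real (Re (cnj u * ?c))"
        by (simp add: torus_embed_def inner_axis inner_complex_def)
      also have "\<dots> = (cnj u * ?c + cnj (cnj u * ?c)) / 2"
        by (simp only: complex_add_cnj) simp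
      also have "cnj (cnj u * ?c) = u * chr (- axis i 1) x"
        by (simp add: chr_def exp_cnj)
      finally show ?thesis by (simp add: add_divide_distrib)
    qed
    moreover have "tpoly (\<lambda>x. cnj u / 2 * chr (axis i 1) x + u / 2 * chr (- axis i 1) x)"
      by (intro tpoly_add tpoly_cmult_chr int_lattice_axis)
    ultimately show ?thesis by simp
  qed
  interpret bounded_linear f by fact
  have "f (torus_embed x) = (\<Sum>b\<in>Basis. (torus_embed x \<bullet> b) * f b)" for x :: "real^'d"
    by (subst euclidean_representation[of "torus_embed x", symmetric]) (simp only: sum scaleR real_scaleR_def)
  then have "(\<lambda>x::real^'d. complex_of_real (f (torus_embed x))) =
      (\<lambda>x. \<Sum>b\<in>Basis. complex_of_real (f b) * complex_of_real (torus_embed x \<bullet> b))"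
    by (simp add: fun_eq_iff mult.commute)
  moreover have "tpoly (\<lambda>x::real^'d. \<Sum>b\<in>Basis. complex_of_real (f b) * complex_of_real (torus_embed x \<bullet> b))"
    by (intro tpoly_sum tpoly_cmult) (auto simp: Basis_vec_def comp)
  ultimately show ?case by simp
qed (auto intro: tpoly_const tpoly_add tpoly_mult)

text \<open>By \<open>compat\<close>, which matches g on opposite faces, g descends to a function
  \<open>G\<close> on the embedded torus. \<open>G\<close> is continuous because
  \<open>torus_embed\<close> maps compact subsets of the closed cube to compact sets, so preimages
  of closed sets under \<open>G\<close> are closed. Stone-Weierstrass is then applied to
  \<open>G\<close>.\<close>

lemma tpoly_uniform_approx:
  fixes g :: "real^'d \<Rightarrow> complex"
  defines "X \<equiv> cbox (\<chi> i. - pi) (\<chi> i. pi) :: (real^'d) set"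
  assumes cont: "continuous_on X g"
    and compat: "\<And>x y. x \<in> X \<Longrightarrow> y \<in> X \<Longrightarrow> torus_embed x = torus_embed y \<Longrightarrow> g x = g y"
    and e: "0 < e"
  obtains p where "tpoly p" "\<And>x. x \<in> X \<Longrightarrow> cmod (g x - p x) < e"
proof -
  define G where "G z = g (SOME x. x \<in> X \<and> torus_embed x = z)" for z
  have G: "G (torus_embed x) = g x" if "x \<in> X" for x
  proof -
    have "(SOME y. y \<in> X \<and> torus_embed y = torus_embed x) \<in> X \<and>
        torus_embed (SOME y. y \<in> X \<and> torus_embed y = torus_embed x) = torus_embed x"
      by (rule someI) (use that in auto)
    then show ?thesis unfolding G_def using compat that by blast
  qed
  have cX: "compact X" by (simp add: X_def)
  have cE: "compact (torus_embed ` X)"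
    by (intro compact_continuous_image continuous_on_torus_embed cX)
  have contG: "continuous_on (torus_embed ` X) G"
    unfolding continuous_on_closed_vimage[OF compact_imp_closed[OF cE]]
  proof (intro allI impI)
    fix B :: "complex set" assume "closed B"
    then have "closed (g -` B \<inter> X)"
      using cont continuous_on_closed_vimage[OF compact_imp_closed[OF cX]] by blast
    then have "compact (X \<inter> (g -` B \<inter> X))" by (intro compact_Int_closed cX)
    then have "compact (torus_embed ` (X \<inter> (g -` B \<inter> X)))"
      by (intro compact_continuous_image continuous_on_torus_embed)
    also have "torus_embed ` (X \<inter> (g -` B \<inter> X)) = G -` B \<inter> torus_embed ` X"
      using G by auto
    finally show "closed (G -` B \<inter> torus_embed ` X)" by (rule compact_imp_closed)
  qed
  obtain q where q: "polynomial_function q" "\<And>z. z \<in> torus_embed ` X \<Longrightarrow> norm (G z - q z) < e"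
    using Stone_Weierstrass_polynomial_function[OF cE contG e] by blast
  have "real_polynomial_function (Re \<circ> q)" "real_polynomial_function (Im \<circ> q)"
    using q(1) bounded_linear_Re bounded_linear_Im unfolding polynomial_function_def by blast+
  then have "tpoly (\<lambda>x. complex_of_real ((Re \<circ> q) (torus_embed x)) + \<i> * complex_of_real ((Im \<circ> q) (torus_embed x)))"
    by (intro tpoly_add tpoly_cmult tpoly_real_polynomial)
  then have "tpoly (\<lambda>x. q (torus_embed x))"
    by (simp add: complex_eq[symmetric])
  moreover have "cmod (g x - q (torus_embed x)) < e" if "x \<in> X" for x
    using q(2)[of "torus_embed x"] G that by auto
  ultimately show ?thesis by (rule that)
qed

section \<open>Lattice periodicity and translation invariance of the integral\<close>

lemma torus_embed_eqD:
  assumes "torus_embed x = torus_embed (y :: real^'d)"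
  shows "\<exists>k\<in>int_lattice. x = y + (2 * pi) *\<^sub>R k"
proof -
  have "\<exists>n::int. x $ i = y $ i + 2 * pi * n" for i
  proof -
    have "exp (\<i> * complex_of_real (x $ i)) = exp (\<i> * complex_of_real (y $ i))"
      using assms by (simp add: torus_embed_def vec_eq_iff chr_def inner_axis')
    then obtain n :: int where "\<i> * complex_of_real (x $ i) = \<i> * complex_of_real (y $ i) + complex_of_int (2 * n) * pi * \<i>"
      by (auto simp: exp_eq)
    then have "x $ i = y $ i + 2 * pi * n"
      by (auto simp: complex_eq_iff algebra_simps)
    then show ?thesis ..
  qed
  then obtain n :: "'d \<Rightarrow> int" where n: "\<And>i. x $ i = y $ i + 2 * pi * n i" by metis
  then show ?thesis
    by (intro bexI[of _ "\<chi> i. real_of_int (n i)"]) (auto simp: vec_eq_iff int_lattice_def)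
qed

lemma periodic_add_int:
  assumes "periodic f"
  shows "f (x + (2 * pi * real_of_int n) *\<^sub>R axis i 1) = f x"
proof -
  have nat: "f (x + (2 * pi * real m) *\<^sub>R axis i 1) = f x" for m and x
  proof (induction m arbitrary: x)
    case (Suc m)
    have "x + (2 * pi * real (Suc m)) *\<^sub>R axis i 1 = (x + (2 * pi * real m) *\<^sub>R axis i 1) + (2 * pi) *\<^sub>R axis i 1"
      by (simp add: algebra_simps)
    then show ?case using assms Suc unfolding periodic_def by metis
  qed simp
  show ?thesis
  proof (cases "n \<ge> 0")
    case True
    then show ?thesis using nat[of x "nat n"] by simp
  next
    case False
    then show ?thesis using nat[of "x + (2 * pi * real_of_int n) *\<^sub>R axis i 1" "nat (- n)"]
      by (simp add: algebra_simps flip: scaleR_add_left)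
  qed
qed

lemma periodic_add_lattice:
  assumes "periodic f" "k \<in> int_lattice"
  shows "f (x + (2 * pi) *\<^sub>R k) = f (x :: real^'d)"
proof -
  have "f (x + (2 * pi) *\<^sub>R (\<Sum>i\<in>I. (k $ i) *\<^sub>R axis i 1)) = f x" if "finite I" for I :: "'d set"
    using that
  proof (induction I)
    case (insert i I)
    obtain n :: int where n: "k $ i = n" using assms(2) by (auto simp: int_lattice_def elim: Ints_cases)
    have eq: "x + (2 * pi) *\<^sub>R (\<Sum>i\<in>insert i I. (k $ i) *\<^sub>R axis i 1) =
        (x + (2 * pi) *\<^sub>R (\<Sum>i\<in>I. (k $ i) *\<^sub>R axis i 1)) + (2 * pi * real_of_int n) *\<^sub>R axis i 1"
      using insert.hyps n by (simp add: algebra_simps)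
    show ?case by (simp only: eq insert.IH periodic_add_int[OF assms(1)])
  qed simp
  from this[of UNIV] show ?thesis
    by (simp add: basis_expansion flip: scalar_mult_eq_scaleR)
qed

lemma torus_representative: "\<exists>k\<in>int_lattice. x + (2 * pi) *\<^sub>R k \<in> (torus :: (real^'d) set)"
proof (intro bexI)
  let ?k = "\<chi> i. - real_of_int \<lfloor>(x $ i + pi) / (2 * pi)\<rfloor>"
  show "?k \<in> int_lattice" by (simp add: int_lattice_def)
  show "x + (2 * pi) *\<^sub>R ?k \<in> torus"
  proof -
    have "- pi \<le> x $ i - 2 * pi * real_of_int \<lfloor>(x $ i + pi) / (2 * pi)\<rfloor>
      \<and> x $ i - 2 * pi * real_of_int \<lfloor>(x $ i + pi) / (2 * pi)\<rfloor> < pi" for i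
    proof -
      define y where "y = (x $ i + pi) / (2 * pi)"
      have y: "x $ i = 2 * pi * y - pi" by (simp add: y_def)
      have "2 * pi * real_of_int \<lfloor>y\<rfloor> \<le> 2 * pi * y" "2 * pi * y < 2 * pi * (real_of_int \<lfloor>y\<rfloor> + 1)"
        using floor_correct[of y] by (auto intro!: mult_left_mono mult_strict_left_mono)
      then show ?thesis unfolding y_def[symmetric] y by (simp add: algebra_simps)
    qed
    then show ?thesis by (simp add: torus_def)
  qed
qed

lemma periodic_all_torus:
  assumes "periodic f" "\<And>x. x \<in> torus \<Longrightarrow> P (f x)"
  shows "P (f (x :: real^'d))"
  using torus_representative[of x] periodic_add_lattice[OF assms(1)] assms(2) by metis

lemma periodic_chr:
  assumes "k \<in> int_lattice" shows "periodic (chr k)"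
  unfolding periodic_def
proof (intro allI)
  fix x i
  obtain n :: int where n: "k $ i = n" using assms by (auto simp: int_lattice_def elim: Ints_cases)
  have "chr k ((2 * pi) *\<^sub>R axis i 1) = 1"
    unfolding chr_def exp_eq_1 using n by (auto simp: inner_axis intro!: exI[of _ n])
  then show "chr k (x + (2 * pi) *\<^sub>R axis i 1) = chr k x" by (simp add: chr_shift)
qed

lemma periodic_mult: "periodic f \<Longrightarrow> periodic g \<Longrightarrow> periodic (\<lambda>x. f x * g x)"
  by (simp add: periodic_def)

lemma periodic_compose: "periodic f \<Longrightarrow> periodic (\<lambda>x. \<phi> (f x))"
  by (simp add: periodic_def)

lemma periodic_trig: "F \<subseteq> int_lattice \<Longrightarrow> periodic (trig F c)"
  unfolding periodic_def trig_def
  by (intro allI sum.cong refl) (simp add: subset_iff periodic_add_lattice[OF periodic_chr int_lattice_axis(1)])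

lemma periodic_tpoly: "tpoly p \<Longrightarrow> periodic p"
  using periodic_trig freqs_subset by (auto simp: tpoly_def)

text \<open>The error bound on one cell extends to the whole space because g and p are both
  periodic; the translated integrals below evaluate functions outside the cell.\<close>

lemma tpoly_uniform_approx_periodic:
  fixes g :: "real^'d \<Rightarrow> complex"
  assumes "continuous_on UNIV g" "periodic g" "0 < e"
  obtains p where "tpoly p" "\<And>x. cmod (g x - p x) < e"
proof (rule tpoly_uniform_approx[of g e])
  show "continuous_on (cbox (\<chi> i. - pi) (\<chi> i. pi)) g" using assms(1) continuous_on_subset by blast
  show "g x = g y" if "torus_embed x = torus_embed y" for x y
    using torus_embed_eqD[OF that] periodic_add_lattice[OF assms(2)] by auto
  fix p assume "tpoly p" "\<And>x. x \<in> cbox (\<chi> i. - pi) (\<chi> i. pi) \<Longrightarrow> cmod (g x - p x) < e"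
  moreover have "periodic (\<lambda>x. g x - p x)"
    using assms(2) periodic_tpoly[OF \<open>tpoly p\<close>] by (simp add: periodic_def)
  ultimately show thesis
    using that[of p] torus_subset_cbox periodic_all_torus[of "\<lambda>x. g x - p x" "\<lambda>z. cmod z < e"] by blast
qed (use assms(3) in simp)

text \<open>The shift multiplies mode k by \<open>chr k h\<close>. Only mode 0 has a nonzero
  integral, and its factor is 1.\<close>

lemma integral_shift_trig:
  assumes "finite F" "F \<subseteq> int_lattice"
  shows "(LINT x|tm. trig F c (x + h)) = (LINT x|tm. trig F c (x :: real^'d))"
proof -
  have int: "integrable tm (\<lambda>x. c * chr k x)" for c and k :: "real^'d"
    by (intro sqint_imp_integrable sqint_cmult sqint_chr)
  have "(LINT x|tm. trig F c (x + h)) = (\<Sum>k\<in>F. c k * chr k h * (LINT x|tm. chr k x))"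
  proof -
    have "(LINT x|tm. trig F c (x + h)) = (LINT x|tm. (\<Sum>k\<in>F. (c k * chr k h) * chr k x))"
      by (simp add: trig_def chr_shift mult.assoc)
    also have "\<dots> = (\<Sum>k\<in>F. (LINT x|tm. (c k * chr k h) * chr k x))"
      by (intro Bochner_Integration.integral_sum int)
    finally show ?thesis by simp
  qed
  also have "\<dots> = (\<Sum>k\<in>F. c k * (LINT x|tm. chr k x))"
    using assms by (intro sum.cong refl) (auto simp: integral_chr subset_iff)
  also have "\<dots> = (LINT x|tm. trig F c x)"
    unfolding trig_def by (subst Bochner_Integration.integral_sum) (auto intro: int)
  finally show ?thesis .
qed

lemma continuous_on_shift: "continuous_on UNIV g \<Longrightarrow> continuous_on UNIV (\<lambda>x::real^'d. g (x + h))"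
  by (rule continuous_on_compose2[of UNIV g]) (auto intro: continuous_intros)

text \<open>Translation invariance is inherited from trigonometric polynomials by uniform
  approximation, instead of cutting and regluing the cell.\<close>

lemma integral_shift:
  assumes "continuous_on UNIV g" "periodic g"
  shows "(LINT x|tm. g (x + h)) = (LINT x|tm. g (x :: real^'d))"
proof -
  let ?V = "(2 * pi) ^ CARD('d)"
  have bound: "cmod ((LINT x|tm. g (x + h)) - (LINT x|tm. g x)) \<le> 2 * ?V * e" if "e > 0" for e
  proof -
    obtain p where p: "tpoly p" "\<And>x. cmod (g x - p x) < e"
      using tpoly_uniform_approx_periodic[OF assms \<open>e > 0\<close>] by blast
    have cp: "continuous_on UNIV p" by (rule continuous_on_tpoly[OF p(1)])
    have shift: "(LINT x|tm. p (x + h)) = (LINT x|tm. p x)"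
      using p(1) integral_shift_trig[OF finite_freqs freqs_subset] by (auto simp: tpoly_def)
    have ints: "integrable tm (\<lambda>x. g (x + a))" "integrable tm (\<lambda>x. p (x + a))" for a
      using assms(1) cp by (auto intro!: sqint_imp_integrable sqint_continuous continuous_on_shift)
    have est: "cmod ((LINT x|tm. g (x + a)) - (LINT x|tm. p (x + a))) \<le> ?V * e" for a
    proof -
      have "cmod ((LINT x|tm. g (x + a)) - (LINT x|tm. p (x + a))) = cmod (LINT x|tm. g (x + a) - p (x + a))"
        using ints by simp
      also have "\<dots> \<le> (LINT x|tm. cmod (g (x + a) - p (x + a)))"
        by (rule integral_norm_bound)
      also have "\<dots> \<le> (LINT x|(tm :: (real^'d) measure). e)"
        by (rule integral_mono) (use ints p(2) in \<open>auto intro!: less_imp_le\<close>)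
      finally show ?thesis by (simp add: measure_torus)
    qed
    have "(LINT x|tm. g (x + h)) - (LINT x|tm. g x) =
        ((LINT x|tm. g (x + h)) - (LINT x|tm. p (x + h))) - ((LINT x|tm. g (x + 0)) - (LINT x|tm. p (x + 0)))"
      by (simp add: shift)
    also have "cmod \<dots> \<le> ?V * e + ?V * e"
      by (rule order_trans[OF norm_triangle_ineq4 add_mono[OF est est]])
    finally show ?thesis by (simp add: algebra_simps)
  qed
  have "cmod ((LINT x|tm. g (x + h)) - (LINT x|tm. g x)) \<le> 0"
  proof (rule field_le_epsilon)
    fix e :: real assume "0 < e"
    then show "cmod ((LINT x|tm. g (x + h)) - (LINT x|tm. g x)) \<le> 0 + e"
      using bound[of "e / (2 * ?V)"] by simp
  qed
  then show ?thesis by simp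
qed

lemma fourier_coeff_shift:
  assumes "continuous_on UNIV g" "periodic g" "k \<in> int_lattice"
  shows "fourier_coeff (\<lambda>x. g (x + h)) k = chr k h * fourier_coeff g (k :: real^'d)"
proof -
  have "ip (\<lambda>x. g (x + h)) (chr k) = (LINT x|tm. chr k h * (g (x + h) * cnj (chr k (x + h))))"
  proof -
    have "chr k h * cnj (chr k h) = 1"
      using norm_chr[of k h] complex_norm_square[of "chr k h"] by simp
    then have "chr k h * (g (x + h) * cnj (chr k (x + h))) = g (x + h) * cnj (chr k x)" for x
      by (simp add: chr_shift algebra_simps)
    then show ?thesis by (simp only: ip_def)
  qed
  also have "\<dots> = chr k h * (LINT x|tm. g (x + h) * cnj (chr k (x + h)))" by simp
  also have "(LINT x|tm. g (x + h) * cnj (chr k (x + h))) = (LINT x|tm. g x * cnj (chr k x))"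
    by (rule integral_shift)
       (use assms in \<open>auto intro!: continuous_intros periodic_mult periodic_compose[of _ cnj] periodic_chr\<close>)
  finally show ?thesis by (simp add: fourier_coeff_ip ip_def)
qed

text \<open>The quotient |exp (i k_i h) - 1| / h tends to |k_i|, which turns the phase factors of
  translations into the weights of the H^1 seminorm.\<close>

lemma chr_axis_difference_limit:
  "(\<lambda>n. (cmod (chr k ((1 / real (Suc n)) *\<^sub>R axis i 1) - 1) * real (Suc n))\<^sup>2) \<longlonglongrightarrow> (k $ i)\<^sup>2"
proof -
  let ?h = "\<lambda>n. complex_of_real (1 / real (Suc n))"
  have "((\<lambda>z. exp (\<i> * (k $ i) * z)) has_field_derivative \<i> * (k $ i)) (at 0)"
    by (auto intro!: derivative_eq_intros)
  then have "((\<lambda>z. (exp (\<i> * (k $ i) * z) - 1) / z) \<longlongrightarrow> \<i> * (k $ i)) (at 0)"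
    by (simp add: has_field_derivative_iff)
  moreover have "filterlim ?h (at 0) sequentially"
    unfolding filterlim_at
    using tendsto_of_real[OF LIMSEQ_Suc[OF lim_1_over_n], where 'a=complex] by (auto simp del: of_nat_Suc)
  ultimately have "(\<lambda>n. (exp (\<i> * (k $ i) * ?h n) - 1) / ?h n) \<longlonglongrightarrow> \<i> * (k $ i)"
    by (rule filterlim_compose)
  then have "(\<lambda>n. (cmod ((exp (\<i> * (k $ i) * ?h n) - 1) / ?h n))\<^sup>2) \<longlonglongrightarrow> (cmod (\<i> * (k $ i)))\<^sup>2"
    by (intro tendsto_intros)
  moreover have "cmod ((exp (\<i> * (k $ i) * ?h n) - 1) / ?h n) =
      cmod (chr k ((1 / real (Suc n)) *\<^sub>R axis i 1) - 1) * real (Suc n)" for n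
    by (simp add: chr_def norm_divide norm_mult inner_axis mult.assoc mult.commute del: of_nat_Suc)
  ultimately show ?thesis by (simp add: norm_mult del: of_nat_Suc)
qed

text \<open>Bessel's inequality is applied to the difference quotients of \<open>\<phi> \<circ> trig F c\<close> along the axes.\<close>

lemma H1_Lipschitz_compose:
  fixes c :: "real^'d \<Rightarrow> complex"
  assumes F: "finite F" "F \<subseteq> int_lattice" and F': "finite F'" "F' \<subseteq> int_lattice"
    and Lip: "\<And>z w. cmod (\<phi> z - \<phi> w) \<le> L * cmod (z - w)" and L: "0 \<le> L"
  shows "(\<Sum>k\<in>F'. (norm k)\<^sup>2 * (cmod (fourier_coeff (\<lambda>x. \<phi> (trig F c x)) k))\<^sup>2)
    \<le> L\<^sup>2 * (\<Sum>k\<in>F. (norm k)\<^sup>2 * (cmod (c k))\<^sup>2)"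
proof -
  let ?V = "(2 * pi) ^ CARD('d)"
  define g where "g x = \<phi> (trig F c x)" for x
  have "L-lipschitz_on UNIV \<phi>" using Lip L by (intro lipschitz_onI) (auto simp: dist_norm)
  then have "continuous_on UNIV \<phi>" by (rule lipschitz_on_continuous_on)
  then have cg: "continuous_on UNIV g"
    unfolding g_def by (rule continuous_on_compose2[OF _ continuous_on_trig subset_UNIV])
  have pg: "periodic g" unfolding g_def by (rule periodic_compose[OF periodic_trig[OF F(2)]])
  \<comment> \<open>A translation difference multiplies mode k by \<open>chr k h - 1\<close>. Bessel
    bounds the left side, the Lipschitz condition compares the two increments pointwise, and for the
    polynomial itself the L2 norm is an exact finite sum.\<close>
  have shifted: "(\<Sum>k\<in>F'. (cmod (chr k h - 1))\<^sup>2 * (cmod (fourier_coeff g k))\<^sup>2)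
      \<le> L\<^sup>2 * (\<Sum>k\<in>F. (cmod (chr k h - 1))\<^sup>2 * (cmod (c k))\<^sup>2)" for h
  proof -
    have sg: "sqint g" "sqint (\<lambda>x. g (x + h))" using cg by (auto intro!: sqint_continuous continuous_on_shift)
    have "?V * (\<Sum>k\<in>F'. (cmod (chr k h - 1))\<^sup>2 * (cmod (fourier_coeff g k))\<^sup>2) =
        ?V * (\<Sum>k\<in>F'. (cmod (fourier_coeff (\<lambda>x. g (x + h) - g x) k))\<^sup>2)"
    proof -
      have "fourier_coeff (\<lambda>x. g (x + h) - g x) k = (chr k h - 1) * fourier_coeff g k" if "k \<in> F'" for k
        using that F' by (subst fourier_coeff_diff) (auto simp: fourier_coeff_shift cg pg sg subset_iff algebra_simps)
      then show ?thesis by (simp add: norm_mult power_mult_distrib cong: sum.cong)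
    qed
    also have "\<dots> \<le> (L2_norm (\<lambda>x. g (x + h) - g x))\<^sup>2"
      by (intro Bessel F' sqint_diff sg)
    also have "\<dots> \<le> (L2_norm (\<lambda>x. complex_of_real L * (trig F c (x + h) - trig F c x)))\<^sup>2"
    proof (intro power_mono L2_norm_mono L2_norm_nonneg)
      show "sqint (\<lambda>x. complex_of_real L * (trig F c (x + h) - trig F c x))"
        by (intro sqint_cmult sqint_diff sqint_trig) (intro sqint_continuous continuous_on_shift continuous_intros)
      show "(\<lambda>x. g (x + h) - g x) \<in> borel_measurable tm" using sqint_diff[OF sg(2,1)] by (simp add: sqint_def)
      show "AE x in tm. cmod (g (x + h) - g x) \<le> cmod (complex_of_real L * (trig F c (x + h) - trig F c x))"
        using Lip L by (auto simp: g_def norm_mult)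
    qed
    also have "(\<lambda>x. complex_of_real L * (trig F c (x + h) - trig F c x)) =
        (\<lambda>x. complex_of_real L * trig F (\<lambda>k. (chr k h - 1) * c k) x)"
      by (simp add: trig_def fun_eq_iff chr_shift sum_subtractf algebra_simps)
    also have "(L2_norm \<dots>)\<^sup>2 = ?V * (L\<^sup>2 * (\<Sum>k\<in>F. (cmod (chr k h - 1))\<^sup>2 * (cmod (c k))\<^sup>2))"
      by (simp add: L2_norm_cmult power_mult_distrib L2_norm_trig[OF F] norm_mult)
    finally show ?thesis by simp
  qed
  \<comment> \<open>Dividing by h^2 and letting h = 1 / (n + 1) tend to 0 replaces the phase weights
    by \<open>(k $ i)\<^sup>2\<close>; both sums are finite, so the limit is taken termwise.\<close>
  have coord: "(\<Sum>k\<in>F'. (k $ i)\<^sup>2 * (cmod (fourier_coeff g k))\<^sup>2) \<le> L\<^sup>2 * (\<Sum>k\<in>F. (k $ i)\<^sup>2 * (cmod (c k))\<^sup>2)" for i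
  proof -
    let ?q = "\<lambda>k n. (cmod (chr k ((1 / real (Suc n)) *\<^sub>R axis i 1) - 1) * real (Suc n))\<^sup>2"
    have lim: "(\<lambda>n. \<Sum>k\<in>S. ?q k n * b k) \<longlonglongrightarrow> (\<Sum>k\<in>S. (k $ i)\<^sup>2 * b k)" for S b
      by (intro tendsto_intros chr_axis_difference_limit)
    show ?thesis
    proof (rule LIMSEQ_le)
      show "(\<lambda>n. \<Sum>k\<in>F'. ?q k n * (cmod (fourier_coeff g k))\<^sup>2) \<longlonglongrightarrow> (\<Sum>k\<in>F'. (k $ i)\<^sup>2 * (cmod (fourier_coeff g k))\<^sup>2)"
        by (rule lim)
      show "(\<lambda>n. L\<^sup>2 * (\<Sum>k\<in>F. ?q k n * (cmod (c k))\<^sup>2)) \<longlonglongrightarrow> L\<^sup>2 * (\<Sum>k\<in>F. (k $ i)\<^sup>2 * (cmod (c k))\<^sup>2)"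
        by (intro tendsto_mult lim tendsto_const)
      have "(\<Sum>k\<in>F'. ?q k n * (cmod (fourier_coeff g k))\<^sup>2) \<le> L\<^sup>2 * (\<Sum>k\<in>F. ?q k n * (cmod (c k))\<^sup>2)" for n
        using mult_left_mono[OF shifted[of "(1 / real (Suc n)) *\<^sub>R axis i 1"], of "(real (Suc n))\<^sup>2"]
        by (simp add: power_mult_distrib sum_distrib_left mult_ac del: of_nat_Suc)
      then show "\<exists>N. \<forall>n\<ge>N. (\<Sum>k\<in>F'. ?q k n * (cmod (fourier_coeff g k))\<^sup>2) \<le> L\<^sup>2 * (\<Sum>k\<in>F. ?q k n * (cmod (c k))\<^sup>2)"
        by blast
    qed
  qed
  have norm_sq: "(\<Sum>k\<in>S. (norm k)\<^sup>2 * b k) = (\<Sum>i\<in>UNIV. \<Sum>k\<in>S. (k $ i)\<^sup>2 * b k)"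
    for S :: "(real^'d) set" and b :: "real^'d \<Rightarrow> real"
  proof -
    have "(norm k)\<^sup>2 = (\<Sum>i\<in>UNIV. (k $ i)\<^sup>2)" for k :: "real^'d"
      by (simp add: norm_eq_sqrt_inner inner_vec_def power2_eq_square sum_nonneg)
    then show ?thesis by (subst sum.swap) (simp add: sum_distrib_right)
  qed
  show ?thesis
    unfolding g_def[symmetric] norm_sq by (subst sum_distrib_left) (intro sum_mono coord)
qed

section \<open>Density in L2\<close>

definition approximable :: "(real^'d \<Rightarrow> complex) \<Rightarrow> bool" where
  "approximable f \<longleftrightarrow> (\<forall>e>0. \<exists>p. tpoly p \<and> L2_norm (\<lambda>x. f x - p x) < e)"

lemma approximable_limit:
  assumes "sqint f" "\<And>e. e > 0 \<Longrightarrow> \<exists>g. sqint g \<and> approximable g \<and> L2_norm (\<lambda>x. f x - g x) < e"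
  shows "approximable f"
  unfolding approximable_def
proof (intro allI impI)
  fix e :: real assume "e > 0"
  then obtain g where g: "sqint g" "approximable g" "L2_norm (\<lambda>x. f x - g x) < e / 2"
    using assms(2)[of "e / 2"] by auto
  obtain p where p: "tpoly p" "L2_norm (\<lambda>x. g x - p x) < e / 2"
    using g(2) \<open>e > 0\<close> unfolding approximable_def by (meson half_gt_zero)
  have "L2_norm (\<lambda>x. f x - p x) < e"
    using L2_norm_dist_triangle[OF assms(1) g(1) sqint_tpoly[OF p(1)]] g(3) p(2) by simp
  then show "\<exists>p. tpoly p \<and> L2_norm (\<lambda>x. f x - p x) < e" using p(1) by blast
qed

lemma approximable_cmult:
  assumes "approximable f" shows "approximable (\<lambda>x. c * f x)"
  unfolding approximable_def
proof (intro allI impI)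
  fix e :: real assume e: "e > 0"
  have "e / (cmod c + 1) > 0" using e by (intro divide_pos_pos add_nonneg_pos) auto
  then obtain p where p: "tpoly p" "L2_norm (\<lambda>x. f x - p x) < e / (cmod c + 1)"
    using assms unfolding approximable_def by blast
  have "L2_norm (\<lambda>x. c * f x - c * p x) = cmod c * L2_norm (\<lambda>x. f x - p x)"
    using L2_norm_cmult[of c "\<lambda>x. f x - p x"] by (simp add: right_diff_distrib)
  also have "\<dots> \<le> cmod c * (e / (cmod c + 1))" using p(2) by (intro mult_left_mono) auto
  also have "\<dots> < e" using e add_nonneg_pos[OF norm_ge_zero[of c] zero_less_one] by (simp add: pos_divide_less_eq algebra_simps)
  finally show "\<exists>p. tpoly p \<and> L2_norm (\<lambda>x. c * f x - p x) < e" using tpoly_cmult[OF p(1)] by blast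
qed

lemma approximable_add:
  assumes "sqint f" "sqint g" "approximable f" "approximable g"
  shows "approximable (\<lambda>x. f x + g x)"
  unfolding approximable_def
proof (intro allI impI)
  fix e :: real assume e: "e > 0"
  obtain p where p: "tpoly p" "L2_norm (\<lambda>x. f x - p x) < e / 2"
    using assms(3) e unfolding approximable_def by (meson half_gt_zero)
  obtain q where q: "tpoly q" "L2_norm (\<lambda>x. g x - q x) < e / 2"
    using assms(4) e unfolding approximable_def by (meson half_gt_zero)
  have "L2_norm (\<lambda>x. (f x - p x) + (g x - q x)) \<le> L2_norm (\<lambda>x. f x - p x) + L2_norm (\<lambda>x. g x - q x)"
    using assms(1,2) p(1) q(1) by (intro L2_norm_triangle sqint_diff) (auto intro: sqint_tpoly)
  then have "L2_norm (\<lambda>x. f x + g x - (p x + q x)) < e" using p(2) q(2) by (simp add: algebra_simps)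
  then show "\<exists>p. tpoly p \<and> L2_norm (\<lambda>x. f x + g x - p x) < e" using tpoly_add[OF p(1) q(1)] by blast
qed

lemma approximable_zero: "approximable (\<lambda>x. 0)"
  unfolding approximable_def by (auto intro!: exI[of _ "\<lambda>x. 0"] tpoly_const simp: L2_norm_def)

lemma approximable_sum:
  assumes "\<And>i. i \<in> I \<Longrightarrow> sqint (f i)" "\<And>i. i \<in> I \<Longrightarrow> approximable (f i)"
  shows "approximable (\<lambda>x. \<Sum>i\<in>I. f i x)"
  using assms
proof (induction I rule: infinite_finite_induct)
  case (insert i I)
  then have "approximable (\<lambda>x. f i x + (\<Sum>i\<in>I. f i x))"
    by (intro approximable_add sqint_sum) auto
  then show ?case using insert.hyps by simp
qed (auto intro: approximable_zero)

lemma approximable_continuous: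
  fixes g :: "real^'d \<Rightarrow> complex"
  assumes cont: "continuous_on UNIV g"
    and compat: "\<And>x y. x \<in> cbox (\<chi> i. - pi) (\<chi> i. pi) \<Longrightarrow> y \<in> cbox (\<chi> i. - pi) (\<chi> i. pi) \<Longrightarrow>
      torus_embed x = torus_embed y \<Longrightarrow> g x = g y"
  shows "approximable g"
  unfolding approximable_def
proof (intro allI impI)
  fix e :: real assume e: "e > 0"
  let ?s = "sqrt ((2 * pi) ^ CARD('d))"
  have e': "e / (2 * ?s) > 0" using e by simp
  obtain p where p: "tpoly p" "\<And>x. x \<in> cbox (\<chi> i. - pi) (\<chi> i. pi) \<Longrightarrow> cmod (g x - p x) < e / (2 * ?s)"
    using tpoly_uniform_approx[OF continuous_on_subset[OF cont subset_UNIV] compat e'] by blast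
  have "L2_norm (\<lambda>x. g x - p x) \<le> ?s * (e / (2 * ?s))"
  proof (rule L2_norm_le_sup)
    show "(\<lambda>x. g x - p x) \<in> borel_measurable tm"
      by (intro borel_measurable_continuous_tm continuous_intros cont continuous_on_tpoly[OF p(1)])
    show "AE x in tm. cmod (g x - p x) \<le> e / (2 * ?s)"
      by (intro AE_torusI less_imp_le p(2)) (use torus_subset_cbox in blast)
  qed (use e in simp)
  also have "\<dots> = e / 2" by simp
  also have "\<dots> < e" using e by simp
  finally show "\<exists>p. tpoly p \<and> L2_norm (\<lambda>x. g x - p x) < e" using p(1) by blast
qed

lemma AE_torus_box: "AE x in tm. x \<in> box (\<chi> i. - pi) (\<chi> i. pi :: (real^'d))"
proof -
  have "AE x in lebesgue. x \<notin> (cbox (\<chi> i. - pi) (\<chi> i. pi) - box (\<chi> i. - pi) (\<chi> i. pi) :: (real^'d) set)"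
    by (rule AE_not_in) (simp add: negligible_frontier_interval flip: negligible_iff_null_sets)
  then show ?thesis
    using torus_subset_cbox by (subst AE_restrict_space_iff) (auto elim!: eventually_mono)
qed

lemma sqint_indicator: "A \<in> sets tm \<Longrightarrow> sqint (indicator A)"
  by (rule sqint_bounded[of _ 1]) (auto simp: indicator_def)

text \<open>Regularity of Lebesgue measure puts a closed K inside and an open U outside the set with
  \<open>U - K\<close> small; a Urysohn function for K and the complement of U differs from the
  indicator only there. The set is first cut down to the open cube, a null change, so that the
  function vanishes on the faces and is compatible with their identification.\<close>

lemma approximable_indicator:
  assumes "A \<in> sets (tm :: (real^'d) measure)"
  shows "approximable (indicator A)"
proof (rule approximable_limit)
  let ?B = "box (\<chi> i. - pi) (\<chi> i. pi) :: (real^'d) set"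
  have A: "A \<in> sets lebesgue" "A \<subseteq> torus" using assms by (auto simp: sets_restrict_space_iff)
  show sA: "sqint (indicator A)"
    using assms by (rule sqint_indicator)
  fix e :: real assume e: "e > 0"
  define A' where "A' = A \<inter> ?B"
  have A': "A' \<in> sets lebesgue" using A(1) by (auto simp: A'_def)
  \<comment> \<open>The L2 norm of an indicator is the square root of the measure, so the outer and
    the inner approximation may each cost half of \<open>e\<^sup>2\<close>.\<close>
  have e2: "e\<^sup>2 / 2 > 0" using e by simp
  obtain U where U: "open U" "A' \<subseteq> U" "U - A' \<in> lmeasurable" "emeasure lebesgue (U - A') < ennreal (e\<^sup>2 / 2)"
    using sets_lebesgue_outer_open[OF A' e2] by blast
  obtain K where K: "closed K" "K \<subseteq> A'" "A' - K \<in> lmeasurable" "emeasure lebesgue (A' - K) < ennreal (e\<^sup>2 / 2)"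
    using sets_lebesgue_inner_closed[OF A' e2] by blast
  have "closed (- (U \<inter> ?B))" using U(1) by (intro closed_Compl open_Int open_box)
  moreover have "K \<inter> - (U \<inter> ?B) = {}" using K(2) U(2) by (auto simp: A'_def)
  ultimately obtain f :: "real^'d \<Rightarrow> complex" where f: "continuous_on UNIV f"
    "\<And>x. f x \<in> closed_segment 1 0" "\<And>x. x \<in> K \<Longrightarrow> f x = 1" "\<And>x. x \<notin> U \<inter> ?B \<Longrightarrow> f x = 0"
    using Urysohn[OF K(1), of "- (U \<inter> ?B)" 1 0] by (metis ComplI)
  have f01: "cmod (f x) \<le> 1" "cmod (1 - f x) \<le> 1" for x
  proof -
    obtain t where t: "0 \<le> t" "t \<le> 1" "f x = (1 - t) *\<^sub>R 1 + t *\<^sub>R 0"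
      using f(2)[of x] unfolding in_segment by blast
    then have "f x = complex_of_real (1 - t)" "1 - f x = complex_of_real t"
      by (simp_all add: scaleR_conv_of_real)
    then show "cmod (f x) \<le> 1" "cmod (1 - f x) \<le> 1" using t by (simp_all only: norm_of_real)
  qed
  define D where "D = (U - A') \<union> (A' - K)"
  have D: "D \<in> lmeasurable" unfolding D_def using U(3) K(3) by auto
  have mD: "measure lebesgue D < e\<^sup>2"
  proof -
    have "measure lebesgue D \<le> measure lebesgue (U - A') + measure lebesgue (A' - K)"
      unfolding D_def using U(3) K(3) by (intro measure_Un_le) auto
    also have "\<dots> < e\<^sup>2 / 2 + e\<^sup>2 / 2"
      using U(3,4) K(3,4) e2 by (intro add_strict_mono) (simp_all add: emeasure_eq_measure2 ennreal_less_iff)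
    finally show ?thesis by simp
  qed
  have mt: "D \<inter> torus \<in> sets tm" using D by (auto simp: sets_restrict_space_iff)
  have ind_sq: "sqint (indicator (D \<inter> torus))"
    using mt by (rule sqint_indicator)
  have sf: "sqint f" by (rule sqint_continuous[OF f(1)])
  have "L2_norm (\<lambda>x. indicator A x - f x) \<le> L2_norm (indicator (D \<inter> torus))"
  proof (rule L2_norm_mono[OF ind_sq])
    show "(\<lambda>x. indicator A x - f x) \<in> borel_measurable tm"
      using sqint_diff[OF sA sf] by (simp add: sqint_def)
    have *: "cmod (indicator A x - f x) \<le> cmod (indicator (D \<inter> torus) x)" if "x \<in> ?B" "x \<in> torus" for x
    proof (cases "x \<in> D")
      case True
      then show ?thesis using f01[of x] that by (auto simp: indicator_def)
    next
      case False
      then show ?thesis using f(3,4)[of x] that K(2) by (auto simp: D_def A'_def indicator_def)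
    qed
    have "AE x in tm. x \<in> (torus :: (real^'d) set)" by (rule AE_torusI)
    then show "AE x in tm. cmod (indicator A x - f x) \<le> cmod (indicator (D \<inter> torus) x)"
      using AE_torus_box by eventually_elim (rule *)
  qed
  also have "L2_norm (indicator (D \<inter> torus) :: real^'d \<Rightarrow> complex) = sqrt (measure tm (D \<inter> torus))"
  proof -
    have "(\<lambda>x. (cmod (indicator (D \<inter> torus) x))\<^sup>2) = (indicator (D \<inter> torus) :: real^'d \<Rightarrow> real)"
      by (auto simp: indicator_def)
    then show ?thesis using mt by (simp add: L2_norm_def)
  qed
  also have "measure tm (D \<inter> torus) = measure lebesgue (D \<inter> torus)"
    by (rule measure_restrict_space) auto
  also have "sqrt \<dots> \<le> sqrt (measure lebesgue D)"
    using D by (intro real_sqrt_le_mono measure_mono_fmeasurable) auto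
  also have "\<dots> < sqrt (e\<^sup>2)" using mD by (rule real_sqrt_less_mono)
  also have "\<dots> = e" using e by simp
  finally have "L2_norm (\<lambda>x. indicator A x - f x) < e" .
  \<comment> \<open>Two distinct points of the closed cube that differ by a lattice vector lie on
    opposite faces, where f vanishes.\<close>
  moreover have "approximable f"
  proof (rule approximable_continuous[OF f(1)])
    fix x y :: "real^'d"
    assume xy: "x \<in> cbox (\<chi> i. - pi) (\<chi> i. pi)" "y \<in> cbox (\<chi> i. - pi) (\<chi> i. pi)" "torus_embed x = torus_embed y"
    obtain k where k: "k \<in> int_lattice" "x = y + (2 * pi) *\<^sub>R k" using torus_embed_eqD[OF xy(3)] by blast
    show "f x = f y"
    proof (cases "k = 0")
      case False
      then obtain i where i: "k $ i \<noteq> 0" by (auto simp: vec_eq_iff)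
      then have "1 \<le> \<bar>k $ i\<bar>" using k(1) by (auto simp: int_lattice_def intro!: Ints_nonzero_abs_ge1)
      then have "2 * pi \<le> 2 * pi * \<bar>k $ i\<bar>" by simp
      also have "\<dots> = \<bar>x $ i - y $ i\<bar>" by (simp add: k(2) abs_mult)
      finally have "\<bar>x $ i\<bar> = pi" "\<bar>y $ i\<bar> = pi"
        using xy(1,2) by (auto simp: mem_box_cart dest!: spec[of _ i])
      then have "x \<notin> ?B" "y \<notin> ?B" by (auto simp: mem_box_cart intro!: exI[of _ i])
      then show ?thesis using f(4) by simp
    qed (use k in simp)
  qed
  ultimately show "\<exists>g. sqint g \<and> approximable g \<and> L2_norm (\<lambda>x. indicator A x - g x) < e"
    using sf by (intro exI[of _ f] conjI)
qed

text \<open>Simple functions F with |F| \<le> 2 |f| converge pointwise to f, so |f - F|^2 \<le> 9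
  |f|^2 is an integrable majorant; each simple function is a finite combination of
  indicators.\<close>

lemma approximable_sqint:
  assumes f: "sqint (f :: real^'d \<Rightarrow> complex)" shows "approximable f"
proof (rule approximable_limit[OF f])
  fix e :: real assume e: "e > 0"
  from borel_measurable_implies_sequence_metric[OF sqint_measurable[OF f], of 0]
  have "\<exists>F. (\<forall>i. simple_function tm (F i)) \<and> (\<forall>x\<in>torus. (\<lambda>i. F i x) \<longlonglongrightarrow> f x) \<and>
    (\<forall>i. \<forall>x\<in>torus. cmod (F i x) \<le> 2 * cmod (f x))"
    by (simp only: space_lebesgue_on dist_norm diff_zero)
  then obtain F where F: "\<And>i. simple_function tm (F i)" "\<And>x. x \<in> torus \<Longrightarrow> (\<lambda>i. F i x) \<longlonglongrightarrow> f x"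
    "\<And>i x. x \<in> torus \<Longrightarrow> cmod (F i x) \<le> 2 * cmod (f x)"
    by blast
  have mF: "F i \<in> borel_measurable tm" for i by (rule borel_measurable_simple_function[OF F(1)])
  have sF: "sqint (F i)" for i
    by (rule sqint_dominated[OF f mF, of _ 2]) (intro AE_torusI F(3))
  have aF: "approximable (F i)" for i
  proof (rule approximable_limit[OF sF])
    fix e :: real assume e: "e > 0"
    let ?G = "\<lambda>x. \<Sum>y\<in>F i ` torus. y * indicator (F i -` {y} \<inter> torus) x"
    have ind: "F i -` {y} \<inter> torus \<in> sets tm" for y
      using measurable_sets[OF mF[of i], of "{y}"] by simp
    have sG: "sqint (\<lambda>x. y * indicator (F i -` {y} \<inter> torus) x)" for y
      by (intro sqint_cmult sqint_indicator ind)
    have sqG: "sqint ?G" by (intro sqint_sum sG)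
    have aG: "approximable ?G"
      by (intro approximable_sum sG approximable_cmult approximable_indicator ind)
    have eqG: "F i x = ?G x" if x: "x \<in> torus" for x
    proof -
      have "F i x = (\<Sum>y\<in>F i ` torus. indicator (F i -` {y} \<inter> torus) x *\<^sub>R y)"
        using simple_function_indicator_representation_banach[OF F(1), of x i] x
        by (simp only: space_lebesgue_on)
      also have "\<dots> = ?G x" by (intro sum.cong refl) (simp add: indicator_def)
      finally show ?thesis .
    qed
    have "L2_norm (\<lambda>x. F i x - ?G x) = L2_norm (\<lambda>x::real^'d. 0)"
    proof (rule L2_norm_cong_AE)
      show "(\<lambda>x. F i x - ?G x) \<in> borel_measurable tm"
        by (rule sqint_measurable[OF sqint_diff[OF sF sqG]])
      show "AE x in tm. F i x - ?G x = 0"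
        by (rule AE_torusI) (rule right_minus_eq[THEN iffD2, OF eqG])
    qed simp
    also have "\<dots> = 0" by (simp add: L2_norm_def)
    also note e
    finally show "\<exists>g. sqint g \<and> approximable g \<and> L2_norm (\<lambda>x. F i x - g x) < e"
      by (intro exI[of _ ?G] conjI sqG aG)
  qed
  have "(\<lambda>i. LINT x|tm. (cmod (f x - F i x))\<^sup>2) \<longlonglongrightarrow> (LINT x|(tm :: (real^'d) measure). 0)"
  proof (rule integral_dominated_convergence[where w="\<lambda>x. 9 * (cmod (f x))\<^sup>2"])
    show "(\<lambda>x. (cmod (f x - F i x))\<^sup>2) \<in> borel_measurable tm" for i
      by (rule borel_measurable_integrable[OF sqint_integrable[OF sqint_diff[OF f sF]]])
    show "integrable tm (\<lambda>x. 9 * (cmod (f x))\<^sup>2)" using f by (simp add: sqint_def)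
    show "AE x in tm. (\<lambda>i. (cmod (f x - F i x))\<^sup>2) \<longlonglongrightarrow> 0"
    proof (rule AE_torusI)
      fix x :: "real^'d" assume "x \<in> torus"
      then have "(\<lambda>i. (cmod (f x - F i x))\<^sup>2) \<longlonglongrightarrow> (cmod (f x - f x))\<^sup>2"
        by (intro tendsto_intros F(2))
      then show "(\<lambda>i. (cmod (f x - F i x))\<^sup>2) \<longlonglongrightarrow> 0" by simp
    qed
    show "AE x in tm. norm ((cmod (f x - F i x))\<^sup>2) \<le> 9 * (cmod (f x))\<^sup>2" for i
    proof (rule AE_torusI)
      fix x :: "real^'d" assume x: "x \<in> torus"
      have "cmod (f x - F i x) \<le> 3 * cmod (f x)"
        using norm_triangle_ineq4[of "f x" "F i x"] F(3)[OF x, of i] by simp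
      then have "(cmod (f x - F i x))\<^sup>2 \<le> (3 * cmod (f x))\<^sup>2" by (intro power_mono) auto
      then show "norm ((cmod (f x - F i x))\<^sup>2) \<le> 9 * (cmod (f x))\<^sup>2" by (simp add: power_mult_distrib)
    qed
  qed simp
  then have "(\<lambda>i. L2_norm (\<lambda>x. f x - F i x)) \<longlonglongrightarrow> sqrt 0"
    unfolding L2_norm_def by (intro tendsto_real_sqrt) simp
  then have "eventually (\<lambda>i. L2_norm (\<lambda>x. f x - F i x) < e) sequentially"
    using e by (intro order_tendstoD) auto
  then obtain i where "L2_norm (\<lambda>x. f x - F i x) < e" by (auto simp: eventually_sequentially)
  then show "\<exists>g. sqint g \<and> approximable g \<and> L2_norm (\<lambda>x. f x - g x) < e"
    using sF aF by (intro exI[of _ "F i"] conjI)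
qed

text \<open>Some trigonometric polynomial is within e of f. For every larger cube its coefficients
  extend by zero, and the projection onto that cube is at least as close.\<close>

lemma proj_tendsto:
  assumes f: "sqint (f :: real^'d \<Rightarrow> complex)" and e: "e > 0"
  obtains N where "\<And>M. N \<le> M \<Longrightarrow> L2_norm (\<lambda>x. f x - proj M f x) < e"
proof -
  obtain N c where Nc: "L2_norm (\<lambda>x. f x - trig (freqs N) c x) < e"
    using approximable_sqint[OF f] e unfolding approximable_def tpoly_def by blast
  show ?thesis
  proof (rule that)
    fix M assume "N \<le> M"
    from trig_extend[OF finite_freqs freqs_mono[OF this]]
    obtain c' where c': "trig (freqs N) c = trig (freqs M) c'" by blast
    have "L2_norm (\<lambda>x. f x - proj M f x) \<le> L2_norm (\<lambda>x. f x - trig (freqs M) c' x)"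
      unfolding proj_eq_trig by (intro L2_norm_diff_trig_best finite_freqs freqs_subset f)
    also have "\<dots> < e" using Nc by (simp add: c')
    finally show "L2_norm (\<lambda>x. f x - proj M f x) < e" .
  qed
qed

lemma trig_diff_subset:
  assumes "finite G" "F \<subseteq> G"
  shows "trig G c x - trig F c x = trig (G - F) c x"
  unfolding trig_def using assms by (simp add: sum_diff)

text \<open>This plays the role of Parseval for the tail: for large M the projection
  \<open>proj M f\<close> is close to f, and its difference from \<open>proj n f\<close> is a finite
  sum of modes outside \<open>freqs n\<close>, where the assumed bound applies.\<close>

lemma L2_norm_diff_proj_le:
  assumes f: "sqint (f :: real^'d \<Rightarrow> complex)" and B: "0 \<le> B"
    and bound: "\<And>F. finite F \<Longrightarrow> F \<subseteq> int_lattice - freqs n \<Longrightarrow>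
      (2 * pi) ^ CARD('d) * (\<Sum>k\<in>F. (cmod (fourier_coeff f k))\<^sup>2) \<le> B\<^sup>2"
  shows "L2_norm (\<lambda>x. f x - proj n f x) \<le> B"
proof (rule field_le_epsilon)
  fix e :: real assume "0 < e"
  then obtain N where N: "\<And>M. N \<le> M \<Longrightarrow> L2_norm (\<lambda>x. f x - proj M f x) < e"
    using proj_tendsto[OF f] by blast
  let ?M = "max N n"
  let ?F = "freqs ?M - freqs n :: (real^'d) set"
  have "(\<lambda>x. proj ?M f x - proj n f x) = trig ?F (fourier_coeff f)"
    unfolding proj_eq_trig by (simp add: fun_eq_iff trig_diff_subset freqs_mono)
  moreover have "L2_norm (trig ?F (fourier_coeff f)) \<le> B"
  proof (rule power2_le_imp_le[OF _ B])
    have "?F \<subseteq> int_lattice - freqs n" using freqs_subset by blast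
    then show "(L2_norm (trig ?F (fourier_coeff f)))\<^sup>2 \<le> B\<^sup>2"
      using bound[of ?F] by (subst L2_norm_trig) auto
  qed
  ultimately show "L2_norm (\<lambda>x. f x - proj n f x) \<le> B + e"
    using L2_norm_dist_triangle[OF f sqint_proj[of ?M f] sqint_proj[of n f]] N[of ?M] by simp
qed

subsection \<open>The logarithmic nonlinearity and its clamping\<close>

lemma log_nonlin_eq: "log_nonlin z = z * complex_of_real (2 * ln (cmod z))"
  by (cases "z = 0") (simp_all add: log_nonlin_def ln_realpow)

text \<open>This is ln q \<le> q - 1 at q = y / x. The factor x is what tames the logarithm near 0
  in all uses below.\<close>

lemma ln_diff_le:
  fixes x y :: real
  assumes "0 < x" "x \<le> y"
  shows "x * (ln y - ln x) \<le> y - x"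
proof -
  have "ln y - ln x = ln (y / x)" using assms by (simp add: ln_div)
  also have "\<dots> \<le> y / x - 1" using assms by (intro ln_le_minus_one) auto
  finally have "x * (ln y - ln x) \<le> x * (y / x - 1)" using assms by (intro mult_left_mono) auto
  then show ?thesis using assms by (simp add: right_diff_distrib)
qed

text \<open>Let |z| \<le> |w|. Splitting off the weight ln |w|^2 from z - w produces |z - w|^2 times
  a real number, which has no imaginary part. The remaining difference of logarithms multiplies z,
  the entry of smaller modulus, and \<open>ln_diff_le\<close> compensates the singularity.\<close>

lemma log_nonlin_quasi_monotone:
  "\<bar>Im ((log_nonlin z - log_nonlin w) * cnj (z - w))\<bar> \<le> 2 * (cmod (z - w))\<^sup>2"
proof -
  have main: "\<bar>Im ((log_nonlin z - log_nonlin w) * cnj (z - w))\<bar> \<le> 2 * (cmod (z - w))\<^sup>2"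
    if zw: "z \<noteq> 0" "cmod z \<le> cmod w" for z w
  proof -
    let ?a = "2 * ln (cmod z)" and ?b = "2 * ln (cmod w)"
    have "0 < cmod z" "0 < cmod w" using zw by auto
    then have ba: "0 \<le> ?b - ?a" using zw by simp
    have "Im ((log_nonlin z - log_nonlin w) * cnj (z - w)) = (?b - ?a) * Im (z * cnj (w - z))"
      by (simp add: log_nonlin_eq algebra_simps)
    also have "\<bar>\<dots>\<bar> = (?b - ?a) * \<bar>Im (z * cnj (w - z))\<bar>"
      using ba by (simp only: abs_mult abs_of_nonneg)
    also have "\<dots> \<le> (?b - ?a) * (cmod z * cmod (w - z))"
      using abs_Im_le_cmod[of "z * cnj (w - z)"] by (intro mult_left_mono ba) (simp only: norm_mult complex_mod_cnj)
    also have "\<dots> = 2 * (cmod z * (ln (cmod w) - ln (cmod z))) * cmod (w - z)" by (simp add: algebra_simps)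
    also have "\<dots> \<le> 2 * (cmod w - cmod z) * cmod (w - z)"
      using ln_diff_le[of "cmod z" "cmod w"] zw by (intro mult_right_mono) auto
    also have "\<dots> \<le> 2 * cmod (w - z) * cmod (w - z)"
      by (intro mult_right_mono mult_left_mono norm_triangle_ineq2) auto
    finally show ?thesis by (simp add: power2_eq_square norm_minus_commute)
  qed
  have sym: "Im ((log_nonlin z - log_nonlin w) * cnj (z - w)) = Im ((log_nonlin w - log_nonlin z) * cnj (w - z))"
    by (simp add: algebra_simps)
  show ?thesis
  proof (cases "z = 0 \<or> w = 0")
    case True
    have "Im (log_nonlin v * cnj v) = 0" for v by (simp add: log_nonlin_eq)
    then show ?thesis using True sym by (auto simp: log_nonlin_def[of 0])
  next
    case False
    then show ?thesis using main[of z w] main[of w z] sym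
      by (cases "cmod z \<le> cmod w") (auto simp: norm_minus_commute)
  qed
qed

text \<open>This is z ln (c^2 / lo^2) with c the modulus clamped to [lo, hi]. Dividing by
  \<open>lo\<close> makes the weight run from 0 to 2 ln (hi / lo), so that the Lipschitz constant
  sees only the ratio of the levels.\<close>

definition clamped_log :: "real \<Rightarrow> real \<Rightarrow> complex \<Rightarrow> complex" where
  "clamped_log lo hi z = z * complex_of_real (2 * ln (max lo (min hi (cmod z)) / lo))"

text \<open>Product rule for differences, with the weight taken at the larger modulus: one term has
  the maximal weight 2 ln (hi / lo), the other is |z| times the increment of the weight. That
  increment vanishes when |z| is above \<open>hi\<close>; otherwise |z| is at most its clamped value
  and \<open>ln_diff_le\<close> gives the constant 2.\<close>

lemma clamped_log_Lipschitz:
  assumes lo: "0 < lo" "lo \<le> hi"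
  shows "cmod (clamped_log lo hi z - clamped_log lo hi w) \<le> (2 * ln (hi / lo) + 2) * cmod (z - w)"
proof -
  define h where "h r = 2 * ln (max lo (min hi r) / lo)" for r
  have h: "0 \<le> h r" "h r \<le> 2 * ln (hi / lo)" for r
    using lo by (auto simp: h_def divide_right_mono)
  have main: "cmod (clamped_log lo hi z - clamped_log lo hi w) \<le> (2 * ln (hi / lo) + 2) * cmod (z - w)"
    if zw: "cmod z \<le> cmod w" for z w
  proof -
    define x y where "x = max lo (min hi (cmod z))" and "y = max lo (min hi (cmod w))"
    have xy: "0 < x" "x \<le> y" using lo zw by (auto simp: x_def y_def)
    have "cmod z * (h (cmod w) - h (cmod z)) \<le> 2 * (cmod w - cmod z)"
    proof (cases "cmod z \<le> hi")
      case False
      then have "x = y" using zw by (simp add: x_def y_def)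
      then show ?thesis using zw by (simp add: h_def x_def y_def)
    next
      case True
      have "cmod z * (h (cmod w) - h (cmod z)) = 2 * (cmod z * (ln y - ln x))"
        using xy lo by (simp add: h_def flip: x_def y_def, simp add: ln_div algebra_simps)
      also have "\<dots> \<le> 2 * (x * (ln y - ln x))"
        using xy True by (intro mult_left_mono mult_right_mono) (auto simp: x_def)
      also have "\<dots> \<le> 2 * (y - x)" using ln_diff_le[OF xy] by simp
      also have "\<dots> \<le> 2 * (cmod w - cmod z)" using True zw by (auto simp: x_def y_def)
      finally show ?thesis .
    qed
    moreover have "0 \<le> h (cmod w) - h (cmod z)"
      using xy lo by (simp add: h_def divide_right_mono flip: x_def y_def)
    ultimately have 2: "cmod (z * complex_of_real (h (cmod w) - h (cmod z))) \<le> 2 * cmod (z - w)"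
      using norm_triangle_ineq3[of w z] zw by (simp only: norm_mult norm_of_real) (simp add: norm_minus_commute)
    have "clamped_log lo hi z - clamped_log lo hi w = (z - w) * complex_of_real (h (cmod w)) - z * complex_of_real (h (cmod w) - h (cmod z))"
      by (simp add: clamped_log_def h_def algebra_simps)
    also have "cmod \<dots> \<le> cmod (z - w) * h (cmod w) + 2 * cmod (z - w)"
      using h(1) by (intro order_trans[OF norm_triangle_ineq4] add_mono 2) (simp only: norm_mult norm_of_real abs_of_nonneg order_refl)
    also have "\<dots> \<le> cmod (z - w) * (2 * ln (hi / lo)) + 2 * cmod (z - w)"
      by (intro add_mono mult_left_mono h) auto
    finally show ?thesis by (simp add: algebra_simps)
  qed
  show ?thesis using main[of z w] main[of w z] by (cases "cmod z \<le> cmod w") (auto simp: norm_minus_commute)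
qed

text \<open>The log sum inequality for the pairs (A, A) and (W, Q): ln q \<le> q - 1 is used once
  for each pair, and r (A + Q) = A + W makes the right sides cancel. It removes the mean, of size A,
  from the excess above \<open>hi\<close> and leaves an expression in the deviation alone.\<close>

lemma shifted_xlogx_le:
  fixes A W Q :: real
  assumes "0 \<le> A" "0 < Q" "Q \<le> W"
  shows "(A + W) * ln ((A + W) / (A + Q)) \<le> W * ln (W / Q)"
proof -
  define r where "r = (A + W) / (A + Q)"
  have r: "r > 0" using assms by (simp add: r_def add_nonneg_pos)
  have rq: "r * (A + Q) = A + W" using assms by (simp add: r_def add_nonneg_pos[THEN less_imp_neq])
  have "ln (r * Q / W) \<le> r * Q / W - 1" using assms r by (intro ln_le_minus_one) auto
  moreover have "ln (r * Q / W) = ln r - ln (W / Q)"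
    using assms r by (simp add: ln_div ln_mult)
  ultimately have "W * (ln r - ln (W / Q)) \<le> W * (r * Q / W - 1)"
    using assms by (intro mult_left_mono) auto
  then have 1: "W * ln r - W * ln (W / Q) \<le> r * Q - W" using assms by (simp add: algebra_simps)
  have 2: "A * ln r \<le> A * (r - 1)" using assms r by (intro mult_left_mono ln_le_minus_one) auto
  show ?thesis using 1 2 rq by (simp add: algebra_simps flip: r_def)
qed

text \<open>Between \<open>lo\<close> and \<open>hi\<close> the two weights agree. Below
  \<open>lo\<close> the error is at most 2 (lo - |z|): if \<open>lo = e\<close> this is at most 2 e,
  and otherwise |z| < |m| - Q forces the deviation from m above Q. Above \<open>hi\<close> the
  deviation also exceeds Q, and \<open>shifted_xlogx_le\<close> converts the logarithmic
  excess.\<close>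

lemma log_nonlin_minus_clamped:
  fixes z m :: complex
  assumes e: "0 < e" and Q: "0 < Q"
  defines "lo \<equiv> max e (cmod m - Q)" and "hi \<equiv> cmod m + Q"
  assumes le: "e \<le> hi"
  shows "cmod (log_nonlin z - z * complex_of_real (ln (lo\<^sup>2)) - clamped_log lo hi z)
    \<le> 2 * e + (if Q < cmod (z - m) then 2 * cmod (z - m) + 2 * cmod (z - m) * ln (cmod (z - m) / Q) else 0)"
    (is "?D \<le> ?R")
proof -
  have lo: "0 < lo" "lo \<le> hi" using e Q le by (auto simp: lo_def hi_def)
  let ?r = "cmod z" and ?W = "cmod (z - m)" and ?c = "max lo (min hi (cmod z))"
  have R: "2 * e \<le> ?R" using Q by (auto intro!: add_nonneg_nonneg mult_nonneg_nonneg)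
  have D: "?D = ?r * \<bar>2 * (ln ?r - ln ?c)\<bar>"
  proof -
    have "ln (lo\<^sup>2) = 2 * ln lo" "ln (?c / lo) = ln ?c - ln lo"
      using lo by (simp_all add: ln_realpow ln_div)
    then have eq: "2 * ln ?r - ln (lo\<^sup>2) - 2 * ln (?c / lo) = 2 * (ln ?r - ln ?c)" by simp
    have "log_nonlin z - z * complex_of_real (ln (lo\<^sup>2)) - clamped_log lo hi z
        = z * complex_of_real (2 * ln ?r - ln (lo\<^sup>2) - 2 * ln (?c / lo))"
      by (simp add: log_nonlin_eq clamped_log_def right_diff_distrib)
    also note eq
    finally show ?thesis by (simp only: norm_mult norm_of_real)
  qed
  consider "z = 0" | "z \<noteq> 0" "?r < lo" | "z \<noteq> 0" "lo \<le> ?r" "?r \<le> hi" | "hi < ?r" by linarith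
  then show ?thesis
  proof cases
    case 1
    then have "?D \<le> 2 * e" using D e by simp
    then show ?thesis using R by (rule order_trans)
  next
    case 2
    have "?D = 2 * (?r * (ln lo - ln ?r))" using 2 lo D by (simp add: max_def min_def)
    also have "\<dots> \<le> 2 * (lo - ?r)" using 2 ln_diff_le[of ?r lo] by simp
    finally have D2: "?D \<le> 2 * (lo - ?r)" .
    show ?thesis
    proof (cases "lo = e")
      case True
      then have "2 * (lo - ?r) \<le> 2 * e" by simp
      from order_trans[OF D2 this] R show ?thesis by (rule order_trans)
    next
      case False
      then have lo': "lo = cmod m - Q" by (auto simp: lo_def max_def split: if_splits)
      have W: "cmod m - ?r \<le> ?W" using norm_triangle_ineq2[of m z] by (simp add: norm_minus_commute)
      then have "Q < ?W" using 2 lo' by simp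
      have "2 * (lo - ?r) \<le> 2 * ?W" using lo' W Q by simp
      also have "\<dots> \<le> ?R"
        unfolding if_P[OF \<open>Q < ?W\<close>] using Q e \<open>Q < ?W\<close>
        by (intro add_increasing add_increasing2 mult_nonneg_nonneg) auto
      finally have "2 * (lo - ?r) \<le> ?R" .
      with D2 show ?thesis by (rule order_trans)
    qed
  next
    case 3
    then have "?c = ?r" by simp
    then have "?D \<le> 2 * e" using D e by simp
    then show ?thesis using R by (rule order_trans)
  next
    case 4
    have z: "z \<noteq> 0" "?r > 0" using 4 lo by auto
    have "?r - cmod m \<le> ?W" by (rule norm_triangle_ineq2)
    then have W: "?r \<le> cmod m + ?W" "Q < ?W" using 4 by (auto simp: hi_def)
    have "?D = 2 * (?r * ln (?r / hi))" using 4 lo z D by (simp add: max_def min_def ln_div)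
    also have "\<dots> \<le> 2 * ((cmod m + ?W) * ln ((cmod m + ?W) / hi))"
      using W 4 lo z by (intro mult_left_mono mult_mono ln_mono divide_right_mono) auto
    also have "\<dots> \<le> 2 * (?W * ln (?W / Q))"
      using shifted_xlogx_le[of "cmod m" Q ?W] W Q by (simp add: hi_def)
    also have "\<dots> \<le> ?R"
      unfolding if_P[OF W(2)] using e by (intro add_increasing) auto
    finally show ?thesis .
  qed
qed

text \<open>The sum counts the thresholds Q b^j below w, and this count is at least the logarithm of
  w / Q to base b. It trades an unbounded logarithm for a sum of excess functions whose L2 norms
  decay geometrically.\<close>

lemma ln_le_dyadic_count:
  fixes w Q b :: real
  assumes "0 < Q" "1 < b" "Q < w" "w \<le> Q * b ^ J"
  shows "ln (w / Q) \<le> ln b * (\<Sum>j<J. if Q * b ^ j < w then 1 else 0)"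
  using assms(4)
proof (induction J)
  case 0
  then show ?case using assms(3) by simp
next
  case (Suc J)
  show ?case
  proof (cases "w \<le> Q * b ^ J")
    case True
    then show ?thesis using Suc.IH assms(2) by simp
  next
    case False
    have "Q * b ^ j < w" if "j \<le> J" for j
    proof -
      have "Q * b ^ j \<le> Q * b ^ J" using that assms(1,2) by (intro mult_left_mono power_increasing) auto
      then show ?thesis using False by simp
    qed
    then have "(\<Sum>j<Suc J. if Q * b ^ j < w then 1 else 0) = (\<Sum>j<Suc J. 1 :: real)"
      by (intro sum.cong) auto
    moreover have "ln (w / Q) \<le> ln (b ^ Suc J)"
      using Suc.prems assms by (intro ln_mono) (auto simp: field_simps)
    ultimately show ?thesis using assms(2) by (simp add: ln_realpow ln_mult algebra_simps)
  qed
qed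

text \<open>The modulus is at most the minimum of \<theta> and 2, and the exponent r / 2 in [0, 1]
  interpolates between the two bounds. With \<theta> = \<sigma> |k|^2, r derivatives in space buy
  the factor \<sigma>^(r/2).\<close>

lemma norm_exp_i_minus_1_le:
  fixes \<theta> r :: real
  assumes "0 \<le> \<theta>" "0 \<le> r" "r \<le> 2"
  shows "cmod (exp (\<i> * complex_of_real \<theta>) - 1) \<le> 2 * \<theta> powr (r / 2)"
proof (cases "\<theta> \<le> 1")
  case True
  show ?thesis
  proof (cases "\<theta> = 0")
    case False
    have "cmod (exp (\<i> * complex_of_real \<theta>) - 1) = 2 * \<bar>sin (\<theta> / 2)\<bar>"
      using dist_exp_i_1[of \<theta>] by simp
    also have "\<dots> \<le> \<theta>" using abs_sin_le_one abs_sin_x_le_abs_x[of "\<theta> / 2"] assms(1) by simp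
    also have "\<theta> = \<theta> powr 1" using False assms by simp
    also have "\<dots> \<le> \<theta> powr (r / 2)" using True False assms by (intro powr_mono') auto
    finally show ?thesis using powr_ge_zero[of \<theta> "r / 2"] by linarith
  qed simp
next
  case False
  have "cmod (exp (\<i> * complex_of_real \<theta>) - 1) \<le> 2"
    using norm_triangle_ineq4[of "exp (\<i> * complex_of_real \<theta>)" 1] by simp
  also have "\<dots> \<le> 2 * \<theta> powr (r / 2)" using False assms by (simp add: ge_one_powr_ge_zero)
  finally show ?thesis .
qed

subsection \<open>Fractional smoothness and the free flow\<close>

lemma power2_powr: "0 \<le> x \<Longrightarrow> (x\<^sup>2) powr a = x powr (2 * a)" for x a :: real
  using powr_powr[of x 2 a] by simp

lemma powr_power2: "(x powr a)\<^sup>2 = x powr (2 * a)" for x a :: real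
  by (simp only: power2_eq_square mult_2 powr_add)

text \<open>Unlike \<open>Hs_seminorm s f \<le> R\<close>, this also excludes a divergent series, whose infinite sum is \<open>0\<close>.\<close>

definition hs_bound :: "real \<Rightarrow> real \<Rightarrow> (real^'d \<Rightarrow> complex) \<Rightarrow> bool" where
  "hs_bound s R f \<longleftrightarrow> sqint f \<and> (\<forall>F. finite F \<longrightarrow> F \<subseteq> int_lattice \<longrightarrow>
     (2 * pi) ^ CARD('d) * (\<Sum>k\<in>F. norm k powr (2 * s) * (cmod (fourier_coeff f k))\<^sup>2) \<le> R\<^sup>2)"

lemma hs_boundD:
  "hs_bound s R (f :: real^'d \<Rightarrow> complex) \<Longrightarrow> finite F \<Longrightarrow> F \<subseteq> int_lattice \<Longrightarrow>
    (2 * pi) ^ CARD('d) * (\<Sum>k\<in>F. norm k powr (2 * s) * (cmod (fourier_coeff f k))\<^sup>2) \<le> R\<^sup>2"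
  by (simp add: hs_bound_def)

lemma hs_bound_sqint: "hs_bound s R f \<Longrightarrow> sqint f"
  by (simp add: hs_bound_def)

lemma Hs_imp_hs_bound:
  assumes f: "(f :: real^'d \<Rightarrow> complex) \<in> Hs s" and s: "0 < s" and R: "Hs_seminorm s f \<le> R"
  shows "hs_bound s R f"
  unfolding hs_bound_def
proof (intro conjI allI impI)
  show "sqint f" using f by (simp add: Hs_def L2_imp_sqint)
  let ?t = "\<lambda>k. norm k powr (2 * s) * (cmod (fourier_coeff f k))\<^sup>2"
  fix F :: "(real^'d) set" assume F: "finite F" "F \<subseteq> int_lattice"
  have "(\<lambda>k. (1 + (norm k)\<^sup>2) powr s * (cmod (fourier_coeff f k))\<^sup>2) summable_on int_lattice"
    using f by (simp add: Hs_def)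
  then have "(\<lambda>k. (1 + (norm k)\<^sup>2) powr s * (cmod (fourier_coeff f k))\<^sup>2) summable_on (int_lattice - {0})"
    by (rule summable_on_subset_banach) auto
  then have sum: "?t summable_on (int_lattice - {0})"
  proof (rule summable_on_comparison_test)
    fix k :: "real^'d" assume "k \<in> int_lattice - {0}"
    then have "norm k powr (2 * s) = ((norm k)\<^sup>2) powr s"
      by (simp add: power2_powr)
    also have "\<dots> \<le> (1 + (norm k)\<^sup>2) powr s" using s by (intro powr_mono2) auto
    finally show "?t k \<le> (1 + (norm k)\<^sup>2) powr s * (cmod (fourier_coeff f k))\<^sup>2"
      by (intro mult_right_mono) auto
  qed auto
  \<comment> \<open>The mode k = 0 contributes nothing because \<open>0 powr x = 0\<close>.\<close>
  have "(\<Sum>k\<in>F. ?t k) = (\<Sum>k\<in>F - {0}. ?t k)"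
    using F(1) by (intro sum.mono_neutral_right) auto
  also have "\<dots> \<le> (\<Sum>\<^sub>\<infinity>k\<in>int_lattice - {0}. ?t k)"
    using F by (intro finite_sum_le_infsum[OF sum]) auto
  finally have le: "(\<Sum>k\<in>F. ?t k) \<le> (\<Sum>\<^sub>\<infinity>k\<in>int_lattice - {0}. ?t k)" .
  have nn: "0 \<le> (\<Sum>\<^sub>\<infinity>k\<in>int_lattice - {0}. ?t k)" by (intro infsum_nonneg) auto
  have "((2 * pi) powr (real CARD('d) / 2))\<^sup>2 = (2 * pi) ^ CARD('d)"
    by (simp add: powr_power2 powr_realpow)
  then have "(Hs_seminorm s f)\<^sup>2 = (2 * pi) ^ CARD('d) * (\<Sum>\<^sub>\<infinity>k\<in>int_lattice - {0}. ?t k)"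
    using nn by (simp add: Hs_seminorm_def power_mult_distrib)
  moreover have "(Hs_seminorm s f)\<^sup>2 \<le> R\<^sup>2"
    using nn R by (intro power_mono) (auto simp: Hs_seminorm_def)
  ultimately have "(2 * pi) ^ CARD('d) * (\<Sum>\<^sub>\<infinity>k\<in>int_lattice - {0}. ?t k) \<le> R\<^sup>2" by simp
  then show "(2 * pi) ^ CARD('d) * (\<Sum>k\<in>F. ?t k) \<le> R\<^sup>2"
    by (rule order_trans[OF mult_left_mono[OF le], rotated]) simp
qed

lemma proj_error:
  assumes f: "hs_bound s R (f :: real^'d \<Rightarrow> complex)" and s: "0 < s" and R: "0 \<le> R" and n: "1 \<le> n"
  shows "L2_norm (\<lambda>x. f x - proj n f x) \<le> real n powr (- s) * R"
proof (rule L2_norm_diff_proj_le)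
  fix F :: "(real^'d) set" assume F: "finite F" "F \<subseteq> int_lattice - freqs n"
  let ?V = "(2 * pi) ^ CARD('d)"
  have "(\<Sum>k\<in>F. (cmod (fourier_coeff f k))\<^sup>2)
      \<le> (\<Sum>k\<in>F. real n powr (- (2 * s)) * (norm k powr (2 * s) * (cmod (fourier_coeff f k))\<^sup>2))"
  proof (rule sum_mono)
    fix k assume "k \<in> F"
    then have "real n < norm k" using F by (intro norm_gt_of_not_freqs) auto
    then have "real n powr (2 * s) \<le> norm k powr (2 * s)" using s by (intro powr_mono2) auto
    then have "1 \<le> real n powr (- (2 * s)) * norm k powr (2 * s)"
      using n by (simp add: powr_minus field_simps)
    then show "(cmod (fourier_coeff f k))\<^sup>2 \<le> real n powr (- (2 * s)) * (norm k powr (2 * s) * (cmod (fourier_coeff f k))\<^sup>2)"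
      using mult_right_mono[of 1 "real n powr (- (2 * s)) * norm k powr (2 * s)" "(cmod (fourier_coeff f k))\<^sup>2"]
      by (simp add: mult.assoc)
  qed
  then have "(\<Sum>k\<in>F. (cmod (fourier_coeff f k))\<^sup>2)
      \<le> real n powr (- (2 * s)) * (\<Sum>k\<in>F. norm k powr (2 * s) * (cmod (fourier_coeff f k))\<^sup>2)"
    by (simp only: sum_distrib_left)
  from mult_left_mono[OF this, of ?V]
  have "?V * (\<Sum>k\<in>F. (cmod (fourier_coeff f k))\<^sup>2)
      \<le> real n powr (- (2 * s)) * (?V * (\<Sum>k\<in>F. norm k powr (2 * s) * (cmod (fourier_coeff f k))\<^sup>2))"
    by (simp only: mult.left_commute[of ?V]) simp
  also have "\<dots> \<le> real n powr (- (2 * s)) * R\<^sup>2"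
    using F by (intro mult_left_mono hs_boundD[OF f]) auto
  also have "real n powr (- (2 * s)) = (real n powr (- s))\<^sup>2"
    by (simp add: powr_power2)
  finally show "?V * (\<Sum>k\<in>F. (cmod (fourier_coeff f k))\<^sup>2) \<le> (real n powr (- s) * R)\<^sup>2"
    by (simp add: power_mult_distrib)
qed (use R hs_bound_sqint[OF f] in auto)

text \<open>Cauchy-Schwarz over at most (3 n)^d frequencies, all with |k| \<ge> 1; since 3 \<le> 2
  pi, the volume of the cell absorbs 3^d. The growth n^(d/2) is harmless because the bound only sets
  the clamping levels, whose ratio enters through a logarithm.\<close>

lemma proj_deviation_bound:
  assumes f: "hs_bound s R (f :: real^'d \<Rightarrow> complex)" and s: "0 < s" and R: "0 \<le> R" and n: "1 \<le> n"
  shows "cmod (proj n f x - fourier_coeff f 0) \<le> sqrt (real n ^ CARD('d)) * R"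
proof -
  let ?V = "(2 * pi) ^ CARD('d)" and ?F = "freqs n - {0} :: (real^'d) set"
  have fin: "finite ?F" and sub: "?F \<subseteq> int_lattice" using freqs_subset by auto
  have "proj n f x - fourier_coeff f 0 = (\<Sum>k\<in>?F. fourier_coeff f k * chr k x)"
    unfolding proj_eq_trig trig_def by (subst sum.remove[of _ 0]) auto
  also have "cmod \<dots> \<le> (\<Sum>k\<in>?F. cmod (fourier_coeff f k))"
    by (rule sum_norm_le) (simp add: norm_mult)
  finally have 1: "cmod (proj n f x - fourier_coeff f 0) \<le> (\<Sum>k\<in>?F. cmod (fourier_coeff f k))" .
  have "?V * (\<Sum>k\<in>?F. (cmod (fourier_coeff f k))\<^sup>2) \<le> ?V * (\<Sum>k\<in>?F. norm k powr (2 * s) * (cmod (fourier_coeff f k))\<^sup>2)"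
  proof (intro mult_left_mono sum_mono)
    fix k assume "k \<in> ?F"
    then have "1 \<le> norm k powr (2 * s)"
      using lattice_norm_ge_1[of k] sub s by (intro ge_one_powr_ge_zero) auto
    then show "(cmod (fourier_coeff f k))\<^sup>2 \<le> norm k powr (2 * s) * (cmod (fourier_coeff f k))\<^sup>2"
      using mult_right_mono[of 1 _ "(cmod (fourier_coeff f k))\<^sup>2"] by simp
  qed simp
  also have "\<dots> \<le> R\<^sup>2" by (rule hs_boundD[OF f fin sub])
  finally have 2: "?V * (\<Sum>k\<in>?F. (cmod (fourier_coeff f k))\<^sup>2) \<le> R\<^sup>2" .
  have "card ?F \<le> (2 * n + 1) ^ CARD('d)"
    using card_mono[OF finite_freqs[of n], of ?F] card_freqs[of n, where 'd='d] by fastforce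
  also have "\<dots> \<le> (3 * n) ^ CARD('d)" using n by (intro power_mono) auto
  finally have "real (card ?F) \<le> real ((3 * n) ^ CARD('d))" by (rule of_nat_mono)
  also have "\<dots> = 3 ^ CARD('d) * real n ^ CARD('d)" by (simp add: power_mult_distrib)
  also have "\<dots> \<le> ?V * real n ^ CARD('d)"
    using pi_ge_two pi_gt3 by (intro mult_right_mono power_mono) auto
  finally have card: "real (card ?F) \<le> ?V * real n ^ CARD('d)" .
  have "(\<Sum>k\<in>?F. cmod (fourier_coeff f k))\<^sup>2 \<le> (\<Sum>k\<in>?F. (cmod (fourier_coeff f k))\<^sup>2) * real (card ?F)"
    by (rule sum_squared_le_sum_of_squares)
  also have "\<dots> \<le> (\<Sum>k\<in>?F. (cmod (fourier_coeff f k))\<^sup>2) * (?V * real n ^ CARD('d))"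
    by (intro mult_left_mono card sum_nonneg) auto
  also have "\<dots> \<le> R\<^sup>2 * real n ^ CARD('d)"
    using mult_right_mono[OF 2, of "real n ^ CARD('d)"] by (simp add: mult_ac)
  also have "\<dots> = (sqrt (real n ^ CARD('d)) * R)\<^sup>2"
    by (simp add: power_mult_distrib)
  finally have "(\<Sum>k\<in>?F. cmod (fourier_coeff f k)) \<le> sqrt (real n ^ CARD('d)) * R"
    by (rule power2_le_imp_le) (use R in simp)
  then show ?thesis using 1 by simp
qed

text \<open>Where \<open>f\<close> deviates from its mean by more than twice the uniform bound on the deviation of
  \<open>proj n f\<close>, the deviation is dominated by the projection error.\<close>

lemma excess_bound:
  assumes f: "hs_bound s R (f :: real^'d \<Rightarrow> complex)" and s: "0 < s" and R: "0 \<le> R" and n: "1 \<le> n"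
    and q: "2 * sqrt (real n ^ CARD('d)) * R \<le> q"
  defines "W \<equiv> \<lambda>x. if q < cmod (f x - fourier_coeff f 0) then f x - fourier_coeff f 0 else 0"
  shows "sqint W" "L2_norm W \<le> 2 * (real n powr (- s) * R)"
proof -
  have sf: "sqint f" by (rule hs_bound_sqint[OF f])
  have sd: "sqint (\<lambda>x. f x - fourier_coeff f 0)" using sf by auto
  have [measurable]: "f \<in> borel_measurable tm" by (rule sqint_measurable[OF sf])
  have meas: "W \<in> borel_measurable tm" unfolding W_def by measurable
  show "sqint W" by (rule sqint_dominated[OF sd meas, of 1]) (auto simp: W_def)
  have "L2_norm W \<le> L2_norm (\<lambda>x. 2 * (f x - proj n f x))"
  proof (rule L2_norm_mono[OF _ meas])
    show "sqint (\<lambda>x. 2 * (f x - proj n f x))" by (intro sqint_cmult sqint_diff sf sqint_proj)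
    have "cmod (W x) \<le> cmod (2 * (f x - proj n f x))" for x
    proof (cases "q < cmod (f x - fourier_coeff f 0)")
      case True
      have "2 * cmod (proj n f x - fourier_coeff f 0) \<le> cmod (f x - fourier_coeff f 0)"
        using proj_deviation_bound[OF f s R n, of x] q True by linarith
      moreover have "cmod (f x - fourier_coeff f 0) \<le> cmod (f x - proj n f x) + cmod (proj n f x - fourier_coeff f 0)"
        using norm_triangle_ineq[of "f x - proj n f x" "proj n f x - fourier_coeff f 0"] by simp
      moreover have "cmod (2 * (f x - proj n f x)) = 2 * cmod (f x - proj n f x)"
        by (simp only: norm_mult norm_numeral)
      ultimately show ?thesis using True unfolding W_def by simp
    qed (simp add: W_def)
    then show "AE x in tm. cmod (W x) \<le> cmod (2 * (f x - proj n f x))" by simp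
  qed
  also have "\<dots> = 2 * L2_norm (\<lambda>x. f x - proj n f x)" by (subst L2_norm_cmult) simp
  also have "\<dots> \<le> 2 * (real n powr (- s) * R)" using proj_error[OF f s R n] by simp
  finally show "L2_norm W \<le> 2 * (real n powr (- s) * R)" .
qed

text \<open>The projected inverse free flow \<open>\<Pi>\<^sub>N exp (- \<i> \<sigma> \<Delta>)\<close>.\<close>

definition schr :: "nat \<Rightarrow> real \<Rightarrow> (real^'d \<Rightarrow> complex) \<Rightarrow> real^'d \<Rightarrow> complex" where
  "schr N \<sigma> f = trig (freqs N) (\<lambda>k. exp (\<i> * complex_of_real (\<sigma> * (norm k)\<^sup>2)) * fourier_coeff f k)"

lemma sqint_schr [simp, intro]: "sqint (schr N \<sigma> f)"
  by (simp add: schr_def)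

lemma fourier_coeff_schr:
  assumes "k \<in> int_lattice"
  shows "fourier_coeff (schr N \<sigma> f) k =
    (if k \<in> freqs N then exp (\<i> * complex_of_real (\<sigma> * (norm k)\<^sup>2)) * fourier_coeff f k else 0)"
  unfolding schr_def using assms freqs_subset by (subst fourier_coeff_trig) auto

lemma L2_norm_schr_le:
  assumes "sqint (f :: real^'d \<Rightarrow> complex)"
  shows "L2_norm (schr N \<sigma> f) \<le> L2_norm f"
proof (rule power2_le_imp_le)
  show "(L2_norm (schr N \<sigma> f))\<^sup>2 \<le> (L2_norm f)\<^sup>2"
    unfolding schr_def using Bessel[OF finite_freqs freqs_subset assms, of N]
    by (subst L2_norm_trig) (simp_all add: freqs_subset norm_mult)
qed simp

lemma schr_diff:
  assumes "sqint f" "sqint g"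
  shows "schr N \<sigma> (\<lambda>x. f x - g x) x = schr N \<sigma> f x - schr N \<sigma> g x"
  by (simp add: schr_def trig_def fourier_coeff_diff[OF assms] algebra_simps sum_subtractf)

lemma schr_add:
  assumes "sqint f" "sqint g"
  shows "schr N \<sigma> (\<lambda>x. f x + g x) x = schr N \<sigma> f x + schr N \<sigma> g x"
  by (simp add: schr_def trig_def fourier_coeff_add[OF assms] algebra_simps sum.distrib)

lemma schr_cmult: "schr N \<sigma> (\<lambda>x. c * f x) x = c * schr N \<sigma> f x"
  by (simp add: schr_def trig_def fourier_coeff_cmult sum_distrib_left mult_ac)

lemma proj_diff:
  assumes "sqint f" "sqint g"
  shows "proj N (\<lambda>x. f x - g x) x = proj N f x - proj N g x"
  by (simp add: proj_eq_trig trig_def fourier_coeff_diff[OF assms] algebra_simps sum_subtractf)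

text \<open>Mode k is displaced by at most 2 \<sigma>^(r/2) |k|^r. The exponent r is left free since
  both r = s, for the solution itself, and r = 1, for the smooth part of an interpolation,
  occur.\<close>

lemma schr_proj_error:
  assumes f: "hs_bound r R (f :: real^'d \<Rightarrow> complex)" and r: "0 \<le> r" "r \<le> 2" and R: "0 \<le> R" and \<sigma>: "0 \<le> \<sigma>"
  shows "L2_norm (\<lambda>x. schr N \<sigma> f x - proj N f x) \<le> 2 * \<sigma> powr (r / 2) * R"
proof (rule power2_le_imp_le)
  let ?V = "(2 * pi) ^ CARD('d)" and ?e = "\<lambda>k::real^'d. exp (\<i> * complex_of_real (\<sigma> * (norm k)\<^sup>2)) - 1"
  have "(\<lambda>x. schr N \<sigma> f x - proj N f x) = trig (freqs N) (\<lambda>k. ?e k * fourier_coeff f k)"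
    by (simp add: schr_def proj_eq_trig trig_def fun_eq_iff left_diff_distrib sum_subtractf)
  then have "(L2_norm (\<lambda>x. schr N \<sigma> f x - proj N f x))\<^sup>2 = ?V * (\<Sum>k\<in>freqs N. (cmod (?e k * fourier_coeff f k))\<^sup>2)"
    by (simp only: L2_norm_trig[OF finite_freqs freqs_subset])
  also have "\<dots> \<le> ?V * (\<Sum>k\<in>freqs N. (2 * \<sigma> powr (r / 2))\<^sup>2 * (norm k powr (2 * r) * (cmod (fourier_coeff f k))\<^sup>2))"
  proof (intro mult_left_mono sum_mono)
    fix k :: "real^'d"
    have "cmod (?e k) \<le> 2 * (\<sigma> * (norm k)\<^sup>2) powr (r / 2)"
      using r \<sigma> by (intro norm_exp_i_minus_1_le) auto
    also have "(\<sigma> * (norm k)\<^sup>2) powr (r / 2) = \<sigma> powr (r / 2) * norm k powr r"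
      using \<sigma> by (simp add: powr_mult power2_powr)
    finally have "(cmod (?e k))\<^sup>2 \<le> (2 * (\<sigma> powr (r / 2) * norm k powr r))\<^sup>2"
      by (rule power_mono) simp
    also have "\<dots> = (2 * \<sigma> powr (r / 2))\<^sup>2 * norm k powr (2 * r)"
      by (simp add: power_mult_distrib powr_power2)
    finally have le: "(cmod (?e k))\<^sup>2 \<le> (2 * \<sigma> powr (r / 2))\<^sup>2 * norm k powr (2 * r)" .
    show "(cmod (?e k * fourier_coeff f k))\<^sup>2 \<le> (2 * \<sigma> powr (r / 2))\<^sup>2 * (norm k powr (2 * r) * (cmod (fourier_coeff f k))\<^sup>2)"
      unfolding norm_mult power_mult_distrib[of "cmod (?e k)"] mult.assoc[symmetric]
      by (rule mult_right_mono[OF le]) simp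
  qed simp
  also have "\<dots> = (2 * \<sigma> powr (r / 2))\<^sup>2 * (?V * (\<Sum>k\<in>freqs N. norm k powr (2 * r) * (cmod (fourier_coeff f k))\<^sup>2))"
    by (simp add: sum_distrib_left mult_ac)
  also have "\<dots> \<le> (2 * \<sigma> powr (r / 2))\<^sup>2 * R\<^sup>2"
    by (intro mult_left_mono hs_boundD[OF f] finite_freqs freqs_subset) auto
  finally show "(L2_norm (\<lambda>x. schr N \<sigma> f x - proj N f x))\<^sup>2 \<le> (2 * \<sigma> powr (r / 2) * R)\<^sup>2"
    by (simp add: power_mult_distrib)
qed (use R in simp)

lemma hs_bound_schr:
  assumes f: "hs_bound s R (f :: real^'d \<Rightarrow> complex)"
  shows "hs_bound s R (schr N \<sigma> f)"
  unfolding hs_bound_def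
proof (intro conjI allI impI)
  fix F :: "(real^'d) set" assume F: "finite F" "F \<subseteq> int_lattice"
  have "(\<Sum>k\<in>F. norm k powr (2 * s) * (cmod (fourier_coeff (schr N \<sigma> f) k))\<^sup>2)
      \<le> (\<Sum>k\<in>F. norm k powr (2 * s) * (cmod (fourier_coeff f k))\<^sup>2)"
    using F by (intro sum_mono mult_left_mono) (auto simp: fourier_coeff_schr norm_mult)
  then show "(2 * pi) ^ CARD('d) * (\<Sum>k\<in>F. norm k powr (2 * s) * (cmod (fourier_coeff (schr N \<sigma> f) k))\<^sup>2) \<le> R\<^sup>2"
    by (intro order_trans[OF mult_left_mono hs_boundD[OF f F]]) auto
qed simp

text \<open>Conservation of the mean lets a function and its image under the free flow share the
  same clamping levels.\<close>

lemma fourier_coeff_schr_0: "fourier_coeff (schr N \<sigma> f) 0 = fourier_coeff f 0"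
  by (simp add: fourier_coeff_schr)

subsection \<open>The commutator of the nonlinearity with the free flow\<close>

lemma L2_norm_of_norm: "L2_norm (\<lambda>x. complex_of_real (cmod (f x))) = L2_norm f"
  by (simp add: L2_norm_def)

lemma sqint_of_norm: "sqint f \<Longrightarrow> sqint (\<lambda>x. complex_of_real (cmod (f x)))"
  by (rule sqint_dominated[of f _ 1]) (auto simp: sqint_def)

lemma log_nonlin_measurable [measurable]: "log_nonlin \<in> borel_measurable borel"
  unfolding log_nonlin_def by measurable

lemma clamped_log_measurable [measurable]: "clamped_log lo hi \<in> borel_measurable borel"
  unfolding clamped_log_def by measurable

text \<open>Three contributions in units of e = N^(-s) R: the norm of the constant function 2 e on
  the cell, twice the first excess layer of norm 2 e, and the geometric series of all layers with
  ratio 2^(-s) and weight 2 ln b, where b = sqrt (2^d). The type argument carries the dimension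
  d.\<close>

definition clamp_const :: "'d::finite itself \<Rightarrow> real \<Rightarrow> real" where
  "clamp_const _ s = 2 * sqrt ((2 * pi) ^ CARD('d)) + 4 + 4 * ln (sqrt (2 ^ CARD('d))) / (1 - 2 powr (- s))"

text \<open>By \<open>excess_bound\<close> at cut-off 2^j N, the part of U - m above the level Q b^j
  has L2 norm at most 2 e 2^(-s j). The logarithmic excess above the clamping interval counts the
  levels exceeded, so its norm is a geometric series.\<close>

lemma log_clamp_error:
  fixes U :: "real^'d \<Rightarrow> complex"
  assumes U: "hs_bound s R U" and bdd: "AE x in tm. cmod (U x) \<le> B"
    and s: "0 < s" and R: "0 < R" and N: "1 \<le> N"
  defines "Q \<equiv> 2 * sqrt (real N ^ CARD('d)) * R"
  defines "lo \<equiv> max (real N powr (- s) * R) (cmod (fourier_coeff U 0) - Q)"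
    and "hi \<equiv> cmod (fourier_coeff U 0) + Q"
  defines "D \<equiv> \<lambda>x. log_nonlin (U x) - U x * complex_of_real (ln (lo\<^sup>2)) - clamped_log lo hi (U x)"
  shows "sqint D" "L2_norm D \<le> clamp_const TYPE('d) s * (real N powr (- s) * R)"
proof -
  define m where "m = fourier_coeff U 0"
  define e where "e = real N powr (- s) * R"
  \<comment> \<open>Doubling the cut-off n multiplies the uniform bound n^(d/2) by b, so the level
    \<open>Q * b ^ j\<close> belongs to the cut-off \<open>2 ^ j * N\<close>.\<close>
  define b where "b = sqrt (2 ^ CARD('d))"
  define W where "W j x = (if Q * b ^ j < cmod (U x - m) then U x - m else 0)" for j x
  have e: "0 < e" using N R by (simp add: e_def)
  have Q: "0 < Q" using N R by (simp add: Q_def)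
  have b: "1 < b" unfolding b_def using one_less_power[of "2::real" "CARD('d)"] by simp
  have "real N powr (- s) \<le> 1" using powr_mono[of "- s" 0 "real N"] N s by simp
  moreover have "1 \<le> sqrt (real N ^ CARD('d))" using N one_le_power[of "real N" "CARD('d)"] by simp
  ultimately have sq: "real N powr (- s) \<le> 1" "1 \<le> sqrt (real N ^ CARD('d))" by auto
  then have "e \<le> 1 * R" unfolding e_def using R by (intro mult_right_mono) auto
  also have "\<dots> \<le> Q" unfolding Q_def using R sq(2) by (intro mult_right_mono; linarith)
  finally have eQ: "e \<le> hi" by (simp add: hi_def add_increasing)
  have sU: "sqint U" by (rule hs_bound_sqint[OF U])
  have [measurable]: "U \<in> borel_measurable tm" by (rule sqint_measurable[OF sU])
  have mD: "D \<in> borel_measurable tm" unfolding D_def by measurable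
  \<comment> \<open>|U - m| \<le> B + |m| almost everywhere, so no layer from J on is active. The
    bound B determines how many layers there are, while the final constant is uniform in J.\<close>
  obtain J where J: "(B + cmod m) / Q < b ^ J" using real_arch_pow[OF b] by blast
  have W: "sqint (W j)" "L2_norm (W j) \<le> 2 * ((2 powr (- s)) ^ j * e)" for j
  proof -
    let ?n = "2 ^ j * N"
    have "sqrt (real ?n ^ CARD('d)) = b ^ j * sqrt (real N ^ CARD('d))"
      by (simp add: b_def power_mult_distrib real_sqrt_mult real_sqrt_power power_commutes flip: power_mult)
    then have q: "2 * sqrt (real ?n ^ CARD('d)) * R \<le> Q * b ^ j" by (simp add: Q_def)
    have n: "1 \<le> ?n" using N by simp
    have "real ?n powr (- s) = (2 powr (- s)) ^ j * real N powr (- s)"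
      by (simp add: powr_mult powr_realpow[symmetric] powr_powr mult.commute)
    then have n2: "2 * (real ?n powr (- s) * R) = 2 * ((2 powr (- s)) ^ j * e)"
      by (simp only: e_def mult.assoc)
    note x = excess_bound[OF U s less_imp_le[OF R] n q, folded m_def]
    show "sqint (W j)" unfolding W_def[abs_def] by (rule x(1))
    show "L2_norm (W j) \<le> 2 * ((2 powr (- s)) ^ j * e)" unfolding W_def[abs_def] using x(2) n2 by simp
  qed
  define H where "H x = complex_of_real (2 * e) + (2 * complex_of_real (cmod (W 0 x)) +
    complex_of_real (2 * ln b) * (\<Sum>j<J. complex_of_real (cmod (W j x))))" for x
  have sH: "sqint H" unfolding H_def
    by (intro sqint_add sqint_cmult sqint_sum sqint_of_norm W sqint_const)
  have DH: "cmod (D x) \<le> cmod (H x)" if x: "cmod (U x) \<le> B" for x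
  proof -
    let ?w = "cmod (U x - m)"
    have nn: "0 \<le> ln b" using b by simp
    have "H x = complex_of_real (2 * e + (2 * cmod (W 0 x) + 2 * ln b * (\<Sum>j<J. cmod (W j x))))"
      by (simp add: H_def)
    moreover have "0 \<le> 2 * e + (2 * cmod (W 0 x) + 2 * ln b * (\<Sum>j<J. cmod (W j x)))"
      using e nn by (intro add_nonneg_nonneg mult_nonneg_nonneg sum_nonneg) auto
    ultimately have H: "cmod (H x) = 2 * e + (2 * cmod (W 0 x) + 2 * ln b * (\<Sum>j<J. cmod (W j x)))"
      by (simp only: norm_of_real abs_of_nonneg)
    have "cmod (D x) \<le> 2 * e + (if Q < ?w then 2 * ?w + 2 * ?w * ln (?w / Q) else 0)"
      unfolding D_def using log_nonlin_minus_clamped[OF e Q, of m "U x"] eQ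
      by (simp only: lo_def hi_def e_def m_def)
    also have "\<dots> \<le> cmod (H x)"
    proof (cases "Q < ?w")
      case True
      have "?w \<le> B + cmod m" using norm_triangle_ineq4[of "U x" m] x by simp
      also have "\<dots> \<le> Q * b ^ J" using J Q by (simp add: field_simps)
      finally have "ln (?w / Q) \<le> ln b * (\<Sum>j<J. if Q * b ^ j < ?w then 1 else 0)"
        by (rule ln_le_dyadic_count[OF Q b True])
      then have "2 * ?w * ln (?w / Q) \<le> 2 * ?w * (ln b * (\<Sum>j<J. if Q * b ^ j < ?w then 1 else 0))"
        by (intro mult_left_mono) auto
      also have "\<dots> = 2 * ln b * (\<Sum>j<J. cmod (W j x))"
      proof -
        have "(\<Sum>j<J. cmod (W j x)) = ?w * (\<Sum>j<J. if Q * b ^ j < ?w then 1 else 0)"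
          unfolding sum_distrib_left by (intro sum.cong) (auto simp: W_def)
        then show ?thesis by simp
      qed
      finally show ?thesis using True by (simp add: H W_def)
    next
      case False
      have "0 \<le> 2 * cmod (W 0 x) + 2 * ln b * (\<Sum>j<J. cmod (W j x))"
        using nn by (intro add_nonneg_nonneg mult_nonneg_nonneg sum_nonneg) auto
      then show ?thesis using False H by simp
    qed
    finally show ?thesis .
  qed
  have AE: "AE x in tm. cmod (D x) \<le> cmod (H x)" using bdd by eventually_elim (rule DH)
  show "sqint D" by (rule sqint_dominated[OF sH mD, of 1]) (use AE in simp)
  have "L2_norm D \<le> L2_norm H" by (rule L2_norm_mono[OF sH mD AE])
  also have "\<dots> \<le> L2_norm (\<lambda>x::real^'d. complex_of_real (2 * e)) +
      (L2_norm (\<lambda>x. 2 * complex_of_real (cmod (W 0 x))) +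
       L2_norm (\<lambda>x. complex_of_real (2 * ln b) * (\<Sum>j<J. complex_of_real (cmod (W j x)))))"
    unfolding H_def
    by (intro order_trans[OF L2_norm_triangle] add_left_mono L2_norm_triangle
        sqint_add sqint_cmult sqint_sum sqint_of_norm W sqint_const)
  also have "\<dots> = sqrt ((2 * pi) ^ CARD('d)) * (2 * e) + (2 * L2_norm (W 0) +
      2 * ln b * L2_norm (\<lambda>x. \<Sum>j<J. complex_of_real (cmod (W j x))))"
    using e b by (simp only: L2_norm_cmult L2_norm_of_norm L2_norm_const norm_of_real) simp
  also have "\<dots> \<le> sqrt ((2 * pi) ^ CARD('d)) * (2 * e) + (2 * (2 * e) + 2 * ln b * (2 * e / (1 - 2 powr (- s))))"
  proof (intro add_mono mult_left_mono)
    show "L2_norm (W 0) \<le> 2 * e" using W(2)[of 0] by simp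
    let ?y = "2 powr (- s) :: real"
    have y: "0 < ?y" "?y < 1" using s by (simp_all add: powr_less_one)
    have "L2_norm (\<lambda>x. \<Sum>j<J. complex_of_real (cmod (W j x))) \<le> (\<Sum>j<J. L2_norm (\<lambda>x. complex_of_real (cmod (W j x))))"
      by (intro L2_norm_sum_triangle sqint_of_norm W)
    also have "\<dots> \<le> (\<Sum>j<J. 2 * (?y ^ j * e))"
      by (intro sum_mono) (simp only: L2_norm_of_norm W)
    also have "\<dots> = 2 * e * (\<Sum>j<J. ?y ^ j)" by (simp add: sum_distrib_left mult_ac)
    \<comment> \<open>Positivity of s makes the ratio less than 1; dropping the last power gives a
      bound that does not see J, hence not B.\<close>
    also have "(\<Sum>j<J. ?y ^ j) \<le> 1 / (1 - ?y)"
    proof -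
      have "(\<Sum>j<J. ?y ^ j) = (1 - ?y ^ J) / (1 - ?y)"
        using y s geometric_sum[of ?y J] minus_divide_divide[of "1 - ?y ^ J" "1 - ?y"] by simp
      also have "\<dots> \<le> 1 / (1 - ?y)" using y by (intro divide_right_mono) auto
      finally show ?thesis .
    qed
    finally show "L2_norm (\<lambda>x. \<Sum>j<J. complex_of_real (cmod (W j x))) \<le> 2 * e / (1 - ?y)"
      using e by simp
  qed (use b in auto)
  also have "\<dots> = clamp_const TYPE('d) s * e"
    by (simp add: clamp_const_def b_def algebra_simps)
  finally show "L2_norm D \<le> clamp_const TYPE('d) s * (real N powr (- s) * R)" by (simp add: e_def)
qed

section \<open>Lipschitz functions of an H^s function\<close>

lemma sqint_Lipschitz_compose:
  assumes U: "sqint U" and Lip: "\<And>z w. cmod (\<phi> z - \<phi> w) \<le> L * cmod (z - w)"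
    and L: "0 \<le> L" and meas: "\<phi> \<in> borel_measurable borel"
  shows "sqint (\<lambda>x. \<phi> (U x))"
proof -
  have mU: "U \<in> borel_measurable tm" by (rule sqint_measurable[OF U])
  have s: "sqint (\<lambda>x. complex_of_real (cmod (\<phi> 0)) + complex_of_real L * complex_of_real (cmod (U x)))"
    by (intro sqint_add sqint_const sqint_cmult sqint_of_norm U)
  show ?thesis
  proof (rule sqint_dominated[OF s, of _ 1])
    show "(\<lambda>x. \<phi> (U x)) \<in> borel_measurable tm" by (rule measurable_compose[OF mU meas])
    have "cmod (\<phi> (U x)) \<le> cmod (\<phi> 0) + L * cmod (U x)" for x
      using Lip[of "U x" 0] norm_triangle_ineq2[of "\<phi> (U x)" "\<phi> 0"] by simp
    moreover have "cmod (complex_of_real (cmod (\<phi> 0)) + complex_of_real L * complex_of_real (cmod (U x)))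
        = cmod (\<phi> 0) + L * cmod (U x)" for x
      using L by (simp flip: of_real_mult of_real_add)
    ultimately show "AE x in tm. cmod (\<phi> (U x)) \<le> 1 * cmod (complex_of_real (cmod (\<phi> 0)) + complex_of_real L * complex_of_real (cmod (U x)))"
      by simp
  qed
qed

text \<open>The decomposition behind real interpolation between L2 and H^1: replacing U by
  \<open>proj n U\<close> inside \<phi> costs n^(-s) in L2, and what remains has an H^1 seminorm of
  order n^(1-s) by \<open>H1_Lipschitz_compose\<close>. The cut-off n is chosen by the
  caller.\<close>

lemma Lipschitz_compose_H1_approx:
  fixes U :: "real^'d \<Rightarrow> complex"
  assumes U: "hs_bound s R U" and s: "0 < s" "s < 1" and R: "0 \<le> R" and n: "1 \<le> n"
    and Lip: "\<And>z w. cmod (\<phi> z - \<phi> w) \<le> L * cmod (z - w)" and L: "0 \<le> L"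
    and meas: "\<phi> \<in> borel_measurable borel"
  shows "L2_norm (\<lambda>x. \<phi> (U x) - \<phi> (proj n U x)) \<le> L * (real n powr (- s) * R)"
    and "hs_bound 1 (L * sqrt (real CARD('d)) * real n powr (1 - s) * R) (\<lambda>x. \<phi> (proj n U x))"
proof -
  have sU: "sqint U" by (rule hs_bound_sqint[OF U])
  have sg: "sqint (\<lambda>x. \<phi> (U x))" "sqint (\<lambda>x. \<phi> (proj n U x))"
    by (rule sqint_Lipschitz_compose[OF _ Lip L meas]; intro sU sqint_proj)+
  have "L2_norm (\<lambda>x. \<phi> (U x) - \<phi> (proj n U x)) \<le> L2_norm (\<lambda>x. complex_of_real L * (U x - proj n U x))"
  proof (rule L2_norm_mono)
    show "sqint (\<lambda>x. complex_of_real L * (U x - proj n U x))" by (intro sqint_cmult sqint_diff sU sqint_proj)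
    show "(\<lambda>x. \<phi> (U x) - \<phi> (proj n U x)) \<in> borel_measurable tm"
      by (rule sqint_measurable[OF sqint_diff[OF sg]])
    show "AE x in tm. cmod (\<phi> (U x) - \<phi> (proj n U x)) \<le> cmod (complex_of_real L * (U x - proj n U x))"
      using Lip L by (simp only: norm_mult norm_of_real abs_of_nonneg) simp
  qed
  also have "\<dots> = L * L2_norm (\<lambda>x. U x - proj n U x)" using L by (simp only: L2_norm_cmult norm_of_real abs_of_nonneg)
  also have "\<dots> \<le> L * (real n powr (- s) * R)"
    by (intro mult_left_mono proj_error U s R n L)
  finally show "L2_norm (\<lambda>x. \<phi> (U x) - \<phi> (proj n U x)) \<le> L * (real n powr (- s) * R)" .
  show "hs_bound 1 (L * sqrt (real CARD('d)) * real n powr (1 - s) * R) (\<lambda>x. \<phi> (proj n U x))"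
    unfolding hs_bound_def
  proof (intro conjI allI impI sg)
    let ?V = "(2 * pi) ^ CARD('d)" and ?d = "real CARD('d)"
    fix F :: "(real^'d) set" assume F: "finite F" "F \<subseteq> int_lattice"
    have "(\<Sum>k\<in>F. norm k powr (2 * 1) * (cmod (fourier_coeff (\<lambda>x. \<phi> (proj n U x)) k))\<^sup>2)
        = (\<Sum>k\<in>F. (norm k)\<^sup>2 * (cmod (fourier_coeff (\<lambda>x. \<phi> (proj n U x)) k))\<^sup>2)"
      by simp
    also have "\<dots> \<le> L\<^sup>2 * (\<Sum>k\<in>freqs n. (norm k)\<^sup>2 * (cmod (fourier_coeff U k))\<^sup>2)"
      unfolding proj_eq_trig by (intro H1_Lipschitz_compose finite_freqs freqs_subset F Lip L)
    also have "\<dots> \<le> L\<^sup>2 * (\<Sum>k\<in>freqs n. (?d * real n powr (2 * (1 - s))) * (norm k powr (2 * s) * (cmod (fourier_coeff U k))\<^sup>2))"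
    proof (intro mult_left_mono sum_mono)
      fix k :: "real^'d" assume k: "k \<in> freqs n"
      \<comment> \<open>A Bernstein-type exchange: 1 - s derivatives are paid for by |k|^2 \<le> d
        n^2 on the cube, and s derivatives stay with U. Then d^(1-s) \<le> d.\<close>
      have "(norm k)\<^sup>2 = norm k powr (2 * (1 - s)) * norm k powr (2 * s)"
        by (cases "k = 0") (simp_all add: algebra_simps flip: powr_add)
      also have "norm k powr (2 * (1 - s)) = ((norm k)\<^sup>2) powr (1 - s)" by (simp add: power2_powr)
      also have "\<dots> \<le> (?d * (real n)\<^sup>2) powr (1 - s)"
        using norm_sq_freqs[OF k] s by (intro powr_mono2) auto
      also have "\<dots> = ?d powr (1 - s) * real n powr (2 * (1 - s))" by (simp add: powr_mult power2_powr)
      also have "\<dots> \<le> ?d * real n powr (2 * (1 - s))"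
        using s powr_mono[of "1 - s" 1 ?d] by (intro mult_right_mono) (auto simp: Suc_le_eq)
      finally have "(norm k)\<^sup>2 \<le> ?d * real n powr (2 * (1 - s)) * norm k powr (2 * s)"
        by (simp add: mult_right_mono)
      then show "(norm k)\<^sup>2 * (cmod (fourier_coeff U k))\<^sup>2
          \<le> (?d * real n powr (2 * (1 - s))) * (norm k powr (2 * s) * (cmod (fourier_coeff U k))\<^sup>2)"
        unfolding mult.assoc[symmetric] by (intro mult_right_mono) auto
    qed simp
    finally have "?V * (\<Sum>k\<in>F. norm k powr (2 * 1) * (cmod (fourier_coeff (\<lambda>x. \<phi> (proj n U x)) k))\<^sup>2)
        \<le> ?V * (L\<^sup>2 * (\<Sum>k\<in>freqs n. (?d * real n powr (2 * (1 - s))) * (norm k powr (2 * s) * (cmod (fourier_coeff U k))\<^sup>2)))"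
      by (rule mult_left_mono) simp
    also have "\<dots> = L\<^sup>2 * (?d * real n powr (2 * (1 - s))) * (?V * (\<Sum>k\<in>freqs n. norm k powr (2 * s) * (cmod (fourier_coeff U k))\<^sup>2))"
      unfolding sum_distrib_left[symmetric] by simp
    also have "\<dots> \<le> L\<^sup>2 * (?d * real n powr (2 * (1 - s))) * R\<^sup>2"
      by (intro mult_left_mono hs_boundD[OF U] finite_freqs freqs_subset) auto
    also have "\<dots> = (L * sqrt ?d * real n powr (1 - s) * R)\<^sup>2"
      by (simp only: power_mult_distrib powr_power2 mult.assoc) simp
    finally show "?V * (\<Sum>k\<in>F. norm k powr (2 * 1) * (cmod (fourier_coeff (\<lambda>x. \<phi> (proj n U x)) k))\<^sup>2)
        \<le> (L * sqrt ?d * real n powr (1 - s) * R)\<^sup>2" .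
  qed
qed

text \<open>Best approximation allows projecting the smoother \<phi> (proj n U) instead of \<phi>
  (U). With the same n in both places its H^1 bound n^(1-s) meets the projection gain n^(-1), which
  gives n^(-s) again.\<close>

lemma Lipschitz_compose_proj_error:
  fixes U :: "real^'d \<Rightarrow> complex"
  assumes U: "hs_bound s R U" and s: "0 < s" "s < 1" and R: "0 \<le> R" and n: "1 \<le> n"
    and Lip: "\<And>z w. cmod (\<phi> z - \<phi> w) \<le> L * cmod (z - w)" and L: "0 \<le> L"
    and meas: "\<phi> \<in> borel_measurable borel"
  shows "L2_norm (\<lambda>x. \<phi> (U x) - proj n (\<lambda>x. \<phi> (U x)) x) \<le> (1 + sqrt (real CARD('d))) * L * (real n powr (- s) * R)"
proof -
  let ?g = "\<lambda>x. \<phi> (U x)" and ?h = "\<lambda>x. \<phi> (proj n U x)"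
  note approx = Lipschitz_compose_H1_approx[OF U s R n Lip L meas]
  have sg: "sqint ?g" "sqint ?h"
    by (rule sqint_Lipschitz_compose[OF _ Lip L meas]; intro hs_bound_sqint[OF U] sqint_proj)+
  have "L2_norm (\<lambda>x. ?g x - proj n ?g x) \<le> L2_norm (\<lambda>x. ?g x - proj n ?h x)"
    unfolding proj_eq_trig by (intro L2_norm_diff_trig_best finite_freqs freqs_subset sg)
  also have "\<dots> \<le> L2_norm (\<lambda>x. ?g x - ?h x) + L2_norm (\<lambda>x. ?h x - proj n ?h x)"
    by (intro L2_norm_dist_triangle sg sqint_proj)
  also have "\<dots> \<le> L * (real n powr (- s) * R) + real n powr (- 1) * (L * sqrt (real CARD('d)) * real n powr (1 - s) * R)"
    using L R by (intro add_mono approx(1) proj_error approx(2) n) auto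
  also have "real n powr (- 1) * (L * sqrt (real CARD('d)) * real n powr (1 - s) * R) =
      sqrt (real CARD('d)) * L * ((real n powr (- 1) * real n powr (1 - s)) * R)"
    by (simp only: mult_ac)
  also have "real n powr (- 1) * real n powr (1 - s) = real n powr (- s)"
    by (subst powr_add[symmetric]) simp
  finally show ?thesis by (simp add: algebra_simps)
qed

text \<open>On the H^1 part the free flow gains \<tau>^(1/2), giving \<tau>^(1/2) n^(1-s); on the L2
  part it and the projection are merely contractions, giving 2 n^(-s).\<close>

lemma Lipschitz_compose_schr_error:
  fixes U :: "real^'d \<Rightarrow> complex"
  assumes U: "hs_bound s R U" and s: "0 < s" "s < 1" and R: "0 \<le> R"
    and Lip: "\<And>z w. cmod (\<phi> z - \<phi> w) \<le> L * cmod (z - w)" and L: "0 \<le> L"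
    and meas: "\<phi> \<in> borel_measurable borel"
    and \<sigma>: "0 \<le> \<sigma>" "\<sigma> \<le> \<tau>" and \<tau>: "0 < \<tau>" "\<tau> \<le> T"
  shows "L2_norm (\<lambda>x. schr N \<sigma> (\<lambda>x. \<phi> (U x)) x - proj N (\<lambda>x. \<phi> (U x)) x)
    \<le> (2 + 2 * sqrt (real CARD('d)) * (1 + sqrt T)) * L * (\<tau> powr (s / 2) * R)"
proof -
  \<comment> \<open>This n balances the two contributions. Rounding up keeps n \<ge> 1 and costs at
    most the factor 1 + sqrt T, because \<tau> \<le> T.\<close>
  define n where "n = nat \<lceil>\<tau> powr (- (1 / 2))\<rceil>"
  have tp: "0 < \<tau> powr (- (1 / 2))" using \<tau> by simp
  have n1: "\<tau> powr (- (1 / 2)) \<le> real n" unfolding n_def by (rule real_nat_ceiling_ge)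
  then have "0 < real n" using tp by linarith
  then have n: "1 \<le> n" by simp
  have "real n \<le> \<tau> powr (- (1 / 2)) + 1" unfolding n_def using tp by linarith
  also have "\<dots> = \<tau> powr (- (1 / 2)) * (1 + \<tau> powr (1 / 2))"
    using \<tau> by (simp add: distrib_left flip: powr_add)
  also have "\<dots> \<le> \<tau> powr (- (1 / 2)) * (1 + sqrt T)"
    using \<tau> by (intro mult_left_mono) (auto simp: powr_half_sqrt)
  finally have n2: "real n \<le> \<tau> powr (- (1 / 2)) * (1 + sqrt T)" .
  have ns: "real n powr (- s) \<le> \<tau> powr (s / 2)"
  proof -
    have "real n powr (- s) \<le> (\<tau> powr (- (1 / 2))) powr (- s)"
      using n1 tp s by (intro powr_mono2') auto
    also have "\<dots> = \<tau> powr (s / 2)" by (simp add: powr_powr)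
    finally show ?thesis .
  qed
  have n1s: "\<tau> powr (1 / 2) * real n powr (1 - s) \<le> \<tau> powr (s / 2) * (1 + sqrt T)"
  proof -
    have "real n powr (1 - s) \<le> (\<tau> powr (- (1 / 2)) * (1 + sqrt T)) powr (1 - s)"
      using n2 s by (intro powr_mono2) auto
    also have "\<dots> = \<tau> powr (- (1 / 2) * (1 - s)) * (1 + sqrt T) powr (1 - s)"
      using \<tau> by (subst powr_mult) (auto simp: powr_powr)
    also have "\<dots> \<le> \<tau> powr (- (1 / 2) * (1 - s)) * (1 + sqrt T)"
      using s \<tau> powr_mono[of "1 - s" 1 "1 + sqrt T"] by (intro mult_left_mono) auto
    finally have "\<tau> powr (1 / 2) * real n powr (1 - s) \<le> \<tau> powr (1 / 2) * (\<tau> powr (- (1 / 2) * (1 - s)) * (1 + sqrt T))"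
      by (intro mult_left_mono) auto
    also have "\<dots> = \<tau> powr (1 / 2 + - (1 / 2) * (1 - s)) * (1 + sqrt T)"
      by (simp only: powr_add mult.assoc)
    also have "1 / 2 + - (1 / 2) * (1 - s) = s / 2" by (simp add: field_simps)
    finally show ?thesis .
  qed
  let ?g = "\<lambda>x. \<phi> (U x)" and ?h = "\<lambda>x. \<phi> (proj n U x)"
  let ?C = "L * sqrt (real CARD('d)) * real n powr (1 - s) * R"
  note approx = Lipschitz_compose_H1_approx[OF U s R n Lip L meas]
  have sg: "sqint ?g" "sqint ?h"
    by (rule sqint_Lipschitz_compose[OF _ Lip L meas]; intro hs_bound_sqint[OF U] sqint_proj)+
  have C0: "0 \<le> ?C" using L R by simp
  have e1: "L2_norm (\<lambda>x. schr N \<sigma> ?h x - proj N ?h x) \<le> 2 * \<sigma> powr (1 / 2) * ?C"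
    by (rule schr_proj_error[OF approx(2) _ _ C0 \<sigma>(1)]) simp_all
  have e2: "2 * \<sigma> powr (1 / 2) * ?C \<le> 2 * \<tau> powr (1 / 2) * ?C"
    using \<sigma> by (intro mult_right_mono[OF _ C0] mult_left_mono powr_mono2) auto
  have sgh: "sqint (\<lambda>x. ?g x - ?h x)" by (intro sqint_diff sg)
  have "L2_norm (\<lambda>x. schr N \<sigma> ?g x - proj N ?g x) =
      L2_norm (\<lambda>x. (schr N \<sigma> ?h x - proj N ?h x) + (schr N \<sigma> (\<lambda>x. ?g x - ?h x) x - proj N (\<lambda>x. ?g x - ?h x) x))"
    by (simp add: schr_diff[OF sg] proj_diff[OF sg])
  also have "\<dots> \<le> L2_norm (\<lambda>x. schr N \<sigma> ?h x - proj N ?h x) +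
      L2_norm (\<lambda>x. schr N \<sigma> (\<lambda>x. ?g x - ?h x) x - proj N (\<lambda>x. ?g x - ?h x) x)"
    by (intro L2_norm_triangle sqint_diff sqint_schr sqint_proj)
  also have "\<dots> \<le> 2 * \<sigma> powr (1 / 2) * ?C + (L2_norm (schr N \<sigma> (\<lambda>x. ?g x - ?h x)) + L2_norm (proj N (\<lambda>x. ?g x - ?h x)))"
    by (rule add_mono[OF e1 L2_norm_triangle_diff[OF sqint_schr sqint_proj]])
  also have "\<dots> \<le> 2 * \<tau> powr (1 / 2) * ?C + (L2_norm (\<lambda>x. ?g x - ?h x) + L2_norm (\<lambda>x. ?g x - ?h x))"
    by (rule add_mono[OF e2 add_mono[OF L2_norm_schr_le[OF sgh] L2_norm_proj_le[OF sgh]]])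
  also have "\<dots> \<le> 2 * \<tau> powr (1 / 2) * ?C + (L * (real n powr (- s) * R) + L * (real n powr (- s) * R))"
    by (rule add_left_mono[OF add_mono[OF approx(1) approx(1)]])
  also have "\<dots> = 2 * sqrt (real CARD('d)) * (L * ((\<tau> powr (1 / 2) * real n powr (1 - s)) * R)) + 2 * (L * (real n powr (- s) * R))"
    by simp
  also have "\<dots> \<le> 2 * sqrt (real CARD('d)) * (L * ((\<tau> powr (s / 2) * (1 + sqrt T)) * R)) + 2 * (L * (\<tau> powr (s / 2) * R))"
    using L R by (intro add_mono mult_left_mono mult_right_mono n1s ns) auto
  also have "\<dots> = (2 + 2 * sqrt (real CARD('d)) * (1 + sqrt T)) * L * (\<tau> powr (s / 2) * R)"
    by (simp add: algebra_simps)
  finally show ?thesis .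
qed

text \<open>If A > 2 Q, the interval from A - Q to A + Q has ratio at most 3. Otherwise the upper
  level is at most 3 Q and the lower one at least N^(-s) R, with ratio at most 6 N^(d/2 + s).
  Neither bound involves A or R.\<close>

lemma ln_clamp_ratio_le:
  fixes A R s :: real and N d :: nat
  assumes A: "0 \<le> A" and R: "0 < R" and s: "0 < s" and N: "1 \<le> N"
  defines "Q \<equiv> 2 * sqrt (real N ^ d) * R"
  shows "ln ((A + Q) / max (real N powr (- s) * R) (A - Q)) \<le> ln 6 + (real d / 2 + s) * ln (real N)"
proof -
  let ?e = "real N powr (- s) * R"
  have e: "0 < ?e" and Q: "0 < Q" using N R by (auto simp: Q_def)
  have lnN: "0 \<le> ln (real N)" using N by simp
  show ?thesis
  proof (cases "A \<le> 2 * Q")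
    case True
    have "(A + Q) / max ?e (A - Q) \<le> (3 * Q) / ?e"
      using True e Q A by (intro frac_le) auto
    also have "(3 * Q) / ?e = 6 * (sqrt (real N ^ d) * real N powr s)"
      using R N by (simp add: Q_def powr_minus field_simps)
    also have "sqrt (real N ^ d) = real N powr (real d / 2)"
      using N by (simp add: powr_half_sqrt[symmetric] powr_realpow[symmetric] powr_powr)
    finally have "ln ((A + Q) / max ?e (A - Q)) \<le> ln (6 * (real N powr (real d / 2) * real N powr s))"
      using e Q A by (intro ln_mono) (auto intro!: divide_pos_pos simp: add_nonneg_pos less_max_iff_disj)
    also have "\<dots> = ln 6 + (real d / 2 + s) * ln (real N)"
      using N by (simp add: ln_mult algebra_simps)
    finally show ?thesis .
  next
    case False
    have "(A + Q) / max ?e (A - Q) \<le> (3 * (A - Q)) / (A - Q)"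
      using False e Q A by (intro frac_le) auto
    also have "\<dots> = 3" by (rule nonzero_mult_div_cancel_right) (use False Q in simp)
    finally have "ln ((A + Q) / max ?e (A - Q)) \<le> ln 6"
      using e Q A by (intro ln_mono) (auto intro!: divide_pos_pos simp: add_nonneg_pos less_max_iff_disj)
    also have "\<dots> \<le> ln 6 + (real d / 2 + s) * ln (real N)" using s lnN by simp
    finally show ?thesis .
  qed
qed

text \<open>Subtracting a constant multiple of the identity from \<open>log_nonlin\<close> does not change the
  commutator, so the logarithm may be normalised at the lower clamping level; this is why the
  bound involves only \<open>ln N\<close> and not the size of \<open>U\<close>.\<close>

lemma log_commutator_bound:
  fixes s T :: real
  assumes s: "0 < s" "s < 1"
  obtains K where "0 < K"
    "\<And>(U :: real^'d \<Rightarrow> complex) R B \<sigma> \<tau> N. hs_bound s R U \<Longrightarrow> AE x in tm. cmod (U x) \<le> B \<Longrightarrow> 0 < R \<Longrightarrow>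
      2 \<le> N \<Longrightarrow> 0 \<le> \<sigma> \<Longrightarrow> \<sigma> \<le> \<tau> \<Longrightarrow> 0 < \<tau> \<Longrightarrow> \<tau> \<le> T \<Longrightarrow>
      sqint (\<lambda>x. log_nonlin (U x)) \<and>
      L2_norm (\<lambda>x. schr N \<sigma> (\<lambda>x. log_nonlin (U x)) x - log_nonlin (schr N \<sigma> U x))
        \<le> K * ln (real N) * (\<tau> powr (s / 2) + real N powr (- s)) * R"
proof -
  let ?d = "real CARD('d)"
  \<comment> \<open>\<open>K1\<close> bounds the clamping errors, \<open>K2\<close> the projection
    error and \<open>K3\<close> the free-flow error of the clamped term; \<open>K4\<close> converts
    its Lipschitz constant into a multiple of ln N. The summand 2 in \<open>K\<close> comes from the
    distance (q + 2 p) R between U and V, and division by ln 2 absorbs constants into ln N for N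
    \<ge> 2.\<close>
  define K1 where "K1 = clamp_const TYPE('d) s"
  define K2 where "K2 = 1 + sqrt ?d"
  define K3 where "K3 = 2 + 2 * sqrt ?d * (1 + sqrt \<bar>T\<bar>)"
  define K4 where "K4 = (2 + 2 * ln 6) / ln 2 + ?d + 2 * s"
  define K where "K = K4 * (K2 + K3 + 2) + 2 * (K1 / ln 2)"
  have K1: "0 \<le> K1"
  proof -
    have "1 \<le> sqrt (2 ^ CARD('d))" by (simp add: one_le_power)
    moreover have "(2::real) powr (- s) < 1" using s by (simp add: powr_less_one)
    ultimately show ?thesis unfolding K1_def clamp_const_def by (intro add_nonneg_nonneg divide_nonneg_pos mult_nonneg_nonneg) auto
  qed
  have K2: "0 \<le> K2" and K3: "0 < K3" unfolding K2_def K3_def by (auto intro!: add_pos_nonneg)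
  have K4: "0 < K4" unfolding K4_def using s by (intro add_nonneg_pos add_nonneg_nonneg) auto
  have "0 < K2 + K3 + 2" using K2 K3 by simp
  from add_pos_nonneg[OF mult_pos_pos[OF K4 this], of "2 * (K1 / ln 2)"]
  have K: "0 < K" unfolding K_def using K1 by simp
  show ?thesis
  proof (rule that[OF K])
    fix U :: "real^'d \<Rightarrow> complex" and R B \<sigma> \<tau> :: real and N :: nat
    assume U: "hs_bound s R U" and bdd: "AE x in tm. cmod (U x) \<le> B" and R: "0 < R"
      and N: "2 \<le> N" and \<sigma>: "0 \<le> \<sigma>" "\<sigma> \<le> \<tau>" and \<tau>: "0 < \<tau>" "\<tau> \<le> T"
    have N1: "1 \<le> N" and R0: "0 \<le> R" and T: "0 < T" using N R \<tau> by auto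
    define p q where "p = \<tau> powr (s / 2)" and "q = real N powr (- s)"
    have p: "0 \<le> p" and q: "0 \<le> q" by (auto simp: p_def q_def)
    define V where "V = schr N \<sigma> U"
    define Q where "Q = 2 * sqrt (real N ^ CARD('d)) * R"
    define A where "A = cmod (fourier_coeff U 0)"
    define lo hi where "lo = max (q * R) (A - Q)" and "hi = A + Q"
    define a where "a = complex_of_real (ln (lo\<^sup>2))"
    define L where "L = 2 * ln (hi / lo) + 2"
    define g where "g = (\<lambda>x. clamped_log lo hi (U x))"
    define DU where "DU = (\<lambda>x. log_nonlin (U x) - U x * a - g x)"
    define DV where "DV = (\<lambda>x. log_nonlin (V x) - V x * a - clamped_log lo hi (V x))"
    have A0: "0 \<le> A" by (simp add: A_def)
    have Q: "0 < Q" using N R by (simp add: Q_def)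
    have lo: "0 < lo" using N R by (simp add: lo_def q_def less_max_iff_disj)
    have "q \<le> 1" unfolding q_def using powr_mono[of "- s" 0 "real N"] N s by simp
    then have "q * R \<le> 1 * R" using R by (intro mult_right_mono) auto
    also have "\<dots> \<le> Q"
    proof -
      have "1 \<le> sqrt (real N ^ CARD('d))" using N1 one_le_power[of "real N" "CARD('d)"] by simp
      then show ?thesis unfolding Q_def using R by (intro mult_right_mono; linarith)
    qed
    finally have lohi: "lo \<le> hi" using A0 Q by (auto simp: lo_def hi_def)
    have L0: "0 \<le> L" using lo lohi by (simp add: L_def)
    have Lip: "cmod (clamped_log lo hi z - clamped_log lo hi w) \<le> L * cmod (z - w)" for z w
      unfolding L_def by (rule clamped_log_Lipschitz[OF lo lohi])
    have lnN: "ln 2 \<le> ln (real N)" using N by simp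
    have ln2: "0 < ln (2::real)" by simp
    have one_le: "1 \<le> ln (real N) / ln 2" using lnN ln2 by (simp add: le_divide_eq)
    have LK: "L \<le> K4 * ln (real N)"
    proof -
      have "L \<le> 2 * (ln 6 + (?d / 2 + s) * ln (real N)) + 2"
        unfolding L_def lo_def hi_def q_def Q_def using ln_clamp_ratio_le[OF A0 R s(1) N1, of "CARD('d)"] by simp
      also have "\<dots> = (2 + 2 * ln 6) * 1 + (?d + 2 * s) * ln (real N)" by (simp add: algebra_simps)
      also have "\<dots> \<le> (2 + 2 * ln 6) * (ln (real N) / ln 2) + (?d + 2 * s) * ln (real N)"
        by (intro add_right_mono mult_left_mono one_le) auto
      also have "\<dots> = K4 * ln (real N)" by (simp only: K4_def distrib_right times_divide_eq_left times_divide_eq_right add.assoc)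
      finally show ?thesis .
    qed
    have sU: "sqint U" by (rule hs_bound_sqint[OF U])
    have V: "hs_bound s R V" unfolding V_def by (rule hs_bound_schr[OF U])
    have sV: "sqint V" by (rule hs_bound_sqint[OF V])
    have sg: "sqint g" unfolding g_def by (rule sqint_Lipschitz_compose[OF sU Lip L0 clamped_log_measurable])
    have sgV: "sqint (\<lambda>x. clamped_log lo hi (V x))" by (rule sqint_Lipschitz_compose[OF sV Lip L0 clamped_log_measurable])
    \<comment> \<open>Equal means give U and V the same \<open>lo\<close>, \<open>hi\<close> and
      \<open>a\<close>; this is what lets the multiples of the identity cancel.\<close>
    have V0: "fourier_coeff V 0 = fourier_coeff U 0" unfolding V_def by (rule fourier_coeff_schr_0)
    have "continuous_on UNIV V" unfolding V_def schr_def by (rule continuous_on_trig)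
    then obtain B' where "\<And>x. x \<in> torus \<Longrightarrow> cmod (V x) \<le> B'" using continuous_bounded_torus by blast
    then have bddV: "AE x in tm. cmod (V x) \<le> B'" by (rule AE_torusI)
    have DU: "sqint DU" "L2_norm DU \<le> K1 * (q * R)"
      using log_clamp_error[OF U bdd s(1) R N1]
      by (simp_all only: DU_def g_def a_def lo_def hi_def A_def Q_def q_def K1_def)
    have DV: "sqint DV" "L2_norm DV \<le> K1 * (q * R)"
      using log_clamp_error[OF V bddV s(1) R N1]
      by (simp_all only: DV_def V0 a_def lo_def hi_def A_def Q_def q_def K1_def)
    have fU: "(\<lambda>x. log_nonlin (U x)) = (\<lambda>x. (a * U x + g x) + DU x)" by (simp add: DU_def mult.commute)
    have sf: "sqint (\<lambda>x. log_nonlin (U x))" unfolding fU by (intro sqint_add sqint_cmult sU sg DU)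
    \<comment> \<open>The multiple a of the identity drops out by linearity of \<open>schr\<close>.
      The clamped part is telescoped through \<open>proj N g\<close> and \<open>g\<close>, which
      separates free-flow error, projection error and Lipschitz difference.\<close>
    have "schr N \<sigma> (\<lambda>x. log_nonlin (U x)) x - log_nonlin (V x) =
        ((schr N \<sigma> g x - proj N g x) + ((proj N g x - g x) + (g x - clamped_log lo hi (V x)))) + (schr N \<sigma> DU x - DV x)" for x
    proof -
      have "schr N \<sigma> (\<lambda>x. log_nonlin (U x)) x = (a * V x + schr N \<sigma> g x) + schr N \<sigma> DU x"
        unfolding fU V_def
        by (subst schr_add, (intro sqint_add sqint_cmult sU sg DU)+, subst schr_add, (intro sqint_cmult sU sg)+, simp only: schr_cmult)
      moreover have "log_nonlin (V x) = a * V x + clamped_log lo hi (V x) + DV x" by (simp add: DV_def mult.commute)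
      ultimately show ?thesis by simp
    qed
    then have "L2_norm (\<lambda>x. schr N \<sigma> (\<lambda>x. log_nonlin (U x)) x - log_nonlin (V x)) =
      L2_norm (\<lambda>x. ((schr N \<sigma> g x - proj N g x) + ((proj N g x - g x) + (g x - clamped_log lo hi (V x)))) + (schr N \<sigma> DU x - DV x))"
      by simp
    also have "\<dots> \<le> (L2_norm (\<lambda>x. schr N \<sigma> g x - proj N g x) + (L2_norm (\<lambda>x. proj N g x - g x) +
        L2_norm (\<lambda>x. g x - clamped_log lo hi (V x)))) + (L2_norm (schr N \<sigma> DU) + L2_norm DV)"
      by (intro order_trans[OF L2_norm_triangle] add_mono order_refl L2_norm_triangle_diff
          sqint_add sqint_diff sqint_schr sqint_proj sg sgV DV(1))
    also have "\<dots> \<le> (K3 * L * (p * R) + (K2 * L * (q * R) + L * ((q + 2 * p) * R))) + (K1 * (q * R) + K1 * (q * R))"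
    proof (intro add_mono)
      show "L2_norm (\<lambda>x. schr N \<sigma> g x - proj N g x) \<le> K3 * L * (p * R)"
        using Lipschitz_compose_schr_error[OF U s R0 Lip L0 clamped_log_measurable \<sigma> \<tau>, of N] T
        by (simp add: g_def p_def K3_def)
      show "L2_norm (\<lambda>x. proj N g x - g x) \<le> K2 * L * (q * R)"
        using Lipschitz_compose_proj_error[OF U s R0 N1 Lip L0 clamped_log_measurable]
        by (subst L2_norm_uminus_diff) (simp add: g_def q_def K2_def)
      show "L2_norm (schr N \<sigma> DU) \<le> K1 * (q * R)" using L2_norm_schr_le[OF DU(1)] DU(2) by (rule order_trans)
      show "L2_norm DV \<le> K1 * (q * R)" by (rule DV(2))
      have "L2_norm (\<lambda>x. g x - clamped_log lo hi (V x)) \<le> L2_norm (\<lambda>x. complex_of_real L * (U x - V x))"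
      proof (rule L2_norm_mono)
        show "sqint (\<lambda>x. complex_of_real L * (U x - V x))" by (intro sqint_cmult sqint_diff sU sV)
        show "(\<lambda>x. g x - clamped_log lo hi (V x)) \<in> borel_measurable tm"
          by (rule sqint_measurable[OF sqint_diff[OF sg sgV]])
        show "AE x in tm. cmod (g x - clamped_log lo hi (V x)) \<le> cmod (complex_of_real L * (U x - V x))"
          unfolding g_def norm_mult norm_of_real abs_of_nonneg[OF L0] using Lip by simp
      qed
      also have "\<dots> = L * L2_norm (\<lambda>x. U x - V x)" by (simp only: L2_norm_cmult norm_of_real abs_of_nonneg[OF L0])
      also have "\<dots> \<le> L * ((q + 2 * p) * R)"
      proof (rule mult_left_mono[OF _ L0])
        have "L2_norm (\<lambda>x. U x - V x) \<le> L2_norm (\<lambda>x. U x - proj N U x) + L2_norm (\<lambda>x. proj N U x - V x)"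
          by (intro L2_norm_dist_triangle sU sV sqint_proj)
        also have "L2_norm (\<lambda>x. proj N U x - V x) = L2_norm (\<lambda>x. schr N \<sigma> U x - proj N U x)"
          unfolding V_def by (rule L2_norm_uminus_diff)
        also have "\<dots> \<le> 2 * \<sigma> powr (s / 2) * R"
          using s by (intro schr_proj_error U R0 \<sigma>) auto
        also have "\<dots> \<le> 2 * p * R"
          unfolding p_def using s \<sigma> R0 by (intro mult_right_mono mult_left_mono powr_mono2) auto
        finally show "L2_norm (\<lambda>x. U x - V x) \<le> (q + 2 * p) * R"
          using proj_error[OF U s(1) R0 N1] by (simp add: q_def algebra_simps)
      qed
      finally show "L2_norm (\<lambda>x. g x - clamped_log lo hi (V x)) \<le> L * ((q + 2 * p) * R)" .
    qed
    \<comment> \<open>The mixed products absent on the left are nonnegative, so each constant may be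
      paired with p + q.\<close>
    also have "\<dots> \<le> (L * (K2 + K3 + 2) + 2 * K1) * ((p + q) * R)"
    proof -
      have "0 \<le> K3 * L * (q * R)" "0 \<le> K2 * L * (p * R)" "0 \<le> L * (q * R)" "0 \<le> K1 * (p * R)"
        using K1 K2 K3 L0 p q R0 by simp_all
      then show ?thesis by (simp add: algebra_simps)
    qed
    also have "\<dots> \<le> (K4 * ln (real N) * (K2 + K3 + 2) + 2 * K1 * (ln (real N) / ln 2)) * ((p + q) * R)"
    proof (intro mult_right_mono add_mono LK)
      show "2 * K1 \<le> 2 * K1 * (ln (real N) / ln 2)"
        using mult_left_mono[OF one_le, of "2 * K1"] K1 by simp
    qed (use K2 K3 p q R0 in auto)
    also have "K4 * ln (real N) * (K2 + K3 + 2) + 2 * K1 * (ln (real N) / ln 2) = K * ln (real N)"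
      by (simp only: K_def distrib_left distrib_right times_divide_eq_left times_divide_eq_right mult_ac)
    also have "K * ln (real N) * ((p + q) * R) = K * ln (real N) * (p + q) * R" by simp
    finally show "sqint (\<lambda>x. log_nonlin (U x)) \<and>
      L2_norm (\<lambda>x. schr N \<sigma> (\<lambda>x. log_nonlin (U x)) x - log_nonlin (schr N \<sigma> U x))
        \<le> K * ln (real N) * (\<tau> powr (s / 2) + real N powr (- s)) * R"
      using sf by (simp add: V_def p_def q_def)
  qed
qed

subsection \<open>Evolution of the Fourier coefficients and of the splitting flow\<close>

lemma chr_directional_derivative:
  "((\<lambda>h. c * chr k (x + h *\<^sub>R axis i 1)) has_vector_derivative (c * (\<i> * (k $ i))) * chr k x) (at 0)"
proof -
  have "((\<lambda>h. c * exp (\<i> * (k \<bullet> x)) * exp (\<i> * (k $ i) * h)) has_vector_derivative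
      c * exp (\<i> * (k \<bullet> x)) * (\<i> * (k $ i))) (at (0::real))"
  proof (rule has_vector_derivative_real_field)
    show "((\<lambda>z. c * exp (\<i> * (k \<bullet> x)) * exp (\<i> * (k $ i) * z)) has_field_derivative
        c * exp (\<i> * (k \<bullet> x)) * (\<i> * (k $ i))) (at (complex_of_real 0))"
      by (auto intro!: derivative_eq_intros)
  qed
  then show ?thesis
    by (simp add: chr_def inner_add_right inner_axis distrib_left exp_add mult_ac)
qed

lemma partial_deriv_chr:
  "partial_deriv i (\<lambda>x. c * chr k x) = (\<lambda>x. (c * (\<i> * (k $ i))) * chr k x)"
  unfolding partial_deriv_def fun_eq_iff
  by (intro allI vector_derivative_at chr_directional_derivative)

lemma C_k_chr: "C_k n (\<lambda>x. c * chr k x)"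
proof (induction n arbitrary: c)
  case 0
  show ?case by (simp, intro continuous_intros)
next
  case (Suc n)
  show ?case
    unfolding C_k.simps partial_deriv_chr
    by (intro allI conjI differentiableI_vector[OF chr_directional_derivative] Suc)
qed

lemma test_function_chr: "k \<in> int_lattice \<Longrightarrow> test_function (chr k)"
  using C_k_chr[of _ 1 k] by (simp add: test_function_def periodic_chr)

lemma laplacian_chr: "laplacian (chr k) x = - complex_of_real ((norm k)\<^sup>2) * chr k x"
proof -
  have "laplacian (chr k) x = (\<Sum>i\<in>UNIV. partial_deriv i (partial_deriv i (\<lambda>x. 1 * chr k x)) x)"
    by (simp add: laplacian_def)
  also have "\<dots> = (\<Sum>i\<in>UNIV. - complex_of_real ((k $ i)\<^sup>2) * chr k x)"
    unfolding partial_deriv_chr by (intro sum.cong refl) (simp add: complex_eq_iff power2_eq_square algebra_simps)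
  also have "\<dots> = - complex_of_real (\<Sum>i\<in>UNIV. (k $ i)\<^sup>2) * chr k x"
    by (simp add: sum_distrib_right sum_negf)
  also have "(\<Sum>i\<in>UNIV. (k $ i)\<^sup>2) = (norm k)\<^sup>2"
    by (simp add: norm_eq_sqrt_inner inner_vec_def power2_eq_square sum_nonneg)
  finally show ?thesis .
qed

lemma fourier_coeff_chr_minus:
  "fourier_coeff f k = (LINT x|tm. f x * chr (- k) x) / (2 * pi) ^ CARD('d)" for f :: "real^'d \<Rightarrow> complex"
  by (simp add: fourier_coeff_def chr_def)

text \<open>\<open>chr (- k)\<close> is an admissible test function and an eigenfunction of the
  Laplacian, so the weak equation tested with it is an ordinary differential equation for
  coefficient k. The sign appears because the weak form pairs without conjugation.\<close>

lemma fourier_coeff_evolution: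
  fixes u :: "real \<Rightarrow> real^'d \<Rightarrow> complex"
  assumes sol: "logSE_solution lam T u0 u" and t: "0 < t" "t \<le> T" and k: "k \<in> int_lattice"
  shows "((\<lambda>t. fourier_coeff (u t) k) has_vector_derivative
    (- \<i> * complex_of_real ((norm k)\<^sup>2) * fourier_coeff (u t) k
     - \<i> * complex_of_real lam * fourier_coeff (\<lambda>x. log_nonlin (u t x)) k)) (at t within {0<..T})"
proof -
  let ?V = "(2 * complex_of_real pi) ^ CARD('d)"
  have mk: "- k \<in> int_lattice" using int_lattice_diff[OF int_lattice_0 k] by simp
  obtain D where D: "((\<lambda>t'. LINT x|tm. u t' x * chr (- k) x) has_vector_derivative D) (at t within {0<..T})"
    and eq: "\<i> * D + (LINT x|tm. u t x * laplacian (chr (- k)) x) =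
      complex_of_real lam * (LINT x|tm. log_nonlin (u t x) * chr (- k) x)"
    using sol test_function_chr[OF mk] t unfolding logSE_solution_def by (meson greaterThanAtMost_iff)
  have V: "?V \<noteq> 0" by simp
  have "(LINT x|tm. u t x * laplacian (chr (- k)) x) = - complex_of_real ((norm k)\<^sup>2) * (LINT x|tm. u t x * chr (- k) x)"
  proof -
    have "u t x * laplacian (chr (- k)) x = - complex_of_real ((norm k)\<^sup>2) * (u t x * chr (- k) x)" for x
      by (simp add: laplacian_chr)
    then show ?thesis by (simp only: integral_mult_right_zero)
  qed
  then have "\<i> * D - complex_of_real ((norm k)\<^sup>2) * (?V * fourier_coeff (u t) k) =
      complex_of_real lam * (?V * fourier_coeff (\<lambda>x. log_nonlin (u t x)) k)"
    using eq by (simp add: fourier_coeff_chr_minus)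
  then have "- \<i> * (\<i> * D) = - \<i> * (?V * (complex_of_real ((norm k)\<^sup>2) * fourier_coeff (u t) k
      + complex_of_real lam * fourier_coeff (\<lambda>x. log_nonlin (u t x)) k))"
    by (simp add: algebra_simps)
  then have "D = - \<i> * (?V * (complex_of_real ((norm k)\<^sup>2) * fourier_coeff (u t) k
      + complex_of_real lam * fourier_coeff (\<lambda>x. log_nonlin (u t x)) k))"
    by (simp flip: mult.assoc)
  moreover have "a = - \<i> * (v * x) \<Longrightarrow> v \<noteq> 0 \<Longrightarrow> a / v = - \<i> * x" for a v x :: complex by simp
  ultimately have "D / ?V = - \<i> * (complex_of_real ((norm k)\<^sup>2) * fourier_coeff (u t) k
      + complex_of_real lam * fourier_coeff (\<lambda>x. log_nonlin (u t x)) k)" using V by blast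
  then have DV: "D / ?V = - \<i> * complex_of_real ((norm k)\<^sup>2) * fourier_coeff (u t) k
     - \<i> * complex_of_real lam * fourier_coeff (\<lambda>x. log_nonlin (u t x)) k"
    by (simp only: distrib_left mult.assoc) (simp add: algebra_simps)
  have "((\<lambda>t'. (LINT x|tm. u t' x * chr (- k) x) / ?V) has_vector_derivative D / ?V) (at t within {0<..T})"
    by (rule has_vector_derivative_divide[OF D])
  moreover have feq: "fourier_coeff f k = (LINT x|tm. f x * chr (- k) x) / ?V" for f :: "real^'d \<Rightarrow> complex"
    by (simp add: fourier_coeff_chr_minus)
  ultimately show ?thesis unfolding DV by (simp only: feq[of "u _"])
qed

lemma norm_fourier_coeff_le:
  assumes "sqint (f :: real^'d \<Rightarrow> complex)"
  shows "cmod (fourier_coeff f k) \<le> L2_norm f / sqrt ((2 * pi) ^ CARD('d))"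
proof -
  let ?V = "(2 * pi) ^ CARD('d)"
  have chr: "L2_norm (chr k :: real^'d \<Rightarrow> complex) = sqrt ?V"
    by (simp add: L2_norm_def measure_torus)
  have "cmod (fourier_coeff f k) = cmod (ip f (chr k)) / ?V"
    by (simp add: fourier_coeff_ip norm_divide norm_power norm_mult)
  also have "\<dots> \<le> (L2_norm f * sqrt ?V) / ?V"
    using Cauchy_Schwarz_L2[OF assms sqint_chr[of k]] chr by (intro divide_right_mono) auto
  also have "\<dots> = L2_norm f * (sqrt ?V / ?V)" by simp
  also have "sqrt ?V / ?V = inverse (sqrt ?V)" by (rule sqrt_divide_self_eq) simp
  also have "L2_norm f * inverse (sqrt ?V) = L2_norm f / sqrt ?V" by (simp only: divide_inverse)
  finally show ?thesis .
qed

lemma fourier_coeff_initial: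
  fixes u :: "real \<Rightarrow> real^'d \<Rightarrow> complex"
  assumes sol: "logSE_solution lam T u0 u" and T: "0 < T" and u0: "u0 \<in> L2"
  shows "((\<lambda>t. fourier_coeff (u t) k) \<longlongrightarrow> fourier_coeff u0 k) (at_right 0)"
proof -
  let ?V = "(2 * pi) ^ CARD('d)"
  have lim: "((\<lambda>t. L2_norm (\<lambda>x. u t x - u0 x) / sqrt ?V) \<longlongrightarrow> 0 / sqrt ?V) (at_right 0)"
    using sol unfolding logSE_solution_def by (intro tendsto_intros) auto
  have "((\<lambda>t. fourier_coeff (u t) k - fourier_coeff u0 k) \<longlongrightarrow> 0) (at_right 0)"
  proof (rule Lim_null_comparison)
    show "((\<lambda>t. L2_norm (\<lambda>x. u t x - u0 x) / sqrt ?V) \<longlongrightarrow> 0) (at_right 0)" using lim by simp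
    show "\<forall>\<^sub>F t in at_right 0. norm (fourier_coeff (u t) k - fourier_coeff u0 k) \<le> L2_norm (\<lambda>x. u t x - u0 x) / sqrt ?V"
    proof (rule eventually_at_rightI[of 0 T])
      fix t assume "t \<in> {0<..<T}"
      then have ut: "sqint (u t)" using sol by (auto simp: logSE_solution_def intro!: L2_imp_sqint)
      show "norm (fourier_coeff (u t) k - fourier_coeff u0 k) \<le> L2_norm (\<lambda>x. u t x - u0 x) / sqrt ?V"
        using norm_fourier_coeff_le[OF sqint_diff[OF ut L2_imp_sqint[OF u0]], of k]
        by (simp add: fourier_coeff_diff[OF ut L2_imp_sqint[OF u0]])
    qed (rule T)
  qed
  then show ?thesis by (simp add: LIM_zero_iff)
qed

section \<open>Differentiability of the pointwise nonlinear flow\<close>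

lemma has_vector_derivative_quadratic_bound:
  fixes f :: "real \<Rightarrow> 'a::real_normed_vector"
  assumes "\<And>y. norm (f y - f x - (y - x) *\<^sub>R d) \<le> C * (y - x)\<^sup>2"
  shows "(f has_vector_derivative d) (at x)"
  unfolding has_vector_derivative_def
proof (rule has_derivativeI_sandwich[of 1])
  show "bounded_linear (\<lambda>h. h *\<^sub>R d)" by (rule bounded_linear_scaleR_left)
  show "norm (f y - f x - (y - x) *\<^sub>R d) / norm (y - x) \<le> C * \<bar>y - x\<bar>" if "y \<noteq> x" for y
    using assms[of y] that by (simp add: divide_le_eq power2_eq_square abs_mult_self_eq mult.assoc)
  have "((\<lambda>y. C * \<bar>y - x\<bar>) \<longlongrightarrow> C * \<bar>x - x\<bar>) (at x)" by (intro tendsto_intros)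
  then show "((\<lambda>y. C * \<bar>y - x\<bar>) \<longlongrightarrow> 0) (at x)" by simp
qed simp

text \<open>With y = sqrt r the expression equals 4 (y ln y)^2, and |y ln y| \<le> 1 on (0, 1]; for
  r > 1, ln r \<le> r. It controls the second-order Taylor remainder of \<open>flow_B\<close>, whose
  phase speed is unbounded near zeros of w.\<close>

lemma x_ln_squared_le:
  fixes r B :: real
  assumes "0 < r" "r \<le> B"
  shows "r * (ln r)\<^sup>2 \<le> 4 + B ^ 3"
proof (cases "r \<le> 1")
  case True
  define y where "y = sqrt r"
  have y: "0 < y" "y \<le> 1" using assms True by (auto simp: y_def)
  have r: "r = y\<^sup>2" using assms by (simp add: y_def)
  have "y * (ln 1 - ln y) \<le> 1 - y" by (rule ln_diff_le[OF y])
  then have "\<bar>y * ln y\<bar> \<le> 1" using y by (simp add: abs_mult mult_le_0_iff)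
  then have "(y * ln y)\<^sup>2 \<le> 1" by (simp add: abs_square_le_1)
  moreover have "r * (ln r)\<^sup>2 = 4 * (y * ln y)\<^sup>2"
    using y by (simp add: r ln_realpow power_mult_distrib)
  moreover have "0 \<le> B ^ 3" using assms by simp
  ultimately show ?thesis by linarith
next
  case False
  have "ln r \<le> r" using ln_bound[of r] assms by simp
  then have "(ln r)\<^sup>2 \<le> r\<^sup>2" using False by (intro power_mono) auto
  then have "r * (ln r)\<^sup>2 \<le> r * r\<^sup>2" using assms by (intro mult_left_mono) auto
  also have "\<dots> = r ^ 3" by (simp add: power2_eq_square power3_eq_cube)
  also have "\<dots> \<le> B ^ 3" using assms by (intro power_mono) auto
  finally show ?thesis by simp
qed

lemma norm_flow_B [simp]: "cmod (flow_B lam t w x) = cmod (w x)"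
  by (simp add: flow_B_def norm_mult)

lemma flow_B_0 [simp]: "flow_B lam 0 w = w"
  by (simp add: flow_B_def fun_eq_iff)

lemma flow_B_measurable [measurable]: "w \<in> borel_measurable M \<Longrightarrow> flow_B lam t w \<in> borel_measurable M"
  unfolding flow_B_def[abs_def] by measurable

lemma sqint_flow_B: "sqint w \<Longrightarrow> sqint (flow_B lam t w)"
  by (rule sqint_dominated[of w _ 1]) (auto intro: flow_B_measurable sqint_measurable)

text \<open>Since |a| \<le> 1 + a^2 at a = ln r, the product r |ln r| is at most r + r (ln r)^2,
  which \<open>x_ln_squared_le\<close> bounds.\<close>

lemma sqint_log_nonlin_bounded:
  assumes "w \<in> borel_measurable tm" "AE x in tm. cmod (w x) \<le> B"
  shows "sqint (\<lambda>x. log_nonlin (w x))"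
proof (rule sqint_dominated[OF sqint_const[of 1]])
  show "(\<lambda>x. log_nonlin (w x)) \<in> borel_measurable tm" using assms(1) by measurable
  show "AE x in tm. cmod (log_nonlin (w x)) \<le> (2 * (B + (4 + B ^ 3))) * cmod 1"
    using assms(2)
  proof eventually_elim
    case (elim x)
    have B: "0 \<le> B" using elim norm_ge_zero order_trans by blast
    show ?case
    proof (cases "w x = 0")
      case True
      then show ?thesis using B by (simp add: log_nonlin_def)
    next
      case False
      let ?r = "cmod (w x)"
      have "?r * \<bar>ln ?r\<bar> \<le> ?r * (1 + (ln ?r)\<^sup>2)"
      proof (rule mult_left_mono)
        have "0 \<le> (\<bar>ln ?r\<bar> - 1)\<^sup>2 + \<bar>ln ?r\<bar>\<^sup>2 + 1" by simp
        then show "\<bar>ln ?r\<bar> \<le> 1 + (ln ?r)\<^sup>2" by (simp add: power2_diff)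
      qed simp
      also have "\<dots> \<le> B + (4 + B ^ 3)"
        using x_ln_squared_le[of ?r B] False elim by (simp add: distrib_left)
      finally show ?thesis by (simp add: log_nonlin_eq norm_mult)
    qed
  qed
qed

text \<open>The modulus, and with it the phase speed, is constant along \<open>flow_B\<close>, so
  the later value is the earlier one rotated by an angle y. The remainder is (exp (i y) - 1 - i y)
  times that value, and |exp (i y) - 1 - i y| \<le> y^2 / 2.\<close>

lemma flow_B_difference:
  assumes "cmod (w x) \<le> B"
  shows "cmod (flow_B lam t' w x - flow_B lam t w x
      - complex_of_real (t' - t) * (- \<i> * complex_of_real lam * log_nonlin (flow_B lam t w x)))
    \<le> 2 * lam\<^sup>2 * (4 + B ^ 3) * (t' - t)\<^sup>2"
proof (cases "w x = 0")
  case True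
  have "0 \<le> B" using assms norm_ge_zero order_trans by blast
  then show ?thesis using True by (simp add: flow_B_def log_nonlin_def)
next
  case False
  let ?r = "cmod (w x)"
  define y where "y = - (lam * (t' - t) * (2 * ln ?r))"
  have ln2: "ln (?r\<^sup>2) = 2 * ln ?r" using False by (simp add: ln_realpow)
  have "flow_B lam t' w x = iexp y * flow_B lam t w x"
    unfolding flow_B_def ln2 y_def by (simp add: algebra_simps flip: exp_add)
  moreover have "complex_of_real (t' - t) * (- \<i> * complex_of_real lam * log_nonlin (flow_B lam t w x)) =
      \<i> * complex_of_real y * flow_B lam t w x"
    by (simp add: log_nonlin_eq y_def algebra_simps)
  ultimately have "flow_B lam t' w x - flow_B lam t w x
      - complex_of_real (t' - t) * (- \<i> * complex_of_real lam * log_nonlin (flow_B lam t w x)) =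
      (iexp y - (1 + \<i> * complex_of_real y)) * flow_B lam t w x"
    by (simp add: algebra_simps)
  then have "cmod (flow_B lam t' w x - flow_B lam t w x
      - complex_of_real (t' - t) * (- \<i> * complex_of_real lam * log_nonlin (flow_B lam t w x)))
      = cmod (iexp y - (1 + \<i> * complex_of_real y)) * ?r"
    by (simp add: norm_mult)
  also have "\<dots> \<le> (y\<^sup>2 / 2) * ?r"
    using iexp_approx1[of y 1] by (intro mult_right_mono) (simp_all add: power2_eq_square)
  also have "\<dots> = 2 * lam\<^sup>2 * (t' - t)\<^sup>2 * (?r * (ln ?r)\<^sup>2)"
    by (simp add: y_def power_mult_distrib)
  also have "\<dots> \<le> 2 * lam\<^sup>2 * (t' - t)\<^sup>2 * (4 + B ^ 3)"
    using x_ln_squared_le[of ?r B] False assms by (intro mult_left_mono) auto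
  finally show ?thesis by (simp only: mult_ac)
qed

text \<open>The Taylor remainder is quadratic in time uniformly over the torus, so the same holds
  for its Fourier coefficients; this replaces differentiation under the integral sign.\<close>

lemma fourier_coeff_flow_B_derivative:
  fixes w :: "real^'d \<Rightarrow> complex"
  assumes w: "w \<in> borel_measurable tm" and B: "\<And>x. x \<in> torus \<Longrightarrow> cmod (w x) \<le> B"
  shows "((\<lambda>t. fourier_coeff (flow_B lam t w) k) has_vector_derivative
    - \<i> * complex_of_real lam * fourier_coeff (\<lambda>x. log_nonlin (flow_B lam t w x)) k) (at t)"
proof (rule has_vector_derivative_quadratic_bound)
  let ?V = "(2 * pi) ^ CARD('d)"
  fix t'
  have AEB: "AE x in tm. cmod (w x) \<le> B" by (rule AE_torusI[OF B])
  have sw: "sqint (flow_B lam r w)" for r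
    by (rule sqint_flow_B[OF sqint_bounded[OF w AEB]])
  have sf: "sqint (\<lambda>x. log_nonlin (flow_B lam t w x))"
    by (rule sqint_log_nonlin_bounded[of _ B]) (use w AEB in auto)
  let ?c = "- \<i> * complex_of_real lam"
  let ?D = "\<lambda>x. flow_B lam t' w x - flow_B lam t w x - complex_of_real (t' - t) * (?c * log_nonlin (flow_B lam t w x))"
  have sc: "sqint (\<lambda>x. complex_of_real (t' - t) * (?c * log_nonlin (flow_B lam t w x)))" by (intro sqint_cmult sf)
  have sD: "sqint ?D" by (intro sqint_diff sw sc)
  have eq: "fourier_coeff (flow_B lam t' w) k - fourier_coeff (flow_B lam t w) k
      - (t' - t) *\<^sub>R (?c * fourier_coeff (\<lambda>x. log_nonlin (flow_B lam t w x)) k) = fourier_coeff ?D k"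
    unfolding fourier_coeff_diff[OF sqint_diff[OF sw sw] sc] fourier_coeff_diff[OF sw sw] fourier_coeff_cmult
    by (simp add: scaleR_conv_of_real)
  have "cmod (fourier_coeff ?D k) \<le> L2_norm ?D / sqrt ?V" by (rule norm_fourier_coeff_le[OF sD])
  also have "\<dots> \<le> (sqrt ?V * (2 * lam\<^sup>2 * (4 + B ^ 3) * (t' - t)\<^sup>2)) / sqrt ?V"
  proof (intro divide_right_mono L2_norm_le_sup sqint_measurable[OF sD])
    show "AE x in tm. cmod (?D x) \<le> 2 * lam\<^sup>2 * (4 + B ^ 3) * (t' - t)\<^sup>2"
      by (intro AE_torusI flow_B_difference B)
    have "(0 :: real^'d) \<in> torus" by (simp add: torus_def)
    then have "0 \<le> B" using B norm_ge_zero order_trans by blast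
    then show "0 \<le> 2 * lam\<^sup>2 * (4 + B ^ 3) * (t' - t)\<^sup>2" by simp
  qed simp
  also have "\<dots> = 2 * lam\<^sup>2 * (4 + B ^ 3) * (t' - t)\<^sup>2" by simp
  finally show "cmod (fourier_coeff (flow_B lam t' w) k - fourier_coeff (flow_B lam t w) k
      - (t' - t) *\<^sub>R (?c * fourier_coeff (\<lambda>x. log_nonlin (flow_B lam t w x)) k)) \<le> 2 * lam\<^sup>2 * (4 + B ^ 3) * (t' - t)\<^sup>2"
    unfolding eq .
qed

text \<open>Dividing by 2 sqrt h makes the bound linear for sqrt h, with rate 2 L and source L G. As
  the root is not differentiable at 0, h is replaced by h + e; the integrating factor exp (- 2 L
  \<sigma>) and the mean value theorem give the bound, and e tends to 0.\<close>

lemma sqrt_Gronwall: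
  fixes h h' :: "real \<Rightarrow> real"
  assumes \<tau>: "0 < \<tau>" and cont: "continuous_on {0..\<tau>} h"
    and deriv: "\<And>\<sigma>. 0 < \<sigma> \<Longrightarrow> \<sigma> < \<tau> \<Longrightarrow> (h has_real_derivative h' \<sigma>) (at \<sigma>)"
    and bound: "\<And>\<sigma>. 0 < \<sigma> \<Longrightarrow> \<sigma> < \<tau> \<Longrightarrow> h' \<sigma> \<le> 4 * L * h \<sigma> + 2 * L * G * sqrt (h \<sigma>)"
    and nonneg: "\<And>\<sigma>. 0 \<le> h \<sigma>" "0 \<le> L" "0 \<le> G"
  shows "sqrt (h \<tau>) \<le> exp (2 * L * \<tau>) * (sqrt (h 0) + L * \<tau> * G)"
proof -
  have main: "sqrt (h \<tau> + e) \<le> exp (2 * L * \<tau>) * (sqrt (h 0 + e) + L * \<tau> * G)" if e: "e > 0" for e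
  proof -
    define \<phi> where "\<phi> \<sigma> = sqrt (h \<sigma> + e) * exp (- (2 * L * \<sigma>))" for \<sigma>
    define \<phi>' where "\<phi>' \<sigma> = h' \<sigma> / (2 * sqrt (h \<sigma> + e)) * exp (- (2 * L * \<sigma>)) - 2 * L * \<phi> \<sigma>" for \<sigma>
    have he: "0 < h \<sigma> + e" for \<sigma> using nonneg(1)[of \<sigma>] e by simp
    have c\<phi>: "continuous_on {0..\<tau>} \<phi>" unfolding \<phi>_def by (intro continuous_intros cont)
    have d\<phi>: "(\<phi> has_real_derivative \<phi>' \<sigma>) (at \<sigma>)" if "0 < \<sigma>" "\<sigma> < \<tau>" for \<sigma>
    proof -
      have "((\<lambda>\<sigma>. sqrt (h \<sigma> + e) * exp (- (2 * L * \<sigma>))) has_real_derivative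
        (h' \<sigma> + 0) * (inverse (sqrt (h \<sigma> + e)) / 2) * exp (- (2 * L * \<sigma>)) + exp (- (2 * L * \<sigma>)) * (- (2 * L * 1)) * sqrt (h \<sigma> + e)) (at \<sigma>)"
        using he[of \<sigma>] by (auto intro!: derivative_eq_intros deriv[OF that])
      then show ?thesis unfolding \<phi>_def[abs_def] \<phi>'_def
        by (rule DERIV_cong) (simp add: \<phi>_def field_simps)
    qed
    have b\<phi>: "\<phi>' \<sigma> \<le> L * G" if "0 < \<sigma>" "\<sigma> < \<tau>" for \<sigma>
    proof -
      let ?q = "sqrt (h \<sigma> + e)" and ?E = "exp (- (2 * L * \<sigma>))"
      have q: "0 < ?q" "?q * ?q = h \<sigma> + e" "sqrt (h \<sigma>) \<le> ?q" using he[of \<sigma>] e by auto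
      have "h' \<sigma> \<le> 4 * L * h \<sigma> + 2 * L * G * sqrt (h \<sigma>)" by (rule bound[OF that])
      also have "\<dots> \<le> 4 * L * (?q * ?q) + 2 * L * G * ?q"
        using nonneg q e by (intro add_mono mult_left_mono) auto
      also have "\<dots> = (2 * L * ?q + L * G) * (2 * ?q)" by (simp add: algebra_simps)
      finally have "h' \<sigma> / (2 * ?q) \<le> 2 * L * ?q + L * G" using q(1) by (simp add: divide_le_eq)
      then have "h' \<sigma> / (2 * ?q) * ?E \<le> (2 * L * ?q + L * G) * ?E" by (intro mult_right_mono) auto
      then have "\<phi>' \<sigma> \<le> L * G * ?E" unfolding \<phi>'_def \<phi>_def by (simp add: algebra_simps)
      also have "\<dots> \<le> L * G * 1" using nonneg that by (intro mult_left_mono) auto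
      finally show ?thesis by simp
    qed
    have d: "(\<phi> has_derivative (*) (\<phi>' \<sigma>)) (at \<sigma>)" if "0 < \<sigma>" "\<sigma> < \<tau>" for \<sigma>
      using d\<phi>[OF that] by (simp add: has_field_derivative_def)
    obtain z where z: "0 < z" "z < \<tau>" "\<phi> \<tau> - \<phi> 0 = \<phi>' z * (\<tau> - 0)"
      using mvt[OF \<tau> c\<phi> d] by blast
    have "\<phi>' z * \<tau> \<le> L * G * \<tau>" using b\<phi>[OF z(1,2)] \<tau> by (intro mult_right_mono) auto
    then have "\<phi> \<tau> \<le> \<phi> 0 + \<tau> * (L * G)"
      using z(3) by (simp add: mult_ac)
    then have "sqrt (h \<tau> + e) * exp (- (2 * L * \<tau>)) \<le> sqrt (h 0 + e) + L * \<tau> * G"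
      by (simp add: \<phi>_def mult_ac)
    then have "exp (2 * L * \<tau>) * (sqrt (h \<tau> + e) * exp (- (2 * L * \<tau>))) \<le> exp (2 * L * \<tau>) * (sqrt (h 0 + e) + L * \<tau> * G)"
      by (intro mult_left_mono) auto
    moreover have "exp (2 * L * \<tau>) * (sqrt (h \<tau> + e) * exp (- (2 * L * \<tau>))) = sqrt (h \<tau> + e)"
      by (simp add: exp_minus)
    ultimately show ?thesis by simp
  qed
  have "((\<lambda>e. exp (2 * L * \<tau>) * (sqrt (h 0 + e) + L * \<tau> * G) - sqrt (h \<tau> + e)) \<longlongrightarrow>
      exp (2 * L * \<tau>) * (sqrt (h 0 + 0) + L * \<tau> * G) - sqrt (h \<tau> + 0)) (at_right 0)"
    by (intro tendsto_intros)
  then have "0 \<le> exp (2 * L * \<tau>) * (sqrt (h 0 + 0) + L * \<tau> * G) - sqrt (h \<tau> + 0)"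
    by (rule tendsto_lowerbound) (use main in \<open>auto intro!: eventually_at_rightI[of 0 1]\<close>)
  then show ?thesis by simp
qed

lemma flow_A_proj:
  "flow_A \<tau> (proj N g) = trig (freqs N) (\<lambda>k. exp (- \<i> * complex_of_real ((norm k)\<^sup>2 * \<tau>)) * fourier_coeff g k)"
proof
  fix x :: "real^'a"
  let ?f = "\<lambda>k. exp (- \<i> * complex_of_real ((norm k)\<^sup>2 * \<tau>)) * fourier_coeff (proj N g) k * exp (\<i> * complex_of_real (k \<bullet> x))"
  have "flow_A \<tau> (proj N g) x = (\<Sum>\<^sub>\<infinity>k\<in>freqs N. ?f k)"
    unfolding flow_A_def
    by (intro infsum_cong_neutral) (auto simp: fourier_coeff_proj dest: subsetD[OF freqs_subset])
  also have "\<dots> = (\<Sum>k\<in>freqs N. ?f k)" by simp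
  also have "\<dots> = trig (freqs N) (\<lambda>k. exp (- \<i> * complex_of_real ((norm k)\<^sup>2 * \<tau>)) * fourier_coeff g k) x"
    unfolding trig_def by (intro sum.cong refl) (simp add: fourier_coeff_proj chr_def subsetD[OF freqs_subset])
  finally show "flow_A \<tau> (proj N g) x = trig (freqs N) (\<lambda>k. exp (- \<i> * complex_of_real ((norm k)\<^sup>2 * \<tau>)) * fourier_coeff g k) x" .
qed

lemma continuous_on_lie_trotter: "continuous_on UNIV (lie_trotter lam \<tau> N u0 n)"
  by (cases n) (simp_all add: proj_eq_trig flow_A_proj[unfolded proj_eq_trig] continuous_on_trig)

text \<open>The numerical solution is compared, before projection, with the exact one in the frame moving
  with the free flow: there the difference of the nonlinear terms is controlled by the quasi-monotonicity
  of \<open>log_nonlin\<close>, and only the commutator \<open>G\<close> of \<open>log_nonlin\<close> with the free flow remains.\<close>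

lemma splitting_step:
  fixes w0 :: "real^'d \<Rightarrow> complex" and b B :: "real \<Rightarrow> real^'d \<Rightarrow> complex"
  assumes w0: "continuous_on UNIV w0" and \<tau>: "0 < \<tau>"
    and cont: "\<And>k. k \<in> freqs N \<Longrightarrow> continuous_on {0..\<tau>} (\<lambda>\<sigma>. b \<sigma> k)"
    and deriv: "\<And>k \<sigma>. k \<in> freqs N \<Longrightarrow> 0 < \<sigma> \<Longrightarrow> \<sigma> < \<tau> \<Longrightarrow>
      ((\<lambda>\<sigma>. b \<sigma> k) has_vector_derivative (- \<i> * complex_of_real lam * B \<sigma> k)) (at \<sigma>)"
    and G: "\<And>\<sigma>. 0 < \<sigma> \<Longrightarrow> \<sigma> < \<tau> \<Longrightarrow>
      L2_norm (\<lambda>x. trig (freqs N) (B \<sigma>) x - log_nonlin (trig (freqs N) (b \<sigma>) x)) \<le> G"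
    and G0: "0 \<le> G"
  shows "L2_norm (\<lambda>x. trig (freqs N) (b \<tau>) x - flow_B lam \<tau> w0 x)
    \<le> exp (2 * \<bar>lam\<bar> * \<tau>) * (L2_norm (\<lambda>x. trig (freqs N) (b 0) x - w0 x) + \<bar>lam\<bar> * \<tau> * G)"
proof -
  let ?K = "freqs N :: (real^'d) set" and ?V = "(2 * pi) ^ CARD('d)"
  obtain M where M: "\<And>x. x \<in> torus \<Longrightarrow> cmod (w0 x) \<le> M" using continuous_bounded_torus[OF w0] by blast
  have mw: "w0 \<in> borel_measurable tm" by (rule borel_measurable_continuous_tm[OF w0])
  define w where "w \<sigma> = flow_B lam \<sigma> w0" for \<sigma>
  define y where "y \<sigma> = trig ?K (b \<sigma>)" for \<sigma>
  define Z where "Z \<sigma> = trig ?K (B \<sigma>)" for \<sigma>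
  define f where "f \<sigma> x = log_nonlin (w \<sigma> x)" for \<sigma> x
  define c where "c \<sigma> k = fourier_coeff (w \<sigma>) k" for \<sigma> k
  define F where "F \<sigma> k = fourier_coeff (f \<sigma>) k" for \<sigma> k
  define h where "h \<sigma> = (L2_norm (\<lambda>x. w \<sigma> x - y \<sigma> x))\<^sup>2" for \<sigma>
  define h' where "h' \<sigma> = ?V * (\<Sum>k\<in>?K. Re ((b \<sigma> k - 2 * c \<sigma> k) * cnj (- \<i> * complex_of_real lam * B \<sigma> k)
      + (- \<i> * complex_of_real lam * B \<sigma> k - 2 * (- \<i> * complex_of_real lam * F \<sigma> k)) * cnj (b \<sigma> k)))" for \<sigma>
  have sw: "sqint (w \<sigma>)" for \<sigma> unfolding w_def by (intro sqint_flow_B sqint_continuous w0)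
  have wM: "cmod (w \<sigma> x) \<le> M" if "x \<in> torus" for \<sigma> x using M[OF that] by (simp add: w_def)
  have sf: "sqint (f \<sigma>)" for \<sigma>
    unfolding f_def by (rule sqint_log_nonlin_bounded[of _ M]) (auto intro: sqint_measurable[OF sw] AE_torusI wM)
  have sy: "sqint (y \<sigma>)" for \<sigma> by (simp add: y_def)
  have sZ: "sqint (Z \<sigma>)" for \<sigma> by (simp add: Z_def)
  have sfy: "sqint (\<lambda>x. log_nonlin (y \<sigma> x))" for \<sigma>
  proof -
    have "continuous_on UNIV (y \<sigma>)" unfolding y_def by (rule continuous_on_trig)
    then obtain M' where "\<And>x. x \<in> torus \<Longrightarrow> cmod (y \<sigma> x) \<le> M'" using continuous_bounded_torus by blast
    then show ?thesis by (intro sqint_log_nonlin_bounded[of _ M'] sqint_measurable[OF sy] AE_torusI)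
  qed
  have dc: "((\<lambda>\<sigma>. c \<sigma> k) has_vector_derivative (- \<i> * complex_of_real lam * F \<sigma> k)) (at \<sigma>)" for k \<sigma>
    unfolding c_def F_def f_def w_def by (rule fourier_coeff_flow_B_derivative[OF mw M])
  \<comment> \<open>\<open>flow_B\<close> preserves the L2 norm, so the part of w outside
    \<open>freqs N\<close> enters only through a constant and the rest is a finite sum of
    coefficients that can be differentiated.\<close>
  have h_eq: "h \<sigma> = (L2_norm w0)\<^sup>2 + ?V * (\<Sum>k\<in>?K. Re ((b \<sigma> k - 2 * c \<sigma> k) * cnj (b \<sigma> k)))" for \<sigma>
  proof -
    have "L2_norm (w \<sigma>) = L2_norm w0" by (simp add: L2_norm_def w_def)
    then have "h \<sigma> = (L2_norm w0)\<^sup>2 + ?V * (\<Sum>k\<in>?K. (cmod (c \<sigma> k - b \<sigma> k))\<^sup>2 - (cmod (c \<sigma> k))\<^sup>2)"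
      unfolding h_def y_def L2_norm_diff_trig[OF finite_freqs freqs_subset sw]
      by (simp add: c_def sum_subtractf right_diff_distrib)
    also have "(\<Sum>k\<in>?K. (cmod (c \<sigma> k - b \<sigma> k))\<^sup>2 - (cmod (c \<sigma> k))\<^sup>2) = (\<Sum>k\<in>?K. Re ((b \<sigma> k - 2 * c \<sigma> k) * cnj (b \<sigma> k)))"
      by (intro sum.cong refl) (simp add: cmod_power2, simp add: power2_eq_square algebra_simps)
    finally show ?thesis .
  qed
  have dh: "(h has_real_derivative h' \<sigma>) (at \<sigma>)" if \<sigma>: "0 < \<sigma>" "\<sigma> < \<tau>" for \<sigma>
  proof -
    have t: "((\<lambda>\<sigma>. Re ((b \<sigma> k - 2 * c \<sigma> k) * cnj (b \<sigma> k))) has_vector_derivative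
        Re ((b \<sigma> k - 2 * c \<sigma> k) * cnj (- \<i> * complex_of_real lam * B \<sigma> k)
      + (- \<i> * complex_of_real lam * B \<sigma> k - 2 * (- \<i> * complex_of_real lam * F \<sigma> k)) * cnj (b \<sigma> k))) (at \<sigma>)"
      if "k \<in> ?K" for k
      by (intro bounded_linear.has_vector_derivative[OF bounded_linear_Re] has_vector_derivative_mult
          bounded_linear.has_vector_derivative[OF bounded_linear_cnj] has_vector_derivative_diff
          bounded_linear.has_vector_derivative[OF bounded_linear_mult_right] deriv[OF that \<sigma>] dc)
    have "(h has_vector_derivative 0 + ?V * (\<Sum>k\<in>?K. Re ((b \<sigma> k - 2 * c \<sigma> k) * cnj (- \<i> * complex_of_real lam * B \<sigma> k)
      + (- \<i> * complex_of_real lam * B \<sigma> k - 2 * (- \<i> * complex_of_real lam * F \<sigma> k)) * cnj (b \<sigma> k)))) (at \<sigma>)"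
      unfolding h_eq[abs_def]
      by (intro has_vector_derivative_add has_vector_derivative_const
          bounded_linear.has_vector_derivative[OF bounded_linear_mult_right] has_vector_derivative_sum t)
    then show ?thesis by (simp add: h'_def has_real_derivative_iff_has_vector_derivative)
  qed
  have ch: "continuous_on {0..\<tau>} h"
  proof -
    have cc: "continuous_on A (\<lambda>\<sigma>. c \<sigma> k)" for A k
      by (intro continuous_at_imp_continuous_on ballI has_vector_derivative_continuous[OF dc])
    show ?thesis unfolding h_eq[abs_def] by (intro continuous_intros cont cc)
  qed
  have h'_eq: "h' \<sigma> = 2 * lam * Im (ip (\<lambda>x. Z \<sigma> x - f \<sigma> x) (\<lambda>x. y \<sigma> x - w \<sigma> x))" for \<sigma>
  proof -
    have Zy: "ip (Z \<sigma>) (y \<sigma>) = ?V * (\<Sum>k\<in>?K. cnj (b \<sigma> k) * B \<sigma> k)"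
      unfolding y_def ip_trig_right[OF sZ] unfolding Z_def
      by (simp add: fourier_coeff_trig freqs_subset subsetD[OF freqs_subset])
    have fy: "ip (f \<sigma>) (y \<sigma>) = ?V * (\<Sum>k\<in>?K. cnj (b \<sigma> k) * F \<sigma> k)"
      unfolding y_def ip_trig_right[OF sf] by (simp add: F_def)
    have "ip (w \<sigma>) (Z \<sigma>) = ?V * (\<Sum>k\<in>?K. cnj (B \<sigma> k) * c \<sigma> k)"
      unfolding Z_def ip_trig_right[OF sw] by (simp add: c_def)
    then have Zw: "ip (Z \<sigma>) (w \<sigma>) = ?V * (\<Sum>k\<in>?K. B \<sigma> k * cnj (c \<sigma> k))"
      by (subst cnj_ip[symmetric]) simp
    \<comment> \<open>f times the conjugate of w is real. This supplies the term missing in the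
      derivative of h, which thereby becomes an inner product of two differences.\<close>
    have fw: "Im (ip (f \<sigma>) (w \<sigma>)) = 0"
    proof -
      have "f \<sigma> x * cnj (w \<sigma> x) = complex_of_real ((cmod (w \<sigma> x))\<^sup>2 * ln ((cmod (w \<sigma> x))\<^sup>2))" for x
        by (simp add: f_def log_nonlin_def complex_norm_square mult_ac del: of_real_power)
      then show ?thesis unfolding ip_def by (simp only: integral_complex_of_real Im_complex_of_real)
    qed
    have "ip (\<lambda>x. Z \<sigma> x - f \<sigma> x) (\<lambda>x. y \<sigma> x - w \<sigma> x) =
        ip (Z \<sigma>) (y \<sigma>) - ip (f \<sigma>) (y \<sigma>) - (ip (Z \<sigma>) (w \<sigma>) - ip (f \<sigma>) (w \<sigma>))"
      by (simp only: ip_diff_right[OF sy sw sqint_diff[OF sZ sf]] ip_diff_left[OF sZ sf sy] ip_diff_left[OF sZ sf sw])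
    then have "Im (ip (\<lambda>x. Z \<sigma> x - f \<sigma> x) (\<lambda>x. y \<sigma> x - w \<sigma> x)) =
        Im (complex_of_real ?V * (\<Sum>k\<in>?K. cnj (b \<sigma> k) * B \<sigma> k - cnj (b \<sigma> k) * F \<sigma> k - B \<sigma> k * cnj (c \<sigma> k)))"
      using fw by (simp add: Zy fy Zw sum_subtractf right_diff_distrib)
    also have "\<dots> = ?V * (\<Sum>k\<in>?K. Im (cnj (b \<sigma> k) * B \<sigma> k - cnj (b \<sigma> k) * F \<sigma> k - B \<sigma> k * cnj (c \<sigma> k)))"
      by simp
    finally have Im_eq: "2 * lam * Im (ip (\<lambda>x. Z \<sigma> x - f \<sigma> x) (\<lambda>x. y \<sigma> x - w \<sigma> x)) =
        ?V * (\<Sum>k\<in>?K. 2 * lam * Im (cnj (b \<sigma> k) * B \<sigma> k - cnj (b \<sigma> k) * F \<sigma> k - B \<sigma> k * cnj (c \<sigma> k)))"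
      by (simp only: sum_distrib_left mult_ac)
    show ?thesis unfolding Im_eq h'_def
      by (intro arg_cong[where f="\<lambda>z. ?V * z"] sum.cong refl) (simp add: algebra_simps)
  qed
  \<comment> \<open>\<open>Z - f\<close> is split at the nonlinearity of y: \<open>?r\<close> is the
    commutator, estimated by Cauchy-Schwarz, and \<open>?q\<close> is a difference of values of
    \<open>log_nonlin\<close>, estimated pointwise by quasi-monotonicity.\<close>
  have bound: "h' \<sigma> \<le> 4 * \<bar>lam\<bar> * h \<sigma> + 2 * \<bar>lam\<bar> * G * sqrt (h \<sigma>)" if \<sigma>: "0 < \<sigma>" "\<sigma> < \<tau>" for \<sigma>
  proof -
    let ?e = "\<lambda>x. y \<sigma> x - w \<sigma> x" and ?r = "\<lambda>x. Z \<sigma> x - log_nonlin (y \<sigma> x)"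
      and ?q = "\<lambda>x. log_nonlin (y \<sigma> x) - f \<sigma> x"
    have se: "sqint ?e" and sr: "sqint ?r" and sq: "sqint ?q" by (intro sqint_diff sy sw sZ sfy sf)+
    have ne: "L2_norm ?e = sqrt (h \<sigma>)" unfolding h_def by (subst L2_norm_uminus_diff) simp
    have "\<bar>Im (ip ?q ?e)\<bar> \<le> (LINT x|tm. 2 * (cmod (?e x))\<^sup>2)"
    proof -
      have i: "integrable tm (\<lambda>x. ?q x * cnj (?e x))" by (rule integrable_ip[OF sq se])
      have "Im (ip ?q ?e) = (LINT x|tm. Im (?q x * cnj (?e x)))" unfolding ip_def by (rule integral_Im[OF i, symmetric])
      also have "\<bar>\<dots>\<bar> \<le> (LINT x|tm. \<bar>Im (?q x * cnj (?e x))\<bar>)"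
        by (rule integral_abs_bound)
      also have "\<dots> \<le> (LINT x|tm. 2 * (cmod (?e x))\<^sup>2)"
      proof (rule integral_mono)
        show "integrable tm (\<lambda>x. \<bar>Im (?q x * cnj (?e x))\<bar>)" by (intro integrable_abs integrable_Im i)
        show "integrable tm (\<lambda>x. 2 * (cmod (?e x))\<^sup>2)" using sqint_integrable[OF se] by simp
      qed (unfold f_def, rule log_nonlin_quasi_monotone)
      finally show ?thesis .
    qed
    also have "\<dots> = 2 * h \<sigma>" unfolding h_def L2_norm_sq by (simp add: norm_minus_commute)
    finally have 1: "\<bar>Im (ip ?q ?e)\<bar> \<le> 2 * h \<sigma>" .
    have "\<bar>Im (ip ?r ?e)\<bar> \<le> cmod (ip ?r ?e)" by (rule abs_Im_le_cmod)
    also have "\<dots> \<le> L2_norm ?r * L2_norm ?e" by (rule Cauchy_Schwarz_L2[OF sr se])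
    also have "\<dots> \<le> G * sqrt (h \<sigma>)"
      unfolding ne using G[OF \<sigma>] by (intro mult_right_mono) (auto simp: y_def Z_def h_def)
    finally have 2: "\<bar>Im (ip ?r ?e)\<bar> \<le> G * sqrt (h \<sigma>)" .
    have "(\<lambda>x. Z \<sigma> x - f \<sigma> x) = (\<lambda>x. ?r x + ?q x)" by simp
    then have "ip (\<lambda>x. Z \<sigma> x - f \<sigma> x) ?e = ip ?r ?e + ip ?q ?e" using ip_add_left[OF sr sq se] by simp
    then have "\<bar>Im (ip (\<lambda>x. Z \<sigma> x - f \<sigma> x) ?e)\<bar> \<le> G * sqrt (h \<sigma>) + 2 * h \<sigma>"
      using 1 2 by simp
    then have "2 * \<bar>lam\<bar> * \<bar>Im (ip (\<lambda>x. Z \<sigma> x - f \<sigma> x) ?e)\<bar> \<le> 2 * \<bar>lam\<bar> * (G * sqrt (h \<sigma>) + 2 * h \<sigma>)"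
      by (intro mult_left_mono) auto
    moreover have "h' \<sigma> \<le> 2 * \<bar>lam\<bar> * \<bar>Im (ip (\<lambda>x. Z \<sigma> x - f \<sigma> x) ?e)\<bar>"
      unfolding h'_eq by (rule order_trans[OF abs_ge_self]) (simp add: abs_mult)
    ultimately show ?thesis by (simp add: algebra_simps)
  qed
  have h0: "0 \<le> h \<sigma>" for \<sigma> by (simp add: h_def)
  have "sqrt (h \<tau>) \<le> exp (2 * \<bar>lam\<bar> * \<tau>) * (sqrt (h 0) + \<bar>lam\<bar> * \<tau> * G)"
    by (rule sqrt_Gronwall[OF \<tau> ch dh bound h0 abs_ge_zero G0])
  moreover have "sqrt (h \<sigma>) = L2_norm (\<lambda>x. y \<sigma> x - w \<sigma> x)" for \<sigma>
    unfolding h_def by (subst L2_norm_uminus_diff) simp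
  ultimately show ?thesis by (simp add: y_def w_def)
qed

lemma L2_norm_trig_unimodular:
  assumes "\<And>k. k \<in> freqs N \<Longrightarrow> cmod (e k) = 1"
  shows "L2_norm (trig (freqs N) (\<lambda>k. e k * c k) :: real^'d \<Rightarrow> complex) = L2_norm (trig (freqs N) c)"
proof (rule power2_eq_imp_eq)
  show "(L2_norm (trig (freqs N) (\<lambda>k. e k * c k)))\<^sup>2 = (L2_norm (trig (freqs N) c))\<^sup>2"
    unfolding L2_norm_trig[OF finite_freqs freqs_subset]
    by (intro arg_cong2[where f="(*)"] sum.cong refl) (simp add: norm_mult assms)
qed simp_all

text \<open>The projection fixes the polynomial with coefficients b and does not increase norms;
  rotating back by the free flow is unitary on each mode and turns b into a. So completing the step
  cannot increase the distance reached in the moving frame.\<close>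

lemma L2_norm_projected_step_le:
  fixes g :: "real^'d \<Rightarrow> complex"
  assumes g: "sqint g" and b: "\<And>k. k \<in> freqs N \<Longrightarrow> b k = exp (\<i> * complex_of_real (\<tau> * (norm k)\<^sup>2)) * a k"
  shows "L2_norm (\<lambda>x. trig (freqs N) a x - flow_A \<tau> (proj N g) x) \<le> L2_norm (\<lambda>x. trig (freqs N) b x - g x)"
proof -
  let ?e = "\<lambda>k::real^'d. exp (- \<i> * complex_of_real ((norm k)\<^sup>2 * \<tau>))"
  have "(\<lambda>x. trig (freqs N) a x - flow_A \<tau> (proj N g) x) = trig (freqs N) (\<lambda>k. ?e k * (b k - fourier_coeff g k))"
  proof
    fix x
    have "a k = ?e k * b k" if "k \<in> freqs N" for k
    proof -
      have "?e k * exp (\<i> * complex_of_real (\<tau> * (norm k)\<^sup>2)) = 1"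
        unfolding exp_add[symmetric] by (simp add: mult.commute)
      moreover have "?e k * b k = (?e k * exp (\<i> * complex_of_real (\<tau> * (norm k)\<^sup>2))) * a k"
        by (simp only: b[OF that] mult.assoc)
      ultimately show ?thesis by simp
    qed
    then show "trig (freqs N) a x - flow_A \<tau> (proj N g) x = trig (freqs N) (\<lambda>k. ?e k * (b k - fourier_coeff g k)) x"
      unfolding flow_A_proj trig_def sum_subtractf[symmetric]
      by (intro sum.cong refl) (simp add: right_diff_distrib left_diff_distrib mult.assoc)
  qed
  then have "L2_norm (\<lambda>x. trig (freqs N) a x - flow_A \<tau> (proj N g) x) = L2_norm (trig (freqs N) (\<lambda>k. b k - fourier_coeff g k))"
    by (simp only:) (rule L2_norm_trig_unimodular, simp)
  also have "trig (freqs N) (\<lambda>k. b k - fourier_coeff g k) = proj N (\<lambda>x. trig (freqs N) b x - g x)"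
    unfolding proj_eq_trig trig_def[of "freqs N" "\<lambda>k. b k - fourier_coeff g k"] trig_def[of "freqs N" "fourier_coeff _"]
    by (intro ext sum.cong refl)
       (simp add: fourier_coeff_diff[OF sqint_trig g] fourier_coeff_trig freqs_subset subsetD[OF freqs_subset])
  also have "L2_norm \<dots> \<le> L2_norm (\<lambda>x. trig (freqs N) b x - g x)"
    by (intro L2_norm_proj_le sqint_diff sqint_trig g)
  finally show ?thesis .
qed

subsection \<open>The error bound\<close>

lemma Linf_norm_AE_bound:
  assumes "Linf_norm (f :: real^'d \<Rightarrow> complex) < \<infinity>"
  obtains B where "AE x in tm. cmod (f x) \<le> B"
proof -
  have AE: "AE x in tm. ereal (cmod (f x)) \<le> Linf_norm f"
    unfolding Linf_norm_def by (rule esssup_AE)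
  show ?thesis
  proof (cases "Linf_norm f")
    case (real B)
    then show ?thesis using AE that[of B] by simp
  next
    case MInf
    have "AE x in tm. cmod (f x) \<le> 0" using AE by eventually_elim (simp add: MInf)
    then show ?thesis by (rule that)
  qed (use assms in simp)
qed

text \<open>Positivity of the measure of the cell matters: over a null space an essential supremum
  would be minus infinity.\<close>

lemma Linf_norm_nonneg: "0 \<le> Linf_norm (f :: real^'d \<Rightarrow> complex)"
proof -
  have "measure tm (space (tm :: (real^'d) measure)) \<noteq> 0" by (simp add: measure_torus)
  then have "emeasure tm (space (tm :: (real^'d) measure)) \<noteq> 0" by (metis measure_eq_emeasure_eq_ennreal emeasure_eq_measure2 measure_def enn2real_0)
  then have "esssup (tm :: (real^'d) measure) (\<lambda>x. 0 :: ereal) = 0" by (rule esssup_const)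
  moreover have "esssup (tm :: (real^'d) measure) (\<lambda>x. 0 :: ereal) \<le> Linf_norm f"
    unfolding Linf_norm_def by (rule esssup_mono) auto
  ultimately show ?thesis by simp
qed

lemma C_fun_nonneg:
  assumes "0 < T" shows "0 \<le> C_fun T (u0 :: real^'d \<Rightarrow> complex) u"
proof -
  have "0 \<le> Linf_norm (u T)" by (rule Linf_norm_nonneg)
  also have "\<dots> \<le> sup_Linf_norm T u" unfolding sup_Linf_norm_def using assms by (intro SUP_upper) auto
  finally have "0 \<le> ln1p_ereal (sup_Linf_norm T u)"
    by (cases "sup_Linf_norm T u") (auto simp: ln1p_ereal_def)
  then show ?thesis by (simp add: C_fun_def)
qed

text \<open>\<open>logSE_solution\<close> leaves \<open>u 0\<close> free and attains the initial
  value only as an L2 limit. Inserting \<open>u0\<close> at time 0 yields coefficients that are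
  continuous on the closed interval, as the first time step requires.\<close>

lemma initial_extended_coeff_continuous:
  fixes u :: "real \<Rightarrow> real^'d \<Rightarrow> complex"
  assumes sol: "logSE_solution lam T u0 u" and T: "0 < T" and u0: "u0 \<in> L2" and k: "k \<in> int_lattice"
  shows "continuous_on {0..T} (\<lambda>t. fourier_coeff (if t = 0 then u0 else u t) k)"
  unfolding continuous_on
proof
  let ?a = "\<lambda>t. fourier_coeff (if t = 0 then u0 else u t) k"
  fix t assume t: "t \<in> {0..T}"
  show "(?a \<longlongrightarrow> ?a t) (at t within {0..T})"
  proof (cases "t = 0")
    case True
    have "(?a \<longlongrightarrow> fourier_coeff u0 k) (at_right 0)"
    proof (rule Lim_transform_eventually[OF fourier_coeff_initial[OF sol T u0, of k]])
      show "\<forall>\<^sub>F t in at_right 0. fourier_coeff (u t) k = ?a t"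
        by (rule eventually_at_rightI[of 0 1]) auto
    qed
    then show ?thesis using True T by (simp add: at_within_Icc_at_right)
  next
    case False
    then have t0: "0 < t" "t \<le> T" using t by auto
    have "((\<lambda>t. fourier_coeff (u t) k) \<longlongrightarrow> fourier_coeff (u t) k) (at t within {0<..T})"
      using has_vector_derivative_continuous[OF fourier_coeff_evolution[OF sol t0 k]]
      by (simp add: continuous_within)
    then have "(?a \<longlongrightarrow> fourier_coeff (u t) k) (at t within {0<..T})"
      by (rule Lim_transform_eventually) (auto simp: eventually_at_filter)
    also have "at t within {0<..T} = at t within {0..T}"
      by (rule at_within_nhd[of t "{0<..}"]) (use t0 in auto)
    finally show ?thesis using False by simp
  qed
qed

text \<open>Comparison with the projected exact solution makes the initial error zero. Each step
  amplifies the error by exp (2 |\<lambda>| \<tau>) and adds the source |\<lambda>| \<tau> G;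
  bounding every amplification by the full exponential yields n times the source.\<close>

lemma lie_trotter_error:
  fixes u :: "real \<Rightarrow> real^'d \<Rightarrow> complex"
  assumes sol: "logSE_solution lam T u0 u" and T: "0 < T" and u0: "u0 \<in> L2" and \<tau>: "0 < \<tau>"
    and G0: "0 \<le> G"
    and G: "\<And>t \<sigma>. 0 < t \<Longrightarrow> t \<le> T \<Longrightarrow> 0 \<le> \<sigma> \<Longrightarrow> \<sigma> \<le> \<tau> \<Longrightarrow> \<tau> \<le> T \<Longrightarrow>
      L2_norm (\<lambda>x. schr N \<sigma> (\<lambda>x. log_nonlin (u t x)) x - log_nonlin (schr N \<sigma> (u t) x)) \<le> G"
  shows "real n * \<tau> \<le> T \<Longrightarrow>
    L2_norm (\<lambda>x. trig (freqs N) (fourier_coeff (if n = 0 then u0 else u (real n * \<tau>))) x - lie_trotter lam \<tau> N u0 n x)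
      \<le> exp (2 * \<bar>lam\<bar> * (real n * \<tau>)) * (real n * (\<bar>lam\<bar> * \<tau> * G))"
proof (induction n)
  case 0
  show ?case by (simp add: proj_eq_trig L2_norm_def)
next
  case (Suc n)
  define t0 where "t0 = real n * \<tau>"
  define a where "a t = fourier_coeff (if t = 0 then u0 else u t)" for t
  define w where "w = lie_trotter lam \<tau> N u0 n"
  \<comment> \<open>The interaction picture: mode k of the exact solution with its free rotation
    since time \<open>t0\<close> undone. \<open>B\<close> is the same transform of the
    nonlinearity.\<close>
  define b where "b \<sigma> k = exp (\<i> * complex_of_real (\<sigma> * (norm k)\<^sup>2)) * a (t0 + \<sigma>) k" for \<sigma> k
  define B where "B \<sigma> k = exp (\<i> * complex_of_real (\<sigma> * (norm k)\<^sup>2)) * fourier_coeff (\<lambda>x. log_nonlin (u (t0 + \<sigma>) x)) k" for \<sigma> k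
  have t0: "0 \<le> t0" using \<tau> by (simp add: t0_def)
  have t1: "t0 + \<tau> = real (Suc n) * \<tau>" by (simp add: t0_def algebra_simps)
  have t1T: "t0 + \<tau> \<le> T" using Suc.prems t1 by simp
  have a0: "a t0 = fourier_coeff (if n = 0 then u0 else u (real n * \<tau>))"
    using \<tau> by (simp add: a_def t0_def)
  have a1: "a (t0 + \<tau>) = fourier_coeff (u (real (Suc n) * \<tau>))"
    using \<tau> t0 by (simp add: a_def t1 del: of_nat_Suc)
  have step: "L2_norm (\<lambda>x. trig (freqs N) (b \<tau>) x - flow_B lam \<tau> w x)
    \<le> exp (2 * \<bar>lam\<bar> * \<tau>) * (L2_norm (\<lambda>x. trig (freqs N) (b 0) x - w x) + \<bar>lam\<bar> * \<tau> * G)"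
  proof (rule splitting_step[where B = B])
    show "continuous_on UNIV w" unfolding w_def by (rule continuous_on_lie_trotter)
    fix k :: "real^'d" assume "k \<in> freqs N"
    then have k: "k \<in> int_lattice" using freqs_subset by blast
    have "continuous_on {0..T} (\<lambda>t. a t k)"
      unfolding a_def by (rule initial_extended_coeff_continuous[OF sol T u0 k])
    then have "continuous_on {0..\<tau>} (\<lambda>\<sigma>. a (t0 + \<sigma>) k)"
      by (rule continuous_on_compose2) (use t0 t1T in \<open>auto intro!: continuous_intros\<close>)
    then show "continuous_on {0..\<tau>} (\<lambda>\<sigma>. b \<sigma> k)"
      unfolding b_def by (intro continuous_intros)
  next
    fix k :: "real^'d" and \<sigma> assume k: "k \<in> freqs N" and \<sigma>: "0 < \<sigma>" "\<sigma> < \<tau>"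
    let ?t = "t0 + \<sigma>" and ?n2 = "complex_of_real ((norm k)\<^sup>2)"
    let ?d = "- \<i> * ?n2 * a ?t k - \<i> * complex_of_real lam * fourier_coeff (\<lambda>x. log_nonlin (u ?t x)) k"
    have t: "0 < ?t" "?t < T" using t0 t1T \<sigma> by auto
    have at: "a ?t k = fourier_coeff (u ?t) k" using t by (simp add: a_def)
    have "((\<lambda>t. fourier_coeff (u t) k) has_vector_derivative ?d) (at ?t within {0<..T})"
      unfolding at using t k freqs_subset by (intro fourier_coeff_evolution[OF sol]) auto
    \<comment> \<open>Since \<sigma> < \<tau>, the time lies strictly inside (0, T), where the
      one-sided notion of derivative becomes two-sided.\<close>
    then have "((\<lambda>t. fourier_coeff (u t) k) has_vector_derivative ?d) (at ?t within {0<..<T})"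
      by (rule has_vector_derivative_within_subset) auto
    then have "((\<lambda>t. fourier_coeff (u t) k) has_vector_derivative ?d) (at ?t)"
      using t by (subst (asm) at_within_open) auto
    then have "((\<lambda>t. a t k) has_vector_derivative ?d) (at ?t)"
      by (rule has_vector_derivative_transform_within_open[of _ _ _ "{0<..<T}"]) (use t in \<open>auto simp: a_def\<close>)
    moreover have "((\<lambda>\<sigma>. t0 + \<sigma>) has_vector_derivative 1) (at \<sigma>)"
      by (auto intro!: derivative_eq_intros)
    ultimately have da: "((\<lambda>\<sigma>. a (t0 + \<sigma>) k) has_vector_derivative ?d) (at \<sigma>)"
      using vector_diff_chain_at[of "\<lambda>\<sigma>. t0 + \<sigma>" 1 \<sigma> "\<lambda>t. a t k" ?d] by (simp add: o_def)
    have de: "((\<lambda>\<sigma>. exp (\<i> * complex_of_real (\<sigma> * (norm k)\<^sup>2))) has_vector_derivative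
        \<i> * ?n2 * exp (\<i> * complex_of_real (\<sigma> * (norm k)\<^sup>2))) (at \<sigma>)"
    proof -
      have "((\<lambda>z. exp (\<i> * (z * ?n2))) has_field_derivative \<i> * ?n2 * exp (\<i> * (complex_of_real \<sigma> * ?n2))) (at (complex_of_real \<sigma>))"
        by (auto intro!: derivative_eq_intros)
      from has_vector_derivative_real_field[OF this] show ?thesis by simp
    qed
    have "((\<lambda>\<sigma>. b \<sigma> k) has_vector_derivative
        exp (\<i> * complex_of_real (\<sigma> * (norm k)\<^sup>2)) * ?d + \<i> * ?n2 * exp (\<i> * complex_of_real (\<sigma> * (norm k)\<^sup>2)) * a ?t k) (at \<sigma>)"
      unfolding b_def by (rule has_vector_derivative_mult[OF de da])
    \<comment> \<open>The derivative of the rotation cancels the Laplacian term, leaving the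
      nonlinearity alone.\<close>
    moreover have "exp (\<i> * complex_of_real (\<sigma> * (norm k)\<^sup>2)) * ?d + \<i> * ?n2 * exp (\<i> * complex_of_real (\<sigma> * (norm k)\<^sup>2)) * a ?t k
        = - \<i> * complex_of_real lam * B \<sigma> k"
      by (simp add: B_def algebra_simps)
    ultimately show "((\<lambda>\<sigma>. b \<sigma> k) has_vector_derivative (- \<i> * complex_of_real lam * B \<sigma> k)) (at \<sigma>)" by simp
  next
    fix \<sigma> assume \<sigma>: "0 < \<sigma>" "\<sigma> < \<tau>"
    have t: "0 < t0 + \<sigma>" "t0 + \<sigma> \<le> T" "\<tau> \<le> T" using t0 t1T \<sigma> by auto
    have "trig (freqs N) (B \<sigma>) = schr N \<sigma> (\<lambda>x. log_nonlin (u (t0 + \<sigma>) x))"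
      unfolding schr_def by (intro arg_cong[where f="trig (freqs N)"] ext) (simp only: B_def)
    moreover have "trig (freqs N) (b \<sigma>) = schr N \<sigma> (u (t0 + \<sigma>))"
      unfolding schr_def using t by (intro arg_cong[where f="trig (freqs N)"] ext) (simp add: b_def a_def)
    ultimately show "L2_norm (\<lambda>x. trig (freqs N) (B \<sigma>) x - log_nonlin (trig (freqs N) (b \<sigma>) x)) \<le> G"
      using G[OF t(1,2) _ _ t(3), of \<sigma>] \<sigma> by simp
  qed (fact \<tau> G0)+
  have b0: "b 0 = a t0" by (simp add: b_def fun_eq_iff)
  have sw: "sqint w" unfolding w_def by (intro sqint_continuous continuous_on_lie_trotter)
  let ?x = "\<bar>lam\<bar> * \<tau> * G" and ?E = "exp (2 * \<bar>lam\<bar> * (real n * \<tau>))"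
  have x0: "0 \<le> ?x" using \<tau> G0 by simp
  have "L2_norm (\<lambda>x. trig (freqs N) (a (t0 + \<tau>)) x - flow_A \<tau> (proj N (flow_B lam \<tau> w)) x)
      \<le> L2_norm (\<lambda>x. trig (freqs N) (b \<tau>) x - flow_B lam \<tau> w x)"
    by (rule L2_norm_projected_step_le[OF sqint_flow_B[OF sw]]) (simp add: b_def)
  also note step
  also have "exp (2 * \<bar>lam\<bar> * \<tau>) * (L2_norm (\<lambda>x. trig (freqs N) (b 0) x - w x) + ?x)
      \<le> exp (2 * \<bar>lam\<bar> * \<tau>) * (?E * (real n * ?x) + ?E * ?x)"
  proof (intro mult_left_mono add_mono)
    have "real n * \<tau> \<le> T" using t1T \<tau> by (simp add: t0_def)
    from Suc.IH[OF this] show "L2_norm (\<lambda>x. trig (freqs N) (b 0) x - w x) \<le> ?E * (real n * ?x)"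
      by (simp only: b0 a0 w_def)
    have "1 \<le> ?E" using \<tau> by simp
    from mult_right_mono[OF this x0] show "?x \<le> ?E * ?x" by simp
  qed simp
  also have "\<dots> = (exp (2 * \<bar>lam\<bar> * \<tau>) * ?E) * (real (Suc n) * ?x)" by (simp add: algebra_simps)
  also have "exp (2 * \<bar>lam\<bar> * \<tau>) * ?E = exp (2 * \<bar>lam\<bar> * (real (Suc n) * \<tau>))"
    by (simp add: algebra_simps flip: exp_add)
  finally show ?case by (simp add: a1 w_def del: of_nat_Suc)
qed

theorem theorem3p1:
  fixes T s :: real
  assumes "0 < T" and "0 < s" and "s < 1"
  shows "\<exists>C :: real \<Rightarrow> real. \<forall>lam :: real. lam \<noteq> 0 \<longrightarrow>
    C \<bar>lam\<bar> > 0 \<and>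
    (\<forall>(u0 :: real^'d \<Rightarrow> complex) (u :: real \<Rightarrow> real^'d \<Rightarrow> complex) (\<tau> :: real) (N :: nat) (m :: nat).
       u0 \<in> L2 \<longrightarrow> logSE_solution lam T u0 u \<longrightarrow> C_Hs_Linf s T u \<longrightarrow>
       0 < \<tau> \<longrightarrow> 2 \<le> N \<longrightarrow> m < nat \<lfloor>T / \<tau>\<rfloor> \<longrightarrow>
       ereal (L2_norm (\<lambda>x. u (real (m + 1) * \<tau>) x - lie_trotter lam \<tau> N u0 (m + 1) x))
         \<le> ereal (C \<bar>lam\<bar> * exp (2 * \<bar>lam\<bar> * T)) *
           (C_fun T u0 u + ereal (ln (real N))) *
           ereal (\<tau> powr (s / 2) + real N powr (- s)) *
           sup_Hs_seminorm s T u)"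
proof -
  obtain K where K: "0 < K"
    "\<And>(U :: real^'d \<Rightarrow> complex) R B \<sigma> \<tau> N. hs_bound s R U \<Longrightarrow> AE x in tm. cmod (U x) \<le> B \<Longrightarrow> 0 < R \<Longrightarrow>
      2 \<le> N \<Longrightarrow> 0 \<le> \<sigma> \<Longrightarrow> \<sigma> \<le> \<tau> \<Longrightarrow> 0 < \<tau> \<Longrightarrow> \<tau> \<le> T \<Longrightarrow>
      sqint (\<lambda>x. log_nonlin (U x)) \<and>
      L2_norm (\<lambda>x. schr N \<sigma> (\<lambda>x. log_nonlin (U x)) x - log_nonlin (schr N \<sigma> U x))
        \<le> K * ln (real N) * (\<tau> powr (s / 2) + real N powr (- s)) * R"
    using log_commutator_bound[OF assms(2,3)] by blast
  \<comment> \<open>1 / ln 2 pays for the projection error of the exact solution, which carries no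
    logarithm and is absorbed using N \<ge> 2; l T K is the accumulated commutator source over total
    time at most T.\<close>
  define C where "C l = 1 / ln 2 + l * T * K" for l :: real
  have Cpos: "C \<bar>lam\<bar> > 0" for lam
    unfolding C_def using K(1) assms(1) by (intro add_pos_nonneg) auto
  have main: "ereal (L2_norm (\<lambda>x. u (real (m + 1) * \<tau>) x - lie_trotter lam \<tau> N u0 (m + 1) x))
         \<le> ereal (C \<bar>lam\<bar> * exp (2 * \<bar>lam\<bar> * T)) * (C_fun T u0 u + ereal (ln (real N))) *
           ereal (\<tau> powr (s / 2) + real N powr (- s)) * sup_Hs_seminorm s T u"
    if u0: "u0 \<in> L2" and sol: "logSE_solution lam T u0 u" and reg: "C_Hs_Linf s T u"
      and \<tau>: "0 < \<tau>" and N: "2 \<le> N" and m: "m < nat \<lfloor>T / \<tau>\<rfloor>"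
    for lam \<tau> :: real and u0 :: "real^'d \<Rightarrow> complex" and u and N m :: nat
  proof -
    define t where "t = real (m + 1) * \<tau>"
    define \<delta> where "\<delta> = \<tau> powr (s / 2) + real N powr (- s)"
    define X where "X = L2_norm (\<lambda>x. u t x - lie_trotter lam \<tau> N u0 (m + 1) x)"
    define E where "E = exp (2 * \<bar>lam\<bar> * T)"
    define S where "S = sup_Hs_seminorm s T u"
    have "real (m + 1) \<le> T / \<tau>"
    proof -
      have "int (m + 1) \<le> \<lfloor>T / \<tau>\<rfloor>" using m by linarith
      then show ?thesis by (simp add: le_floor_iff)
    qed
    then have "t \<le> T" unfolding t_def using \<tau> by (simp only: pos_le_divide_eq)
    moreover have "0 < t" unfolding t_def using \<tau> by (intro mult_pos_pos) auto
    ultimately have t: "0 < t" "t \<le> T" by auto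
    have lnN: "ln 2 \<le> ln (real N)" "0 < ln (real N)" using N by auto
    have \<delta>: "0 < \<delta>" "real N powr (- s) \<le> \<delta>" using \<tau> N by (auto simp: \<delta>_def intro!: add_pos_pos)
    have E: "1 \<le> E" using assms(1) by (simp add: E_def)
    \<comment> \<open>Stated for an arbitrary positive real majorant R of the seminorms, because the
      supremum over (0, T] is an extended real that may be infinite.\<close>
    have real_bound: "X \<le> (C \<bar>lam\<bar> * E * ln (real N) * \<delta>) * R"
      if R: "0 < R" and seminorm: "\<And>t. 0 < t \<Longrightarrow> t \<le> T \<Longrightarrow> Hs_seminorm s (u t) \<le> R" for R
    proof -
      let ?G = "K * ln (real N) * \<delta> * R"
      have G0: "0 \<le> ?G" using K(1) lnN \<delta> R by simp
      have hs: "hs_bound s R (u r)" if "0 < r" "r \<le> T" for r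
        using reg that assms(2) seminorm[OF that] unfolding C_Hs_Linf_def by (intro Hs_imp_hs_bound) auto
      have "L2_norm (\<lambda>x. schr N \<sigma> (\<lambda>x. log_nonlin (u r x)) x - log_nonlin (schr N \<sigma> (u r) x)) \<le> ?G"
        if r: "0 < r" "r \<le> T" and \<sigma>: "0 \<le> \<sigma>" "\<sigma> \<le> \<tau>" "\<tau> \<le> T" for r \<sigma>
      proof -
        have "Linf_norm (u r) < \<infinity>" using reg r unfolding C_Hs_Linf_def by auto
        then obtain B where "AE x in tm. cmod (u r x) \<le> B" by (rule Linf_norm_AE_bound)
        from K(2)[OF hs[OF r] this R N \<sigma>(1,2) \<tau> \<sigma>(3)] show ?thesis unfolding \<delta>_def by blast
      qed
      from lie_trotter_error[OF sol assms(1) u0 \<tau> G0 this, of "m + 1"] t(2)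
      have "L2_norm (\<lambda>x. proj N (u t) x - lie_trotter lam \<tau> N u0 (m + 1) x)
          \<le> exp (2 * \<bar>lam\<bar> * t) * (real (m + 1) * (\<bar>lam\<bar> * \<tau> * ?G))"
        unfolding t_def proj_eq_trig by simp
      also have "\<dots> = exp (2 * \<bar>lam\<bar> * t) * (t * (\<bar>lam\<bar> * ?G))" by (simp add: t_def)
      also have "\<dots> \<le> E * (T * (\<bar>lam\<bar> * ?G))"
      proof (rule mult_mono)
        have "\<bar>lam\<bar> * t \<le> \<bar>lam\<bar> * T" using t by (intro mult_left_mono) auto
        then show "exp (2 * \<bar>lam\<bar> * t) \<le> E" by (simp add: E_def)
        have "0 \<le> \<bar>lam\<bar> * ?G" by (rule mult_nonneg_nonneg[OF abs_ge_zero G0])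
        then show "t * (\<bar>lam\<bar> * ?G) \<le> T * (\<bar>lam\<bar> * ?G)" "0 \<le> t * (\<bar>lam\<bar> * ?G)"
          using t by (auto intro: mult_right_mono mult_nonneg_nonneg)
      qed (use E in simp)
      finally have 1: "L2_norm (\<lambda>x. proj N (u t) x - lie_trotter lam \<tau> N u0 (m + 1) x) \<le> E * (T * (\<bar>lam\<bar> * ?G))" .
      have su: "sqint (u t)" by (rule hs_bound_sqint[OF hs[OF t]])
      have "L2_norm (\<lambda>x. u t x - proj N (u t) x) \<le> real N powr (- s) * R"
        using R N by (intro proj_error hs t assms) auto
      also have "\<dots> \<le> \<delta> * R" using \<delta> R by (intro mult_right_mono) auto
      also have "\<dots> \<le> E * (ln (real N) / ln 2) * (\<delta> * R)"
      proof -
        have "1 \<le> ln (real N) / ln 2" using lnN by (simp add: le_divide_eq)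
        then have "1 * 1 \<le> E * (ln (real N) / ln 2)" using E by (intro mult_mono) auto
        from mult_right_mono[OF this, of "\<delta> * R"] show ?thesis using \<delta> R by simp
      qed
      finally have 2: "L2_norm (\<lambda>x. u t x - proj N (u t) x) \<le> E * (ln (real N) / ln 2) * (\<delta> * R)" .
      have "X \<le> L2_norm (\<lambda>x. u t x - proj N (u t) x) + L2_norm (\<lambda>x. proj N (u t) x - lie_trotter lam \<tau> N u0 (m + 1) x)"
        unfolding X_def by (intro L2_norm_dist_triangle su sqint_proj sqint_continuous continuous_on_lie_trotter)
      also have "\<dots> \<le> E * (ln (real N) / ln 2) * (\<delta> * R) + E * (T * (\<bar>lam\<bar> * ?G))"
        by (rule add_mono[OF 2 1])
      also have "\<dots> = (C \<bar>lam\<bar> * E * ln (real N) * \<delta>) * R"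
        by (simp only: C_def distrib_left distrib_right times_divide_eq_left times_divide_eq_right mult_1_left mult_ac)
      finally show ?thesis .
    qed
    let ?c = "C \<bar>lam\<bar> * E * ln (real N) * \<delta>"
    have c: "0 < ?c" using Cpos E lnN \<delta> by simp
    have semi0: "0 \<le> Hs_seminorm s (u T)"
      unfolding Hs_seminorm_def by (intro mult_nonneg_nonneg real_sqrt_ge_zero infsum_nonneg) auto
    have le_S: "ereal (Hs_seminorm s (u r)) \<le> S" if "0 < r" "r \<le> T" for r
      unfolding S_def sup_Hs_seminorm_def using that by (intro SUP_upper) auto
    have S0: "0 \<le> S" using le_S[of T] semi0 assms(1) by (metis ereal_less_eq(5) order_refl order_trans)
    have "ereal X \<le> ereal ?c * S"
    proof (cases S)
      case (real r)
      \<comment> \<open>\<open>real_bound\<close> asks for R > 0, as the lower clamping level is at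
        least N^(-s) R. A supremum r that may be 0 is therefore approached by R = r + e / c.\<close>
      have "X \<le> ?c * r"
      proof (rule field_le_epsilon)
        fix e :: real assume e: "0 < e"
        have "0 \<le> r" using S0 real by simp
        then have r': "0 < r + e / ?c" using e c by (intro add_nonneg_pos) auto
        have "Hs_seminorm s (u q) \<le> r + e / ?c" if "0 < q" "q \<le> T" for q
          using le_S[OF that] real e c by (simp add: add_increasing2)
        from real_bound[OF r' this] have "X \<le> ?c * (r + e / ?c)" .
        also have "\<dots> = ?c * r + e"
          by (simp only: distrib_left times_divide_eq_right nonzero_mult_div_cancel_left[OF less_imp_neq[OF c, symmetric]])
        finally show "X \<le> ?c * r + e" .
      qed
      then show ?thesis by (simp add: real)
    next
      \<comment> \<open>In \<open>ereal\<close> 0 * \<infinity> = 0, so strict positivity of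
        \<open>?c\<close> is what makes the right side infinite here.\<close>
      case PInf
      have "ereal a * \<infinity> = \<infinity>" if "0 < a" for a using that by simp
      from this[OF c] show ?thesis by (simp only: PInf ereal_less_eq)
    qed (use S0 in simp)
    also have "ereal ?c * S = ereal (C \<bar>lam\<bar> * E) * ereal (ln (real N)) * ereal \<delta> * S" by simp
    also have "\<dots> \<le> ereal (C \<bar>lam\<bar> * E) * (C_fun T u0 u + ereal (ln (real N))) * ereal \<delta> * S"
    proof (intro ereal_mult_right_mono ereal_mult_left_mono)
      show "ereal (ln (real N)) \<le> C_fun T u0 u + ereal (ln (real N))"
        using C_fun_nonneg[OF assms(1), of u0 u] by (simp add: add_increasing)
      show "0 \<le> ereal (C \<bar>lam\<bar> * E)" using Cpos[of lam] E by simp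
    qed (use S0 \<delta> in auto)
    finally show ?thesis by (simp only: X_def t_def E_def \<delta>_def S_def)
  qed
  show ?thesis using Cpos main by (intro exI[of _ C]) blast
qed

end
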